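(* Let $S_3$ be the permutation group of three elements, let $s'=(1\,2)$, $t'=(1\,2\,3)$, and let $S'=\{t',t'^{-1},s'\}$ be the symmetric generating set built of a transposition and of a cycle. The quantum group of orientation preserving isometries $\mathrm{QISO}^+(S_3,S')$ is isomorphic to $C^*(S_3)\oplus C^*(S_3)$ as a $C^*$-algebra. Its action on $C^*(S_3)$ is given by the formula $$\alpha(\lambda_{t'})=\lambda_{t'}\otimes E+\lambda_{t'^{-1}}\otimes F,\qquad \alpha(\lambda_{s'})=\lambda_{s'}\otimes L,$$ where $E,F,L$ are respectively identified with $\lambda_{t'}\oplus0,\ 0\oplus\lambda_{t'},\ \lambda_{s'}\oplus\lambda_{s'}\in C^*(S_3)\oplus C^*(S_3)$. The coproduct of $\mathrm{QISO}^+(S_3,S')$ can be read out from the condition that $$\begin{pmatrix} E & F & 0 \\ F^2 & E^2 & 0 \\ 0 & 0 & L \end{pmatrix}$$ is the fundamental corepresentation.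
   Context: Let $\Gamma$ be a discrete group with a finite symmetric generating set $S$ and associated word-length function $l$. $C^*_r(\Gamma)$ is generated by the left regular representation unitaries $\lambda_\gamma$ on $\ell^2(\Gamma)$ (for $\Gamma$ finite or abelian $C^*_r(\Gamma)=C^*(\Gamma)$), and $\tau$ is the canonical trace, $\tau(\lambda_\gamma)=\delta_{\gamma,e}$. All $C^*$-tensor products are minimal; $\otimes_{\mathrm{alg}}$ is algebraic. A matrix $u=(u_{ij})$ over a compact quantum group $(\mathsf Q,\Delta)$ is a (finite-dimensional) corepresentation if $\Delta(u_{ij})=\sum_k u_{ik}\otimes u_{kj}$; it is fundamental if it is unitary and its entries generate $\mathsf Q$ as a $C^*$-algebra. An action of $(\mathsf Q,\Delta)$ on a unital $C^*$-algebra $\mathsf A$ is a unital $^*$-homomorphism $\alpha:\mathsf A\to\mathsf A\otimes\mathsf Q$ that satisfies the coaction identity with respect to $\Delta$ and for which $\mathrm{Lin}\,\alpha(\mathsf A)(1\otimes\mathsf Q)$ is dense in $\mathsf A\otimes\mathsf Q$. Convention: the order of the two $\mathsf Q$-legs in the coaction identity is the one matching the displayed matrix, namely $(\alpha\otimes\mathrm{id})\alpha=(\mathrm{id}\otimes\sigma\Delta)\alpha$, with $\sigma$ the flip on $\mathsf Q\otimes\mathsf Q$. (With the other common order, $(\alpha\otimes\mathrm{id})\alpha=(\mathrm{id}\otimes\Delta)\alpha$, the coproduct is replaced by its opposite.) $\mathrm{QISO}^+(\Gamma,S)$, the quantum group of orientation preserving isometries of the spectral triple $(\mathbb{C}[\Gamma],\ell^2(\Gamma),D_\Gamma)$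 with $D_\Gamma\delta_\gamma=l(\gamma)\delta_\gamma$, is (characterized, up to isomorphism, as) the universal (initial) object in the category of pairs $(\mathsf Q,\alpha)$, where $\mathsf Q$ is a compact quantum group and $\alpha$ is an action of $\mathsf Q$ on $C^*_r(\Gamma)$ such that $(\tau\otimes\mathrm{id})\alpha(a)=\tau(a)1_{\mathsf Q}$ for all $a$, and $\alpha(\lambda_\gamma)\in\mathrm{Lin}\{\lambda_{\gamma'}:l(\gamma')=l(\gamma)\}\otimes_{\mathrm{alg}}\mathsf Q$ for all $\gamma\in\Gamma$ (i.e. $\alpha$ commutes with the map $\lambda_\gamma\mapsto l(\gamma)\lambda_\gamma$ on $\mathbb{C}[\Gamma]$). Morphisms $(\mathsf Q,\alpha)\to(\mathsf Q',\alpha')$ are compact quantum group morphisms $\Phi:\mathsf Q\to\mathsf Q'$ with $(\mathrm{id}\otimes\Phi)\alpha=\alpha'$. *)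

theory Defs
  imports "HOL-Analysis.Analysis" "HOL-Algebra.Sym_Groups"
begin

section \<open>The Hilbert space of square-summable functions on an index type\<close>

definition square_summable :: "('i \<Rightarrow> complex) \<Rightarrow> bool" where
  "square_summable f \<longleftrightarrow> (\<lambda>i. (cmod (f i))\<^sup>2) summable_on UNIV"

lemma square_summable_prod:
  assumes "square_summable f" "square_summable g"
  shows "(\<lambda>i. cnj (f i) * g i) summable_on UNIV"
proof -
  have "(\<lambda>i. (cmod (f i))\<^sup>2 + (cmod (g i))\<^sup>2) summable_on UNIV"
    using assms unfolding square_summable_def by (rule summable_on_add)
  then have "(\<lambda>i. norm (cnj (f i) * g i)) summable_on UNIV"
  proof (rule summable_on_comparison_test)
    fix i
    have "2 * (cmod (f i) * cmod (g i)) \<le> (cmod (f i))\<^sup>2 + (cmod (g i))\<^sup>2"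
      using sum_squares_bound[of "cmod (f i)" "cmod (g i)"] by (simp add: mult.assoc)
    moreover have "0 \<le> cmod (f i) * cmod (g i)" by simp
    ultimately show "norm (cnj (f i) * g i) \<le> (cmod (f i))\<^sup>2 + (cmod (g i))\<^sup>2"
      unfolding norm_mult complex_mod_cnj by linarith
  qed auto
  then show ?thesis by (rule abs_summable_summable)
qed

lemma square_summable_add:
  assumes "square_summable f" "square_summable g"
  shows "square_summable (\<lambda>i. f i + g i)"
proof -
  have "(\<lambda>i. 2 * (cmod (f i))\<^sup>2 + 2 * (cmod (g i))\<^sup>2) summable_on UNIV"
    using assms unfolding square_summable_def
    by (intro summable_on_add summable_on_cmult_right)
  then show ?thesis unfolding square_summable_def
  proof (rule summable_on_comparison_test)
    fix i
    have "(cmod (f i + g i))\<^sup>2 \<le> (cmod (f i) + cmod (g i))\<^sup>2"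
      by (intro power_mono norm_triangle_ineq) auto
    also have "\<dots> \<le> 2 * (cmod (f i))\<^sup>2 + 2 * (cmod (g i))\<^sup>2"
      using sum_squares_bound[of "cmod (f i)" "cmod (g i)"] by (simp add: power2_sum)
    finally show "(cmod (f i + g i))\<^sup>2 \<le> 2 * (cmod (f i))\<^sup>2 + 2 * (cmod (g i))\<^sup>2" .
  qed auto
qed

lemma square_summable_scale:
  assumes "square_summable f" shows "square_summable (\<lambda>i. c * f i)"
  using assms unfolding square_summable_def
  by (auto simp: norm_mult power_mult_distrib intro: summable_on_cmult_right)

lemma square_summable_0: "square_summable (\<lambda>_. 0)"
  by (simp add: square_summable_def)

typedef 'i ell2 = "{f :: 'i \<Rightarrow> complex. square_summable f}"
  morphisms ell2_apply Abs_ell2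
  by (rule exI[of _ "\<lambda>_. 0"]) (simp add: square_summable_0)

setup_lifting type_definition_ell2

lift_definition cinner :: "'i ell2 \<Rightarrow> 'i ell2 \<Rightarrow> complex" is
  "\<lambda>f g. \<Sum>\<^sub>\<infinity>i. cnj (f i) * g i" .

lift_definition scaleC :: "complex \<Rightarrow> 'i ell2 \<Rightarrow> 'i ell2" is "\<lambda>c f i. c * f i"
  by (rule square_summable_scale)

instantiation ell2 :: (type) real_inner
begin

lift_definition zero_ell2 :: "'a ell2" is "\<lambda>_. 0" by (rule square_summable_0)
lift_definition plus_ell2 :: "'a ell2 \<Rightarrow> 'a ell2 \<Rightarrow> 'a ell2" is "\<lambda>f g i. f i + g i"
  by (rule square_summable_add)
lift_definition uminus_ell2 :: "'a ell2 \<Rightarrow> 'a ell2" is "\<lambda>f i. - f i"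
  by (simp add: square_summable_def)
lift_definition minus_ell2 :: "'a ell2 \<Rightarrow> 'a ell2 \<Rightarrow> 'a ell2" is "\<lambda>f g i. f i - g i"
  using square_summable_add[of _ "\<lambda>i. - _ i"] by (simp add: square_summable_def)
definition scaleR_ell2 :: "real \<Rightarrow> 'a ell2 \<Rightarrow> 'a ell2" where
  "scaleR_ell2 r = scaleC (complex_of_real r)"
definition inner_ell2 :: "'a ell2 \<Rightarrow> 'a ell2 \<Rightarrow> real" where
  "inner_ell2 x y = Re (cinner x y)"
definition norm_ell2 :: "'a ell2 \<Rightarrow> real" where
  "norm_ell2 x = sqrt (inner x x)"
definition dist_ell2 :: "'a ell2 \<Rightarrow> 'a ell2 \<Rightarrow> real" where
  "dist_ell2 x y = norm (x - y)"
definition sgn_ell2 :: "'a ell2 \<Rightarrow> 'a ell2" where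
  "sgn_ell2 x = inverse (norm x) *\<^sub>R x"
definition uniformity_ell2 :: "('a ell2 \<times> 'a ell2) filter" where
  "uniformity_ell2 = (INF e\<in>{0 <..}. principal {(x, y). dist x y < e})"
definition open_ell2 :: "'a ell2 set \<Rightarrow> bool" where
  "open_ell2 U \<longleftrightarrow> (\<forall>x\<in>U. \<forall>\<^sub>F (x', y) in uniformity. x' = x \<longrightarrow> y \<in> U)"

instance
proof
  fix x y z :: "'a ell2" and r s :: real and U :: "'a ell2 set"
  show "x + y + z = x + (y + z)" by transfer (simp add: add.assoc)
  show "x + y = y + x" by transfer (simp add: add.commute)
  show "0 + x = x" by transfer simp
  show "- x + x = 0" by transfer simp
  show "x - y = x + - y" by transfer simp
  show "r *\<^sub>R (x + y) = r *\<^sub>R x + r *\<^sub>R y"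
    unfolding scaleR_ell2_def by transfer (simp add: algebra_simps)
  show "(r + s) *\<^sub>R x = r *\<^sub>R x + s *\<^sub>R x"
    unfolding scaleR_ell2_def by transfer (simp add: algebra_simps)
  show "r *\<^sub>R s *\<^sub>R x = (r * s) *\<^sub>R x"
    unfolding scaleR_ell2_def by transfer (simp add: algebra_simps)
  show "1 *\<^sub>R x = x" unfolding scaleR_ell2_def by transfer simp
  show "sgn x = inverse (norm x) *\<^sub>R x" by (rule sgn_ell2_def)
  show "dist x y = norm (x - y)" by (rule dist_ell2_def)
  show "uniformity = (INF e\<in>{0 <..}. principal {(x, y :: 'a ell2). dist x y < e})"
    by (rule uniformity_ell2_def)
  show "open U = (\<forall>x\<in>U. \<forall>\<^sub>F (x', y) in uniformity. x' = x \<longrightarrow> y \<in> U)"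
    by (rule open_ell2_def)
  show "norm x = sqrt (inner x x)" by (rule norm_ell2_def)
  have "cinner x y = cnj (cinner y x)"
    by transfer (simp flip: infsum_cnj add: mult.commute)
  then show "inner x y = inner y x" by (simp add: inner_ell2_def)
  have "cinner (x + y) z = cinner x z + cinner y z"
    by transfer (simp add: distrib_right infsum_add square_summable_prod)
  then show "inner (x + y) z = inner x z + inner y z" by (simp add: inner_ell2_def)
  have "cinner (scaleC (complex_of_real r) x) y = r * cinner x y"
    by transfer (simp add: infsum_cmult_right' mult.assoc)
  then show "inner (r *\<^sub>R x) y = r * inner x y"
    by (simp add: inner_ell2_def scaleR_ell2_def)
  have eq: "inner x x = (\<Sum>\<^sub>\<infinity>i. (cmod (ell2_apply x i))\<^sup>2)"
    unfolding inner_ell2_def cinner.rep_eq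
    by (subst infsum_Re[symmetric])
       (use ell2_apply[of x] in \<open>auto intro!: square_summable_prod infsum_cong
          simp: cmod_power2 simp flip: power2_eq_square\<close>)
  show "0 \<le> inner x x" unfolding eq by (intro infsum_nonneg) simp
  show "inner x x = 0 \<longleftrightarrow> x = 0"
  proof
    assume 0: "inner x x = 0"
    have "(cmod (ell2_apply x i))\<^sup>2 = 0" for i
      by (rule nonneg_infsum_le_0D[of "\<lambda>i. (cmod (ell2_apply x i))\<^sup>2" UNIV])
         (use ell2_apply[of x] 0 eq in \<open>auto simp: square_summable_def\<close>)
    then show "x = 0" by transfer auto
  next
    assume "x = 0"
    then show "inner x x = 0" unfolding eq by (simp add: zero_ell2.rep_eq)
  qed
qed

end

lemma norm_scaleC: "norm (scaleC c x) = cmod c * norm (x :: 'i ell2)"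
proof -
  have "cinner (scaleC c x) (scaleC c x) = of_real ((cmod c)\<^sup>2) * cinner x x"
  proof transfer
    fix c :: complex and f :: "'i \<Rightarrow> complex"
    have "cnj (c * f i) * (c * f i) = of_real ((cmod c)\<^sup>2) * (cnj (f i) * f i)" for i
      by (metis (no_types, lifting) complex_cnj_mult complex_norm_square mult.assoc
          mult.left_commute)
    then show "(\<Sum>\<^sub>\<infinity>i. cnj (c * f i) * (c * f i)) =
        of_real ((cmod c)\<^sup>2) * (\<Sum>\<^sub>\<infinity>i. cnj (f i) * f i)"
      by (simp only: infsum_cmult_right')
  qed
  then show ?thesis
    by (simp add: norm_ell2_def inner_ell2_def real_sqrt_mult)
qed

lemma bounded_linear_scaleC: "bounded_linear (scaleC c :: 'i ell2 \<Rightarrow> 'i ell2)"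
proof (rule bounded_linear_intro[where K = "cmod c"])
  fix x y :: "'i ell2" and r :: real
  show "scaleC c (x + y) = scaleC c x + scaleC c y" by transfer (simp add: algebra_simps)
  show "scaleC c (r *\<^sub>R x) = r *\<^sub>R scaleC c x"
    unfolding scaleR_ell2_def by transfer (simp add: algebra_simps)
  show "norm (scaleC c x) \<le> norm x * cmod c" by (simp add: norm_scaleC)
qed

lift_definition ket :: "'i \<Rightarrow> 'i ell2" is "\<lambda>i j. if j = i then 1 else 0"
proof -
  fix i :: 'i
  have "(\<lambda>j. (cmod (if j = i then 1 else 0))\<^sup>2) summable_on {i}" by simp
  then show "square_summable (\<lambda>j. if j = i then 1 else 0)"
    unfolding square_summable_def
    by (rule summable_on_cong_neutral[THEN iffD1, rotated -1]) auto
qed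

text \<open>The identification of the Hilbert space tensor product of the spaces over \<open>'i\<close> and \<open>'j\<close>
  with the space over \<open>'i \<times> 'j\<close>.\<close>

lift_definition tensor_vec :: "'i ell2 \<Rightarrow> 'j ell2 \<Rightarrow> ('i \<times> 'j) ell2" is
  "\<lambda>f g (i, j). f i * g j"
proof -
  fix f :: "'i \<Rightarrow> complex" and g :: "'j \<Rightarrow> complex"
  assume f: "square_summable f" and g: "square_summable g"
  have "(\<lambda>(i, j). (cmod (f i))\<^sup>2 * (cmod (g j))\<^sup>2) summable_on UNIV \<times> UNIV"
    by (rule summable_on_SigmaI[where g = "\<lambda>i. (cmod (f i))\<^sup>2 * (\<Sum>\<^sub>\<infinity>j. (cmod (g j))\<^sup>2)"])
       (use f g in \<open>auto simp: square_summable_def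
          intro!: has_sum_cmult_right summable_on_cmult_left\<close>)
  then show "square_summable (\<lambda>(i, j). f i * g j)"
    by (simp add: square_summable_def norm_mult power_mult_distrib case_prod_unfold)
qed

lift_definition inl_vec :: "'i ell2 \<Rightarrow> ('i + 'j) ell2" is "\<lambda>f. case_sum f (\<lambda>_. 0)"
proof -
  fix f :: "'i \<Rightarrow> complex"
  assume "square_summable f"
  then have "(\<lambda>k. (cmod (case_sum f (\<lambda>_. 0) k))\<^sup>2) summable_on range (Inl :: 'i \<Rightarrow> 'i + 'j)"
    by (subst summable_on_reindex) (auto simp: square_summable_def o_def)
  then show "square_summable (case_sum f (\<lambda>_ :: 'j. 0))"
    unfolding square_summable_def
    by (rule summable_on_cong_neutral[THEN iffD1, rotated -1]) (auto split: sum.splits)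
qed

lift_definition inr_vec :: "'j ell2 \<Rightarrow> ('i + 'j) ell2" is "\<lambda>f. case_sum (\<lambda>_. 0) f"
proof -
  fix f :: "'j \<Rightarrow> complex"
  assume "square_summable f"
  then have "(\<lambda>k. (cmod (case_sum (\<lambda>_. 0) f k))\<^sup>2) summable_on range (Inr :: 'j \<Rightarrow> 'i + 'j)"
    by (subst summable_on_reindex) (auto simp: square_summable_def o_def)
  then show "square_summable (case_sum (\<lambda>_ :: 'i. 0) f)"
    unfolding square_summable_def
    by (rule summable_on_cong_neutral[THEN iffD1, rotated -1]) (auto split: sum.splits)
qed


section \<open>Bounded operators\<close>

text \<open>\<open>blinfun\<close> only knows the real structure; complex linearity is a separate predicate.\<close>

type_synonym 'i op = "'i ell2 \<Rightarrow>\<^sub>L 'i ell2"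

definition complex_linear :: "('i ell2 \<Rightarrow>\<^sub>L 'j ell2) \<Rightarrow> bool" where
  "complex_linear T \<longleftrightarrow> (\<forall>c x. blinfun_apply T (scaleC c x) = scaleC c (blinfun_apply T x))"

definition scale_op :: "complex \<Rightarrow> 'i op \<Rightarrow> 'i op" where
  "scale_op c T = Blinfun (scaleC c) o\<^sub>L T"

lemma scale_op_apply: "blinfun_apply (scale_op c T) x = scaleC c (blinfun_apply T x)"
  by (simp add: scale_op_def bounded_linear_Blinfun_apply[OF bounded_linear_scaleC])

definition adj :: "'i op \<Rightarrow> 'i op" where
  "adj T = (THE T'. \<forall>x y. cinner (blinfun_apply T' x) y = cinner x (blinfun_apply T y))"

definition tensor_op :: "'i op \<Rightarrow> 'j op \<Rightarrow> ('i \<times> 'j) op" (infixr "\<otimes>\<^sub>o" 72) where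
  "S \<otimes>\<^sub>o T = (THE R. \<forall>x y. blinfun_apply R (tensor_vec x y) =
      tensor_vec (blinfun_apply S x) (blinfun_apply T y))"

definition dsum_op :: "'i op \<Rightarrow> 'j op \<Rightarrow> ('i + 'j) op" (infixr "\<oplus>\<^sub>o" 68) where
  "S \<oplus>\<^sub>o T = (THE R. (\<forall>x. blinfun_apply R (inl_vec x) = inl_vec (blinfun_apply S x)) \<and>
      (\<forall>y. blinfun_apply R (inr_vec y) = inr_vec (blinfun_apply T y)))"

text \<open>The unitary induced by a bijection of index types, and conjugation by it.  It is used only
  for the flip and for reassociating iterated tensor products.\<close>

definition perm_op :: "('i \<Rightarrow> 'j) \<Rightarrow> ('i ell2 \<Rightarrow>\<^sub>L 'j ell2)" where
  "perm_op \<pi> = (THE U. complex_linear U \<and> (\<forall>i. blinfun_apply U (ket i) = ket (\<pi> i)))"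

definition reindex_op :: "('i \<Rightarrow> 'j) \<Rightarrow> 'i op \<Rightarrow> 'j op" where
  "reindex_op \<pi> T = perm_op \<pi> o\<^sub>L T o\<^sub>L perm_op (Hilbert_Choice.inv \<pi>)"

definition flip :: "('i \<times> 'j) op \<Rightarrow> ('j \<times> 'i) op" where
  "flip = reindex_op prod.swap"

definition reassoc :: "(('i \<times> 'j) \<times> 'k) op \<Rightarrow> ('i \<times> 'j \<times> 'k) op" where
  "reassoc = reindex_op (\<lambda>((i, j), k). (i, j, k))"


section \<open>C*-algebras and their minimal tensor products\<close>

text \<open>C*-algebras are represented faithfully on a Hilbert space (Gelfand--Naimark), which is what
  the minimal tensor product is defined from.  The representation may be degenerate: the unit
  of a unital C*-algebra need not be the identity operator.\<close>

definition cstar_algebra :: "'i op set \<Rightarrow> bool" where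
  "cstar_algebra A \<longleftrightarrow> 0 \<in> A \<and> (\<forall>a\<in>A. complex_linear a) \<and>
     (\<forall>a\<in>A. \<forall>b\<in>A. a + b \<in> A \<and> a o\<^sub>L b \<in> A) \<and>
     (\<forall>c. \<forall>a\<in>A. scale_op c a \<in> A) \<and> (\<forall>a\<in>A. adj a \<in> A) \<and> closed A"

definition is_unit :: "'i op set \<Rightarrow> 'i op \<Rightarrow> bool" where
  "is_unit A e \<longleftrightarrow> e \<in> A \<and> (\<forall>a\<in>A. e o\<^sub>L a = a \<and> a o\<^sub>L e = a)"

definition unital_cstar_algebra :: "'i op set \<Rightarrow> bool" where
  "unital_cstar_algebra A \<longleftrightarrow> cstar_algebra A \<and> (\<exists>e. is_unit A e)"

definition unit_of :: "'i op set \<Rightarrow> 'i op" where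
  "unit_of A = (THE e. is_unit A e)"

definition cstar_generated :: "'i op set \<Rightarrow> 'i op set" where
  "cstar_generated X = \<Inter> {A. cstar_algebra A \<and> X \<subseteq> A}"

definition cstar_dsum :: "'i op set \<Rightarrow> 'j op set \<Rightarrow> ('i + 'j) op set" (infixr "\<oplus>\<^sub>C" 68) where
  "A \<oplus>\<^sub>C B = {a \<oplus>\<^sub>o b |a b. a \<in> A \<and> b \<in> B}"

text \<open>Here and below the real \<open>span\<close> is also the complex span, because one of the factors
  ranges over a complex subspace.\<close>

definition alg_tensor :: "'i op set \<Rightarrow> 'j op set \<Rightarrow> ('i \<times> 'j) op set" where
  "alg_tensor A B = span {a \<otimes>\<^sub>o b |a b. a \<in> A \<and> b \<in> B}"

definition min_tensor :: "'i op set \<Rightarrow> 'j op set \<Rightarrow> ('i \<times> 'j) op set" (infixr "\<otimes>\<^sub>C" 72) where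
  "A \<otimes>\<^sub>C B = closure (alg_tensor A B)"

definition complex_linear_on :: "'i op set \<Rightarrow> ('i op \<Rightarrow> 'j op) \<Rightarrow> bool" where
  "complex_linear_on A f \<longleftrightarrow> (\<forall>a\<in>A. \<forall>b\<in>A. f (a + b) = f a + f b) \<and>
     (\<forall>c. \<forall>a\<in>A. f (scale_op c a) = scale_op c (f a))"

text \<open>Maps between C*-algebras are taken extensional, so that equality of functions is equality
  on the algebra.  Continuity of *-homomorphisms is automatic and is recorded for convenience.\<close>

definition unital_star_hom :: "'i op set \<Rightarrow> 'j op set \<Rightarrow> ('i op \<Rightarrow> 'j op) \<Rightarrow> bool" where
  "unital_star_hom A B f \<longleftrightarrow> f \<in> A \<rightarrow>\<^sub>E B \<and> complex_linear_on A f \<and> continuous_on A f \<and>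
     (\<forall>a\<in>A. \<forall>b\<in>A. f (a o\<^sub>L b) = f a o\<^sub>L f b) \<and> (\<forall>a\<in>A. f (adj a) = adj (f a)) \<and>
     f (unit_of A) = unit_of B"

text \<open>The continuous linear map on the minimal tensor product with prescribed values on
  elementary tensors.  It exists in all cases where it is used below, namely for tensor products
  of *-homomorphisms and for slice maps.\<close>

definition tensor_lift ::
  "'i op set \<Rightarrow> 'j op set \<Rightarrow> ('i op \<Rightarrow> 'j op \<Rightarrow> 'k op) \<Rightarrow> ('i \<times> 'j) op \<Rightarrow> 'k op" where
  "tensor_lift A B \<phi> = (THE h. h \<in> extensional (A \<otimes>\<^sub>C B) \<and> complex_linear_on (A \<otimes>\<^sub>C B) h \<and>
     continuous_on (A \<otimes>\<^sub>C B) h \<and> (\<forall>a\<in>A. \<forall>b\<in>B. h (a \<otimes>\<^sub>o b) = \<phi> a b))"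

definition tensor_map ::
  "'i op set \<Rightarrow> 'j op set \<Rightarrow> ('i op \<Rightarrow> 'k op) \<Rightarrow> ('j op \<Rightarrow> 'l op) \<Rightarrow> ('i \<times> 'j) op \<Rightarrow> ('k \<times> 'l) op"
  where "tensor_map A B f g = tensor_lift A B (\<lambda>a b. f a \<otimes>\<^sub>o g b)"


section \<open>Compact quantum groups, corepresentations and actions\<close>

definition compact_quantum_group :: "'i op set \<Rightarrow> ('i op \<Rightarrow> ('i \<times> 'i) op) \<Rightarrow> bool" where
  "compact_quantum_group Q \<Delta> \<longleftrightarrow> unital_cstar_algebra Q \<and> unital_star_hom Q (Q \<otimes>\<^sub>C Q) \<Delta> \<and>
     (\<forall>a\<in>Q. reassoc (tensor_map Q Q \<Delta> id (\<Delta> a)) = tensor_map Q Q id \<Delta> (\<Delta> a)) \<and>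
     closure (span {\<Delta> a o\<^sub>L (unit_of Q \<otimes>\<^sub>o b) |a b. a \<in> Q \<and> b \<in> Q}) = Q \<otimes>\<^sub>C Q \<and>
     closure (span {\<Delta> a o\<^sub>L (b \<otimes>\<^sub>o unit_of Q) |a b. a \<in> Q \<and> b \<in> Q}) = Q \<otimes>\<^sub>C Q"

definition cqg_morphism ::
  "'i op set \<Rightarrow> ('i op \<Rightarrow> ('i \<times> 'i) op) \<Rightarrow> 'j op set \<Rightarrow> ('j op \<Rightarrow> ('j \<times> 'j) op) \<Rightarrow>
    ('i op \<Rightarrow> 'j op) \<Rightarrow> bool" where
  "cqg_morphism Q \<Delta> Q' \<Delta>' \<Phi> \<longleftrightarrow> unital_star_hom Q Q' \<Phi> \<and>
     (\<forall>a\<in>Q. tensor_map Q Q \<Phi> \<Phi> (\<Delta> a) = \<Delta>' (\<Phi> a))"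

definition corepresentation ::
  "'i op set \<Rightarrow> ('i op \<Rightarrow> ('i \<times> 'i) op) \<Rightarrow> 'i op ^ 'n ^ 'n \<Rightarrow> bool" where
  "corepresentation Q \<Delta> u \<longleftrightarrow>
     (\<forall>i j. u $ i $ j \<in> Q \<and> \<Delta> (u $ i $ j) = (\<Sum>k\<in>UNIV. u $ i $ k \<otimes>\<^sub>o u $ k $ j))"

definition unitary_matrix :: "'i op set \<Rightarrow> 'i op ^ 'n ^ 'n \<Rightarrow> bool" where
  "unitary_matrix Q u \<longleftrightarrow> (\<forall>i j.
     (\<Sum>k\<in>UNIV. adj (u $ k $ i) o\<^sub>L u $ k $ j) = (if i = j then unit_of Q else 0) \<and>
     (\<Sum>k\<in>UNIV. u $ i $ k o\<^sub>L adj (u $ j $ k)) = (if i = j then unit_of Q else 0))"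

definition fundamental_corepresentation ::
  "'i op set \<Rightarrow> ('i op \<Rightarrow> ('i \<times> 'i) op) \<Rightarrow> 'i op ^ 'n ^ 'n \<Rightarrow> bool" where
  "fundamental_corepresentation Q \<Delta> u \<longleftrightarrow> corepresentation Q \<Delta> u \<and> unitary_matrix Q u \<and>
     cstar_generated {u $ i $ j |i j. True} = Q"

text \<open>The flip in the coaction identity is the convention under which the coefficient matrix of an
  action is a corepresentation with respect to \<open>\<Delta>\<close> rather than its opposite.\<close>

definition cqg_action ::
  "'i op set \<Rightarrow> ('i op \<Rightarrow> ('i \<times> 'i) op) \<Rightarrow> 'a op set \<Rightarrow> ('a op \<Rightarrow> ('a \<times> 'i) op) \<Rightarrow> bool" where
  "cqg_action Q \<Delta> A \<alpha> \<longleftrightarrow> unital_star_hom A (A \<otimes>\<^sub>C Q) \<alpha> \<and>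
     (\<forall>a\<in>A. reassoc (tensor_map A Q \<alpha> id (\<alpha> a)) =
        tensor_map A Q id (\<lambda>q. flip (\<Delta> q)) (\<alpha> a)) \<and>
     closure (span {\<alpha> a o\<^sub>L (unit_of A \<otimes>\<^sub>o q) |a q. a \<in> A \<and> q \<in> Q}) = A \<otimes>\<^sub>C Q"


section \<open>Group C*-algebras and quantum isometry groups\<close>

text \<open>The Hilbert space of square-summable functions on \<open>carrier G\<close> is viewed as a subspace of
  the space over the whole underlying type; the operators vanish on its complement.\<close>

definition left_reg :: "('g, 'm) monoid_scheme \<Rightarrow> 'g \<Rightarrow> 'g op" where
  "left_reg G \<gamma> = (THE T. complex_linear T \<and>
     (\<forall>h. blinfun_apply T (ket h) = (if h \<in> carrier G then ket (\<gamma> \<otimes>\<^bsub>G\<^esub> h) else 0)))"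

definition reduced_group_cstar :: "('g, 'm) monoid_scheme \<Rightarrow> 'g op set" where
  "reduced_group_cstar G = cstar_generated (left_reg G ` carrier G)"

definition canonical_trace :: "('g, 'm) monoid_scheme \<Rightarrow> 'g op \<Rightarrow> complex" where
  "canonical_trace G a = cinner (ket \<one>\<^bsub>G\<^esub>) (blinfun_apply a (ket \<one>\<^bsub>G\<^esub>))"

definition symmetric_generating_set :: "('g, 'm) monoid_scheme \<Rightarrow> 'g set \<Rightarrow> bool" where
  "symmetric_generating_set G S \<longleftrightarrow> finite S \<and> S \<subseteq> carrier G \<and>
     (\<forall>s\<in>S. inv\<^bsub>G\<^esub> s \<in> S) \<and> generate G S = carrier G"

definition word_length :: "('g, 'm) monoid_scheme \<Rightarrow> 'g set \<Rightarrow> 'g \<Rightarrow> nat" where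
  "word_length G S \<gamma> =
     (LEAST n. \<exists>w. set w \<subseteq> S \<and> length w = n \<and> foldr (\<lambda>x y. x \<otimes>\<^bsub>G\<^esub> y) w \<one>\<^bsub>G\<^esub> = \<gamma>)"

definition isometric_action ::
  "('g, 'm) monoid_scheme \<Rightarrow> 'g set \<Rightarrow> 'i op set \<Rightarrow> ('i op \<Rightarrow> ('i \<times> 'i) op) \<Rightarrow>
    ('g op \<Rightarrow> ('g \<times> 'i) op) \<Rightarrow> bool" where
  "isometric_action G S Q \<Delta> \<alpha> \<longleftrightarrow>
     compact_quantum_group Q \<Delta> \<and> cqg_action Q \<Delta> (reduced_group_cstar G) \<alpha> \<and>
     (\<forall>a\<in>reduced_group_cstar G.
        tensor_lift (reduced_group_cstar G) Q (\<lambda>b q. scale_op (canonical_trace G b) q) (\<alpha> a) =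
          scale_op (canonical_trace G a) (unit_of Q)) \<and>
     (\<forall>\<gamma>\<in>carrier G. \<alpha> (left_reg G \<gamma>) \<in>
        span {left_reg G \<gamma>' \<otimes>\<^sub>o q |\<gamma>' q.
          \<gamma>' \<in> carrier G \<and> word_length G S \<gamma>' = word_length G S \<gamma> \<and> q \<in> Q})"

definition isometric_action_morphism ::
  "('g, 'm) monoid_scheme \<Rightarrow> 'i op set \<Rightarrow> ('i op \<Rightarrow> ('i \<times> 'i) op) \<Rightarrow> ('g op \<Rightarrow> ('g \<times> 'i) op) \<Rightarrow>
    'j op set \<Rightarrow> ('j op \<Rightarrow> ('j \<times> 'j) op) \<Rightarrow> ('g op \<Rightarrow> ('g \<times> 'j) op) \<Rightarrow> ('i op \<Rightarrow> 'j op) \<Rightarrow> bool"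
  where
  "isometric_action_morphism G Q \<Delta> \<alpha> Q' \<Delta>' \<alpha>' \<Phi> \<longleftrightarrow> cqg_morphism Q \<Delta> Q' \<Delta>' \<Phi> \<and>
     (\<forall>a\<in>reduced_group_cstar G. tensor_map (reduced_group_cstar G) Q id \<Phi> (\<alpha> a) = \<alpha>' a)"

text \<open>\<open>(Q, \<Delta>, \<alpha>)\<close> is the quantum group of orientation preserving isometries, i.e. the initial
  isometric action.  HOL cannot quantify over all Hilbert spaces in a formula, so the competitors
  are those represented over the index type \<open>'q\<close>; the property is meant to be asserted for a
  free type variable \<open>'q\<close>.\<close>

definition is_QISO_plus ::
  "'q itself \<Rightarrow> ('g, 'm) monoid_scheme \<Rightarrow> 'g set \<Rightarrow>
    'i op set \<Rightarrow> ('i op \<Rightarrow> ('i \<times> 'i) op) \<Rightarrow> ('g op \<Rightarrow> ('g \<times> 'i) op) \<Rightarrow> bool" where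
  "is_QISO_plus (U :: 'q itself) G S Q \<Delta> \<alpha> \<longleftrightarrow>
     group G \<and> symmetric_generating_set G S \<and> isometric_action G S Q \<Delta> \<alpha> \<and>
     (\<forall>(Q' :: 'q op set) \<Delta>' \<alpha>'. isometric_action G S Q' \<Delta>' \<alpha>' \<longrightarrow>
        (\<exists>!\<Phi>. isometric_action_morphism G Q \<Delta> \<alpha> Q' \<Delta>' \<alpha>' \<Phi>))"


section \<open>The symmetric group on three letters\<close>

abbreviation S3 :: "(nat \<Rightarrow> nat) monoid" where
  "S3 \<equiv> sym_group 3"

definition s3 :: "nat \<Rightarrow> nat" where
  "s3 = cycle_of_list [1, 2]"

definition t3 :: "nat \<Rightarrow> nat" where
  "t3 = cycle_of_list [1, 2, 3]"

definition gens3 :: "(nat \<Rightarrow> nat) set" where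
  "gens3 = {t3, inv\<^bsub>S3\<^esub> t3, s3}"

abbreviation CS3 :: "(nat \<Rightarrow> nat) op set" where
  "CS3 \<equiv> reduced_group_cstar S3"

abbreviation lam3 :: "(nat \<Rightarrow> nat) \<Rightarrow> (nat \<Rightarrow> nat) op" where
  "lam3 \<equiv> left_reg S3"

abbreviation Q3 :: "((nat \<Rightarrow> nat) + (nat \<Rightarrow> nat)) op set" where
  "Q3 \<equiv> CS3 \<oplus>\<^sub>C CS3"

definition E3 :: "((nat \<Rightarrow> nat) + (nat \<Rightarrow> nat)) op" where "E3 = lam3 t3 \<oplus>\<^sub>o 0"
definition F3 :: "((nat \<Rightarrow> nat) + (nat \<Rightarrow> nat)) op" where "F3 = 0 \<oplus>\<^sub>o lam3 t3"
definition L3 :: "((nat \<Rightarrow> nat) + (nat \<Rightarrow> nat)) op" where "L3 = lam3 s3 \<oplus>\<^sub>o lam3 s3"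

definition U3 :: "((nat \<Rightarrow> nat) + (nat \<Rightarrow> nat)) op ^ 3 ^ 3" where
  "U3 = vector [vector [E3, F3, 0],
                vector [F3 o\<^sub>L F3, E3 o\<^sub>L E3, 0],
                vector [0, 0, L3]]"

end

theory Submission
  imports Defs
begin

text \<open>
  The group \<open>S\<^sub>3\<close> has the involutive automorphism \<open>\<theta>\<close> of conjugation by \<open>s = (1 2)\<close>, which fixes \<open>s\<close>,
  inverts \<open>t = (1 2 3)\<close> and therefore preserves word length.  For any finite group \<open>G\<close> with
  such a \<open>\<theta>\<close> the algebra \<open>C*(G) \<oplus> C*(G)\<close> carries the structure of a quantum group acting on
  \<open>C*(G)\<close>: with \<open>e j g\<close> denoting \<open>\<lambda>\<^sub>g\<close> in the summand \<open>j \<in> {0, 1}\<close>, the action spreads \<open>\<lambda>\<^sub>g\<close> over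
  \<open>g\<close> and \<open>\<theta> g\<close> with coefficients \<open>e 0 g\<close> and \<open>e 1 g\<close>.  For \<open>S\<^sub>3\<close> this yields the formulas for \<open>E\<close>, \<open>F\<close>
  and \<open>L\<close>, and the coproduct and the action are unique because \<open>E\<close>, \<open>F\<close>, \<open>L\<close> generate the
  algebra (\<open>Q3_generation\<close>).

  For the universal property, let \<open>\<alpha>'\<close> be an isometric action of \<open>Q'\<close>.  Comparing coefficients in the
  images of the relations of \<open>S\<^sub>3\<close>, together with the fact that \<open>s t\<close> has length two, leaves only
  \<open>\<alpha>' (\<lambda>\<^sub>t) = \<lambda>\<^sub>t \<otimes> A + \<lambda>\<^sub>r \<otimes> B\<close> and \<open>\<alpha>' (\<lambda>\<^sub>s) = \<lambda>\<^sub>s \<otimes> L\<close>, with \<open>r\<close> the inverse of \<open>t\<close>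
  (\<open>coaction_generators\<close>).  The cubes of \<open>A\<close> and \<open>B\<close> are complementary projections
  which commute with the coaction and cut it into a diagonal block and a block supported on the graph of
  \<open>\<theta>\<close> (\<open>coaction_partition\<close>).  The entries of the two blocks are then representations of \<open>S\<^sub>3\<close>
  automatically, and assemble into the morphism from \<open>C*(S\<^sub>3) \<oplus> C*(S\<^sub>3)\<close>.  It respects
  coproducts and is unique since the coaction identity can be read off coefficientwise at every
  element moved by \<open>\<theta>\<close>, and one such element suffices to separate the two summands everywhere
  (\<open>ex1_morphism\<close>).

  Both \<open>C*(G)\<close> and its double have a finite basis in which each coordinate is a single matrix
  entry (locale \<open>matrix_basis\<close>).  This makes coordinates continuous and lets tensor products
  with an arbitrary, possibly infinite-dimensional \<open>Q'\<close> be handled by finite sums.  The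
  preparatory part supplies adjoints and tensor products of bounded operators on the
  Hilbert spaces of square-summable functions.
\<close>


section \<open>Square-summable functions and the basis of kets\<close>

lemma ell2_eqI: "(\<And>i. ell2_apply x i = ell2_apply y i) \<Longrightarrow> x = y"
  by (metis ell2_apply_inject ext)

lemmas ell2_coord = zero_ell2.rep_eq plus_ell2.rep_eq uminus_ell2.rep_eq minus_ell2.rep_eq
  scaleC.rep_eq ket.rep_eq

lemma scaleR_scaleC: "r *\<^sub>R (x :: 'i ell2) = scaleC (complex_of_real r) x"
  by (simp add: scaleR_ell2_def)

lemma ell2_apply_scaleR [simp]: "ell2_apply (r *\<^sub>R x) i = complex_of_real r * ell2_apply x i"
  by (simp add: scaleR_scaleC scaleC.rep_eq)

lemma scaleC_algebra:
  "scaleC c (x + y) = scaleC c x + scaleC c y" "scaleC (c + d) x = scaleC c x + scaleC d x"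
  "scaleC c (scaleC d x) = scaleC (c * d) x" "scaleC 1 x = x" "scaleC 0 x = 0" "scaleC c 0 = 0"
  "scaleC c (- x) = - scaleC c x" "scaleC c (x - y) = scaleC c x - scaleC c y"
  by (rule ell2_eqI; simp add: ell2_coord algebra_simps)+

lemma ell2_apply_sum: "ell2_apply (\<Sum>k\<in>F. f k) i = (\<Sum>k\<in>F. ell2_apply (f k) i)"
  by (induction F rule: infinite_finite_induct) (simp_all add: ell2_coord)

lemma summable_ell2: "(\<lambda>i. (cmod (ell2_apply x i))\<^sup>2) summable_on UNIV"
  using ell2_apply[of x] by (simp add: square_summable_def)

lemma cinner_commute: "cinner x y = cnj (cinner y x)"
  by transfer (simp flip: infsum_cnj add: mult.commute)

lemma cinner_add_right: "cinner x (y + z) = cinner x y + cinner x z"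
  by transfer (simp add: distrib_left infsum_add square_summable_prod)

lemma cinner_scaleC_right: "cinner x (scaleC c y) = c * cinner x y"
  by transfer (simp add: mult.left_commute infsum_cmult_right')

lemma cinner_ket_left: "cinner (ket i) x = ell2_apply x i"
proof -
  have "(\<Sum>\<^sub>\<infinity>j. cnj (ell2_apply (ket i) j) * ell2_apply x j) =
      (\<Sum>\<^sub>\<infinity>j\<in>{i}. cnj (ell2_apply (ket i) j) * ell2_apply x j)"
    by (rule infsum_cong_neutral) (auto simp: ket.rep_eq)
  then show ?thesis by (simp add: cinner.rep_eq ket.rep_eq)
qed

lemma cinner_ket_right: "cinner x (ket i) = cnj (ell2_apply x i)"
  by (metis cinner_commute cinner_ket_left)

lemma cinner_eqI: "(\<And>y. cinner x y = cinner x' y) \<Longrightarrow> x = x'"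
  by (rule ell2_eqI) (metis cinner_ket_right complex_cnj_cancel_iff)

lemma norm_ell2_power2: "(norm x)\<^sup>2 = (\<Sum>\<^sub>\<infinity>i. (cmod (ell2_apply x i))\<^sup>2)"
proof -
  have "(norm x)\<^sup>2 = Re (\<Sum>\<^sub>\<infinity>i. cnj (ell2_apply x i) * ell2_apply x i)"
    by (simp add: power2_norm_eq_inner inner_ell2_def cinner.rep_eq)
  also have "\<dots> = (\<Sum>\<^sub>\<infinity>i. Re (cnj (ell2_apply x i) * ell2_apply x i))"
    by (rule infsum_Re[symmetric])
       (use ell2_apply[of x] in \<open>auto intro: square_summable_prod\<close>)
  also have "\<dots> = (\<Sum>\<^sub>\<infinity>i. (cmod (ell2_apply x i))\<^sup>2)"
    by (rule infsum_cong) (simp add: cmod_power2 flip: power2_eq_square)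
  finally show ?thesis .
qed

lemma sum_coord_le_norm: "finite F \<Longrightarrow> (\<Sum>i\<in>F. (cmod (ell2_apply x i))\<^sup>2) \<le> (norm x)\<^sup>2"
  unfolding norm_ell2_power2 by (rule finite_sum_le_infsum[OF summable_ell2]) auto

lemma norm_le_by_finite_sums:
  assumes "\<And>F. finite F \<Longrightarrow> (\<Sum>i\<in>F. (cmod (ell2_apply x i))\<^sup>2) \<le> B\<^sup>2" "0 \<le> B"
  shows "norm x \<le> B"
proof -
  have "(norm x)\<^sup>2 \<le> B\<^sup>2" unfolding norm_ell2_power2
    by (rule infsum_le_finite_sums[OF summable_ell2]) (use assms in auto)
  then show ?thesis using assms(2) power2_le_imp_le by blast
qed

lemma square_summable_by_finite_sums:
  assumes "\<And>F. finite F \<Longrightarrow> (\<Sum>i\<in>F. (cmod (f i))\<^sup>2) \<le> B"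
  shows "square_summable f"
  unfolding square_summable_def
  by (rule nonneg_bdd_above_summable_on) (use assms in \<open>auto intro!: bdd_aboveI[of _ B]\<close>)

lemma norm_coord_le: "cmod (ell2_apply x i) \<le> norm x"
proof -
  have "(cmod (ell2_apply x i))\<^sup>2 \<le> (norm x)\<^sup>2" using sum_coord_le_norm[of "{i}" x] by simp
  then show ?thesis using power2_le_imp_le by fastforce
qed

lemma cmod_cinner_le: "cmod (cinner x y) \<le> 2 * (norm x * norm y)"
proof -
  have r: "\<bar>Re (cinner x y)\<bar> \<le> norm x * norm y" for x y :: "'a ell2"
    using Cauchy_Schwarz_ineq2[of x y] by (simp add: inner_ell2_def)
  have "\<bar>Im (cinner x y)\<bar> = \<bar>Re (cinner x (scaleC (- \<i>) y))\<bar>" by (simp add: cinner_scaleC_right)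
  also have "\<dots> \<le> norm x * norm y" using r[of x "scaleC (- \<i>) y"] by (simp add: norm_scaleC)
  finally show ?thesis using r[of x y] cmod_le[of "cinner x y"] by linarith
qed

lemma bounded_linear_cinner: "bounded_linear (cinner x)"
  by (rule bounded_linear_intro[where K = "2 * norm x"])
     (use cmod_cinner_le[of x] in
       \<open>auto simp: cinner_add_right scaleR_scaleC cinner_scaleC_right scaleR_conv_of_real algebra_simps\<close>)

lemma ket_expansion:
  "((\<lambda>F. \<Sum>i\<in>F. scaleC (ell2_apply x i) (ket i)) \<longlongrightarrow> x) (finite_subsets_at_top UNIV)"
proof -
  let ?a = "\<lambda>i. (cmod (ell2_apply x i))\<^sup>2"
  let ?s = "\<lambda>F. \<Sum>i\<in>F. scaleC (ell2_apply x i) (ket i)"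
  have coord: "ell2_apply (?s F) i = (if i \<in> F then ell2_apply x i else 0)" if "finite F" for F i
    using that by (simp add: ell2_apply_sum ell2_coord if_distrib cong: if_cong)
  have err: "(norm (?s F - x))\<^sup>2 = infsum ?a UNIV - sum ?a F" if F: "finite F" for F
  proof -
    have "(norm (?s F - x))\<^sup>2 = infsum ?a (- F)"
      unfolding norm_ell2_power2
      by (rule infsum_cong_neutral) (auto simp: ell2_coord coord[OF F])
    moreover have "infsum ?a (F \<union> - F) = infsum ?a F + infsum ?a (- F)"
      by (rule infsum_Un_disjoint)
         (use F summable_on_cofin_subset[OF summable_ell2 F] in \<open>auto simp: Compl_eq_Diff_UNIV\<close>)
    ultimately show ?thesis using F by (simp add: Compl_partition)
  qed
  have "(sum ?a \<longlongrightarrow> infsum ?a UNIV) (finite_subsets_at_top UNIV)"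
    using has_sum_infsum[OF summable_ell2[of x]] by (simp add: has_sum_def)
  then have "((\<lambda>F. infsum ?a UNIV - sum ?a F) \<longlongrightarrow> infsum ?a UNIV - infsum ?a UNIV)
      (finite_subsets_at_top UNIV)"
    by (intro tendsto_intros)
  then have "((\<lambda>F. sqrt (infsum ?a UNIV - sum ?a F)) \<longlongrightarrow> 0) (finite_subsets_at_top UNIV)"
    using tendsto_real_sqrt by fastforce
  moreover have "\<forall>\<^sub>F F in finite_subsets_at_top UNIV.
      sqrt (infsum ?a UNIV - sum ?a F) = norm (?s F - x)"
  proof (rule eventually_finite_subsets_at_top_weakI)
    fix F :: "'a set" assume "finite F"
    then show "sqrt (infsum ?a UNIV - sum ?a F) = norm (?s F - x)"
      by (simp flip: err)
  qed
  ultimately have "((\<lambda>F. norm (?s F - x)) \<longlongrightarrow> 0) (finite_subsets_at_top UNIV)"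
    using tendsto_cong by force
  then show ?thesis by (simp add: LIM_zero_cancel tendsto_norm_zero_iff)
qed

text \<open>Bounded operators are only known to be real-linear, so agreement on kets does not suffice:
  the multiples \<open>scaleC c (ket i)\<close>, whose real span is dense, have to be tested as well.\<close>

lemma bounded_linear_ket_eqI:
  fixes f g :: "'i ell2 \<Rightarrow> 'b :: real_normed_vector"
  assumes f: "bounded_linear f" and g: "bounded_linear g"
    and eq: "\<And>c i. f (scaleC c (ket i)) = g (scaleC c (ket i))"
  shows "f x = g x"
proof -
  let ?s = "\<lambda>F. \<Sum>i\<in>F. scaleC (ell2_apply x i) (ket i)"
  have "((\<lambda>F. f (?s F)) \<longlongrightarrow> f x) (finite_subsets_at_top UNIV)"
    by (rule bounded_linear.tendsto[OF f ket_expansion])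
  moreover have "((\<lambda>F. g (?s F)) \<longlongrightarrow> g x) (finite_subsets_at_top UNIV)"
    by (rule bounded_linear.tendsto[OF g ket_expansion])
  moreover have "f (?s F) = g (?s F)" for F
    by (simp only: linear_sum[OF bounded_linear.linear[OF f]]
        linear_sum[OF bounded_linear.linear[OF g]] eq)
  ultimately show ?thesis
    by (intro tendsto_unique[OF finite_subsets_at_top_neq_bot]) simp_all
qed

lemma blinfun_ket_eqI:
  assumes "\<And>c i. blinfun_apply S (scaleC c (ket i)) = blinfun_apply T (scaleC c (ket i))"
  shows "S = T"
  by (rule blinfun_eqI)
     (rule bounded_linear_ket_eqI[OF blinfun.bounded_linear_right blinfun.bounded_linear_right assms])


section \<open>Complex-linear operators, matrix coefficients and adjoints\<close>

lemma complex_linearD: "complex_linear T \<Longrightarrow>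
    blinfun_apply T (scaleC c x) = scaleC c (blinfun_apply T x)"
  by (simp add: complex_linear_def)

lemma scale_op_algebra:
  "scale_op c (S + T) = scale_op c S + scale_op c T"
  "scale_op (c + d) T = scale_op c T + scale_op d T"
  "scale_op c (scale_op d T) = scale_op (c * d) T" "scale_op 1 T = T" "scale_op 0 T = 0"
  "scale_op c 0 = 0" "scale_op c (- T) = - scale_op c T"
  "scale_op c (S - T) = scale_op c S - scale_op c T"
  by (rule blinfun_eqI;
      simp add: scale_op_apply blinfun.add_left blinfun.minus_left blinfun.diff_left scaleC_algebra)+

lemma scaleR_scale_op: "r *\<^sub>R (T :: 'i op) = scale_op (complex_of_real r) T"
  by (rule blinfun_eqI) (simp add: scale_op_apply blinfun.scaleR_left scaleR_scaleC)

lemma scale_op_sum: "scale_op c (\<Sum>k\<in>F. f k) = (\<Sum>k\<in>F. scale_op c (f k))"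
  by (induction F rule: infinite_finite_induct) (simp_all add: scale_op_algebra)

lemma scale_op_compose_left: "scale_op c S o\<^sub>L T = scale_op c (S o\<^sub>L T)"
  by (rule blinfun_eqI) (simp add: scale_op_apply)

lemma scale_op_compose_right: "complex_linear S \<Longrightarrow> S o\<^sub>L scale_op c T = scale_op c (S o\<^sub>L T)"
  by (rule blinfun_eqI) (simp add: scale_op_apply complex_linearD)

lemma norm_scale_op: "norm (scale_op c T) \<le> cmod c * norm T"
proof (rule norm_blinfun_bound)
  fix x show "norm (blinfun_apply (scale_op c T) x) \<le> cmod c * norm T * norm x"
    by (simp add: scale_op_apply norm_scaleC mult.assoc mult_left_mono norm_blinfun)
qed simp

lemma bounded_linear_scale_op: "bounded_linear (scale_op c)"
  by (rule bounded_linear_intro[where K = "cmod c"])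
     (use norm_scale_op[of c] in \<open>auto simp: scale_op_algebra scaleR_scale_op mult.commute\<close>)

lemma bounded_linear_scale_op_left: "bounded_linear (\<lambda>c. scale_op c T)"
  by (rule bounded_linear_intro[where K = "norm T"])
     (use norm_scale_op[of _ T] in \<open>auto simp: scale_op_algebra scaleR_scale_op scaleR_conv_of_real\<close>)

named_theorems cl_intros

lemma complex_linear_zero [cl_intros]: "complex_linear 0"
  by (simp add: complex_linear_def scaleC_algebra)

lemma complex_linear_add [cl_intros]:
    "complex_linear S \<Longrightarrow> complex_linear T \<Longrightarrow> complex_linear (S + T)"
  by (simp add: complex_linear_def blinfun.add_left scaleC_algebra)

lemma complex_linear_scale_op [cl_intros]: "complex_linear T \<Longrightarrow> complex_linear (scale_op c T)"
  by (simp add: complex_linear_def scale_op_apply scaleC_algebra mult.commute)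

lemma complex_linear_compose [cl_intros]:
    "complex_linear S \<Longrightarrow> complex_linear T \<Longrightarrow> complex_linear (S o\<^sub>L T)"
  by (simp add: complex_linear_def)

lemma complex_linear_sum [cl_intros]:
    "(\<And>k. k \<in> F \<Longrightarrow> complex_linear (f k)) \<Longrightarrow> complex_linear (\<Sum>k\<in>F. f k)"
  by (induction F rule: infinite_finite_induct) (simp_all add: cl_intros)

text \<open>This is the matrix entry \<open>\<langle>ket i, T (ket j)\<rangle>\<close>.  Most operator identities below, in particular
  those on tensor products and direct sums, are checked entry by entry.\<close>

definition mcoef :: "'j \<Rightarrow> 'i \<Rightarrow> ('i ell2 \<Rightarrow>\<^sub>L 'j ell2) \<Rightarrow> complex" where
  "mcoef i j T = ell2_apply (blinfun_apply T (ket j)) i"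

lemma op_eqI_ket:
  assumes "complex_linear S" "complex_linear T" "\<And>j. blinfun_apply S (ket j) = blinfun_apply T (ket j)"
  shows "S = T"
  by (rule blinfun_ket_eqI) (simp add: assms complex_linearD)

lemma op_eqI_mcoef:
  assumes "complex_linear S" "complex_linear T" "\<And>i j. mcoef i j S = mcoef i j T"
  shows "S = T"
  by (rule op_eqI_ket[OF assms(1,2)], rule ell2_eqI) (use assms(3) in \<open>simp add: mcoef_def\<close>)

lemma mcoef_algebra:
  "mcoef i j (S + T) = mcoef i j S + mcoef i j T" "mcoef i j 0 = 0"
  "mcoef i' j' (scale_op c T') = c * mcoef i' j' T'"
  by (simp_all add: mcoef_def blinfun.add_left scale_op_apply ell2_coord)

lemma bounded_linear_mcoef: "bounded_linear (mcoef (i :: 'j) (j :: 'i))"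
proof (rule bounded_linear_intro[where K = 1])
  fix T :: "'i ell2 \<Rightarrow>\<^sub>L 'j ell2"
  have "(norm (ket j))\<^sup>2 = 1"
    unfolding power2_norm_eq_inner inner_ell2_def by (simp add: cinner_ket_left ket.rep_eq)
  then have "norm (ket j) = 1" by (metis norm_ge_zero real_sqrt_one real_sqrt_unique)
  then show "norm (mcoef i j T) \<le> norm T * 1"
    unfolding mcoef_def using norm_coord_le[of "blinfun_apply T (ket j)" i] norm_blinfun[of T "ket j"]
    by simp
qed (simp_all add: mcoef_def blinfun.add_left plus_ell2.rep_eq blinfun.scaleR_left scaleR_conv_of_real)

lemma adj_eqI:
  assumes "\<And>x y. cinner (blinfun_apply T' x) y = cinner x (blinfun_apply T y)"
  shows "adj T = T'"
  unfolding adj_def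
proof (rule the_equality)
  fix R assume "\<forall>x y. cinner (blinfun_apply R x) y = cinner x (blinfun_apply T y)"
  then show "R = T'" using assms by (intro blinfun_eqI cinner_eqI) simp
qed (simp add: assms)

text \<open>The adjoint of \<open>T\<close> has to send \<open>x\<close> to the function \<open>i \<mapsto> \<langle>T (ket i), x\<rangle>\<close>; pairing it with
  finite truncations of itself bounds its norm.\<close>

lemma adjoint_exists:
  assumes T: "complex_linear (T :: 'i op)"
  obtains T' where "complex_linear T'"
    "\<And>x y. cinner (blinfun_apply T' x) y = cinner x (blinfun_apply T y)"
proof -
  define g where "g x i = cinner (blinfun_apply T (ket i)) x" for x i
  have bnd: "(\<Sum>i\<in>F. (cmod (g x i))\<^sup>2) \<le> (norm x * norm T)\<^sup>2" if F: "finite F" for x and F :: "'i set"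
  proof -
    define s where "s = (\<Sum>i\<in>F. (cmod (g x i))\<^sup>2)"
    define y where "y = (\<Sum>i\<in>F. scaleC (g x i) (ket i))"
    have yi: "ell2_apply y i = (if i \<in> F then g x i else 0)" for i
      using F by (simp add: y_def ell2_apply_sum ell2_coord if_distrib cong: if_cong)
    have ny: "norm y \<le> sqrt s"
    proof (rule norm_le_by_finite_sums)
      fix F' :: "'i set" assume "finite F'"
      have "(\<Sum>i\<in>F'. (cmod (ell2_apply y i))\<^sup>2) = (\<Sum>i\<in>F' \<inter> F. (cmod (g x i))\<^sup>2)"
        by (rule sum.mono_neutral_cong_right) (use \<open>finite F'\<close> in \<open>auto simp: yi\<close>)
      also have "\<dots> \<le> s" unfolding s_def by (rule sum_mono2) (use F in auto)
      also have "s = (sqrt s)\<^sup>2" by (simp add: s_def sum_nonneg)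
      finally show "(\<Sum>i\<in>F'. (cmod (ell2_apply y i))\<^sup>2) \<le> (sqrt s)\<^sup>2" .
    qed (simp add: s_def sum_nonneg)
    have "cinner x (blinfun_apply T y) = (\<Sum>i\<in>F. g x i * cinner x (blinfun_apply T (ket i)))"
      unfolding y_def blinfun.sum_right
      by (simp add: linear_sum[OF bounded_linear.linear[OF bounded_linear_cinner]]
          complex_linearD[OF T] cinner_scaleC_right)
    also have "\<dots> = (\<Sum>i\<in>F. complex_of_real ((cmod (g x i))\<^sup>2))"
      by (rule sum.cong) (simp_all only: g_def cinner_commute[of x] complex_norm_square)
    finally have "s = inner x (blinfun_apply T y)" by (simp add: inner_ell2_def s_def)
    also have "\<dots> \<le> norm x * (norm T * norm y)"
      by (meson norm_blinfun mult_left_mono norm_cauchy_schwarz norm_ge_zero order_trans)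
    also have "\<dots> \<le> norm x * (norm T * sqrt s)"
      by (intro mult_left_mono ny) auto
    finally have *: "sqrt s * sqrt s \<le> (norm x * norm T) * sqrt s"
      by (simp add: s_def sum_nonneg mult.assoc)
    have "sqrt s \<le> norm x * norm T"
    proof (cases "sqrt s > 0")
      case True
      then show ?thesis using * mult_right_le_imp_le by blast
    next
      case False
      then show ?thesis by (meson mult_nonneg_nonneg norm_ge_zero not_less order_trans)
    qed
    then have "s \<le> (norm x * norm T)\<^sup>2"
      by (metis real_sqrt_le_iff real_sqrt_abs abs_of_nonneg mult_nonneg_nonneg norm_ge_zero)
    then show ?thesis by (simp add: s_def)
  qed
  define h where "h x = Abs_ell2 (g x)" for x
  have h: "ell2_apply (h x) i = g x i" for x i
    using square_summable_by_finite_sums[OF bnd] by (simp add: h_def Abs_ell2_inverse)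
  have "bounded_linear h"
  proof (rule bounded_linear_intro[where K = "norm T"])
    fix x y r
    show "h (x + y) = h x + h y"
      by (rule ell2_eqI) (simp add: h g_def ell2_coord cinner_add_right)
    show "h (r *\<^sub>R x) = r *\<^sub>R h x"
      by (rule ell2_eqI) (simp add: h g_def cinner_scaleC_right scaleR_scaleC scaleC.rep_eq)
    show "norm (h x) \<le> norm x * norm T"
      by (rule norm_le_by_finite_sums) (simp_all add: h bnd)
  qed
  then have app: "blinfun_apply (Blinfun h) = h" by (rule bounded_linear_Blinfun_apply)
  show ?thesis
  proof
    show "complex_linear (Blinfun h)"
      unfolding complex_linear_def app
      by (intro allI ell2_eqI) (simp add: h g_def cinner_scaleC_right ell2_coord)
    fix x y
    have "cinner (h x) y = (cinner x \<circ> blinfun_apply T) y"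
    proof (rule bounded_linear_ket_eqI)
      show "bounded_linear (cinner x \<circ> blinfun_apply T)"
        unfolding comp_def
        by (rule bounded_linear_compose[OF bounded_linear_cinner blinfun.bounded_linear_right])
    next
      fix c i show "cinner (h x) (scaleC c (ket i)) = (cinner x \<circ> blinfun_apply T) (scaleC c (ket i))"
        by (simp add: cinner_scaleC_right cinner_ket_right h g_def complex_linearD[OF T]
            flip: cinner_commute)
    qed (rule bounded_linear_cinner)
    then show "cinner (blinfun_apply (Blinfun h) x) y = cinner x (blinfun_apply T y)"
      by (simp add: app)
  qed
qed

lemma
  assumes "complex_linear T"
  shows cinner_adj: "cinner (blinfun_apply (adj T) x) y = cinner x (blinfun_apply T y)"
    and complex_linear_adj [cl_intros]: "complex_linear (adj T)"
proof -
  obtain T' where T': "complex_linear T'"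
    "\<And>x y. cinner (blinfun_apply T' x) y = cinner x (blinfun_apply T y)"
    using adjoint_exists[OF assms] by blast
  moreover have "adj T = T'" by (rule adj_eqI) (rule T')
  ultimately show "cinner (blinfun_apply (adj T) x) y = cinner x (blinfun_apply T y)"
    "complex_linear (adj T)" by simp_all
qed

lemma mcoef_adj: "complex_linear T \<Longrightarrow> mcoef i j (adj T) = cnj (mcoef j i T)"
  by (metis mcoef_def cinner_adj cinner_ket_left cinner_ket_right complex_cnj_cnj)

lemma adj_eqI_mcoef:
  assumes "complex_linear T" "complex_linear T'" "\<And>i j. mcoef i j T' = cnj (mcoef j i T)"
  shows "adj T = T'"
  by (rule op_eqI_mcoef) (use assms in \<open>simp_all add: mcoef_adj cl_intros\<close>)

lemma adj_zero [simp]: "adj 0 = 0"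
  by (rule adj_eqI_mcoef) (simp_all add: cl_intros mcoef_algebra)

lemma adj_add: "complex_linear S \<Longrightarrow> complex_linear T \<Longrightarrow> adj (S + T) = adj S + adj T"
  by (rule adj_eqI_mcoef) (simp_all add: cl_intros mcoef_algebra mcoef_adj)

lemma adj_scale_op: "complex_linear T \<Longrightarrow> adj (scale_op c T) = scale_op (cnj c) (adj T)"
  by (rule adj_eqI_mcoef) (simp_all add: cl_intros mcoef_algebra mcoef_adj)

lemma adj_sum: "(\<And>k. k \<in> F \<Longrightarrow> complex_linear (f k)) \<Longrightarrow> adj (\<Sum>k\<in>F. f k) = (\<Sum>k\<in>F. adj (f k))"
  by (induction F rule: infinite_finite_induct) (simp_all add: adj_add cl_intros)

lemma adj_adj: "complex_linear T \<Longrightarrow> adj (adj T) = T"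
  by (rule adj_eqI_mcoef) (simp_all add: cl_intros mcoef_adj)

lemma adj_compose: "complex_linear S \<Longrightarrow> complex_linear T \<Longrightarrow> adj (S o\<^sub>L T) = adj T o\<^sub>L adj S"
  by (rule adj_eqI) (simp add: cinner_adj)


section \<open>Operators that permute kets\<close>

text \<open>Every operator below that moves kets around comes from an injection on a subset of the
  index type: the unitaries of bijections, the left regular representation, and the inclusions and
  projections of direct sums and tensor products.\<close>

definition partial_perm_op :: "'i set \<Rightarrow> ('i \<Rightarrow> 'j) \<Rightarrow> ('i ell2 \<Rightarrow>\<^sub>L 'j ell2)" where
  "partial_perm_op D \<pi> = Blinfun (\<lambda>x. Abs_ell2
     (\<lambda>k. if k \<in> \<pi> ` D then ell2_apply x (inv_into D \<pi> k) else 0))"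

lemma partial_perm_op_apply:
  assumes inj: "inj_on \<pi> D"
  shows "ell2_apply (blinfun_apply (partial_perm_op D \<pi>) x) k =
    (if k \<in> \<pi> ` D then ell2_apply x (inv_into D \<pi> k) else 0)"
proof -
  define g where "g x k = (if k \<in> \<pi> ` D then ell2_apply x (inv_into D \<pi> k) else 0)" for x k
  have bnd: "(\<Sum>k\<in>F. (cmod (g x k))\<^sup>2) \<le> (norm x)\<^sup>2" if F: "finite F" for x F
  proof -
    have "(\<Sum>k\<in>F. (cmod (g x k))\<^sup>2) = (\<Sum>k\<in>F \<inter> \<pi> ` D. (cmod (ell2_apply x (inv_into D \<pi> k)))\<^sup>2)"
      by (rule sum.mono_neutral_cong_right) (use F in \<open>auto simp: g_def\<close>)
    also have "\<dots> = (\<Sum>i\<in>inv_into D \<pi> ` (F \<inter> \<pi> ` D). (cmod (ell2_apply x i))\<^sup>2)"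
      by (subst sum.reindex) (auto intro: inj_on_subset[OF inj_on_inv_into[OF subset_refl]])
    also have "\<dots> \<le> (norm x)\<^sup>2" by (rule sum_coord_le_norm) (use F in auto)
    finally show ?thesis .
  qed
  define h where "h x = Abs_ell2 (g x)" for x
  have h: "ell2_apply (h x) i = g x i" for x i
    using square_summable_by_finite_sums[OF bnd] by (simp add: h_def Abs_ell2_inverse)
  have "bounded_linear h"
  proof (rule bounded_linear_intro[where K = 1])
    fix x show "norm (h x) \<le> norm x * 1"
      by (rule norm_le_by_finite_sums) (simp_all add: h bnd)
  qed (rule ell2_eqI; simp add: h g_def ell2_coord)+
  then have "blinfun_apply (partial_perm_op D \<pi>) = h"
    unfolding partial_perm_op_def g_def[symmetric, abs_def] h_def[symmetric, abs_def]
    by (rule bounded_linear_Blinfun_apply)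
  then show ?thesis by (simp add: h g_def)
qed

lemma partial_perm_op_ket:
  assumes "inj_on \<pi> D"
  shows "blinfun_apply (partial_perm_op D \<pi>) (ket i) = (if i \<in> D then ket (\<pi> i) else 0)"
  by (rule ell2_eqI) (use assms in \<open>auto simp: partial_perm_op_apply ell2_coord f_inv_into_f inv_into_into\<close>)

lemma complex_linear_partial_perm_op [cl_intros]: "inj_on \<pi> D \<Longrightarrow> complex_linear (partial_perm_op D \<pi>)"
  unfolding complex_linear_def
  by (intro allI ell2_eqI) (simp add: partial_perm_op_apply ell2_coord)

lemma the_op_eq:
  assumes "complex_linear T" "\<And>i. blinfun_apply T (ket i) = f i"
  shows "(THE T. complex_linear T \<and> (\<forall>i. blinfun_apply T (ket i) = f i)) = T"
proof (rule the_equality)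
  fix R assume "complex_linear R \<and> (\<forall>i. blinfun_apply R (ket i) = f i)"
  then show "R = T" using assms by (intro op_eqI_ket) auto
qed (use assms in simp)

lemma perm_op_eq: "inj \<pi> \<Longrightarrow> perm_op \<pi> = partial_perm_op UNIV \<pi>"
  unfolding perm_op_def by (rule the_op_eq) (simp_all add: cl_intros partial_perm_op_ket)

lemma bounded_linear_compose_left: "bounded_linear (\<lambda>S. S o\<^sub>L T)"
  by (rule bounded_bilinear.bounded_linear_left[OF bounded_bilinear_blinfun_compose])

lemma bounded_linear_compose_right: "bounded_linear (\<lambda>T. S o\<^sub>L T)"
  by (rule bounded_bilinear.bounded_linear_right[OF bounded_bilinear_blinfun_compose])

lemma compose_sum_left: "(\<Sum>k\<in>F. f k) o\<^sub>L T = (\<Sum>k\<in>F. f k o\<^sub>L T)"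
  by (rule linear_sum[OF bounded_linear.linear[OF bounded_linear_compose_left]])

lemma compose_sum_right: "S o\<^sub>L (\<Sum>k\<in>F. f k) = (\<Sum>k\<in>F. S o\<^sub>L f k)"
  by (rule linear_sum[OF bounded_linear.linear[OF bounded_linear_compose_right]])

lemmas compose_add = bounded_bilinear.add_left[OF bounded_bilinear_blinfun_compose]
  bounded_bilinear.add_right[OF bounded_bilinear_blinfun_compose]

lemma bounded_linear_reindex_op: "bounded_linear (reindex_op \<pi>)"
  unfolding reindex_op_def
  using bounded_linear_compose[OF bounded_linear_compose_left bounded_linear_compose_right] .

lemma complex_linear_reindex_op [cl_intros]:
  "bij \<pi> \<Longrightarrow> complex_linear T \<Longrightarrow> complex_linear (reindex_op \<pi> T)"
  by (simp add: reindex_op_def perm_op_eq bij_is_inj bij_imp_bij_inv cl_intros)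

lemma mcoef_reindex_op:
  assumes "bij \<pi>" "complex_linear T"
  shows "mcoef (\<pi> i) (\<pi> j) (reindex_op \<pi> T) = mcoef i j T"
  using assms
  by (simp add: mcoef_def reindex_op_def perm_op_eq bij_is_inj bij_imp_bij_inv partial_perm_op_ket
      partial_perm_op_apply)

lemma reindex_op_scale_op:
  assumes "bij \<pi>" shows "reindex_op \<pi> (scale_op c T) = scale_op c (reindex_op \<pi> T)"
  by (rule blinfun_eqI)
     (simp add: reindex_op_def perm_op_eq assms bij_is_inj scale_op_apply complex_linearD cl_intros)


section \<open>Tensor products of operators\<close>

definition row_op :: "'i \<Rightarrow> ('i \<times> 'j) ell2 \<Rightarrow>\<^sub>L 'j ell2" where
  "row_op i = partial_perm_op ({i} \<times> UNIV) snd"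

definition col_op :: "'i \<Rightarrow> 'j ell2 \<Rightarrow>\<^sub>L ('i \<times> 'j) ell2" where
  "col_op i = partial_perm_op UNIV (Pair i)"

lemma inj_on_snd_fibre: "inj_on snd ({i} \<times> UNIV)"
  by (auto simp: inj_on_def)

lemma row_op_apply [simp]: "ell2_apply (blinfun_apply (row_op i) f) j = ell2_apply f (i, j)"
proof -
  have "inv_into ({i} \<times> UNIV) snd j = (i, j)"
    by (rule inv_into_f_eq[OF inj_on_snd_fibre]) auto
  moreover have "j \<in> snd ` ({i} \<times> UNIV)" by force
  ultimately show ?thesis by (simp add: row_op_def partial_perm_op_apply[OF inj_on_snd_fibre])
qed

lemma col_op_ket [simp]: "blinfun_apply (col_op i) (ket j) = ket (i, j)"
  by (simp add: col_op_def partial_perm_op_ket inj_on_def)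

lemma complex_linear_row_op [cl_intros]: "complex_linear (row_op i)"
  by (simp add: row_op_def complex_linear_partial_perm_op inj_on_snd_fibre)

lemma complex_linear_col_op [cl_intros]: "complex_linear (col_op i)"
  by (simp add: col_op_def complex_linear_partial_perm_op inj_on_def)

lemma sum_norm_row_op_le:
  assumes I: "finite I"
  shows "(\<Sum>i\<in>I. (norm (blinfun_apply (row_op i) f))\<^sup>2) \<le> (norm f)\<^sup>2"
proof -
  let ?a = "\<lambda>p. (cmod (ell2_apply f p))\<^sup>2"
  have s: "?a summable_on (I \<times> UNIV)"
    by (rule summable_on_subset_banach[OF summable_ell2]) auto
  have "(\<Sum>i\<in>I. (norm (blinfun_apply (row_op i) f))\<^sup>2) = (\<Sum>\<^sub>\<infinity>i\<in>I. \<Sum>\<^sub>\<infinity>j. ?a (i, j))"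
    using I by (simp add: norm_ell2_power2)
  also have "\<dots> = infsum ?a (I \<times> UNIV)"
    using infsum_Sigma_banach[OF s] by simp
  also have "\<dots> \<le> infsum ?a UNIV"
    by (rule infsum_mono2[OF s summable_ell2]) auto
  finally show ?thesis by (simp add: norm_ell2_power2)
qed

text \<open>This is \<open>1 \<otimes> T\<close>, acting on each row of a function of two variables.  A tensor product
  \<open>S \<otimes> T\<close> is then built from \<open>1 \<otimes> T\<close> and \<open>1 \<otimes> S\<close> with the flip in between.\<close>

definition amplify :: "'j op \<Rightarrow> ('i \<times> 'j) op" where
  "amplify T = Blinfun (\<lambda>f. Abs_ell2
     (\<lambda>(i, j). ell2_apply (blinfun_apply T (blinfun_apply (row_op i) f)) j))"

lemma
  fixes T :: "'j op" and f :: "('i \<times> 'j) ell2"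
  shows amplify_apply: "ell2_apply (blinfun_apply (amplify T) f) (i, j) =
      ell2_apply (blinfun_apply T (blinfun_apply (row_op i) f)) j"
    and norm_amplify: "norm (amplify T :: ('i \<times> 'j) op) \<le> norm T"
proof -
  define g where "g = (\<lambda>f (i :: 'i, j :: 'j). ell2_apply (blinfun_apply T (blinfun_apply (row_op i) f)) j)"
  have bnd: "(\<Sum>p\<in>F. (cmod (g f p))\<^sup>2) \<le> (norm T * norm f)\<^sup>2" if F: "finite F" for f F
  proof -
    have "(\<Sum>p\<in>F. (cmod (g f p))\<^sup>2) \<le> (\<Sum>p\<in>fst ` F \<times> snd ` F. (cmod (g f p))\<^sup>2)"
      by (rule sum_mono2) (use F in force)+
    also have "\<dots> = (\<Sum>i\<in>fst ` F. \<Sum>j\<in>snd ` F. (cmod (g f (i, j)))\<^sup>2)"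
      by (simp add: sum.cartesian_product)
    also have "\<dots> \<le> (\<Sum>i\<in>fst ` F. (norm (blinfun_apply T (blinfun_apply (row_op i) f)))\<^sup>2)"
      unfolding g_def split_conv by (intro sum_mono sum_coord_le_norm) (use F in auto)
    also have "\<dots> \<le> (\<Sum>i\<in>fst ` F. (norm T)\<^sup>2 * (norm (blinfun_apply (row_op i) f))\<^sup>2)"
      by (intro sum_mono) (metis norm_blinfun norm_ge_zero power_mono power_mult_distrib)
    also have "\<dots> \<le> (norm T)\<^sup>2 * (norm f)\<^sup>2"
      unfolding sum_distrib_left[symmetric]
      by (intro mult_left_mono sum_norm_row_op_le) (use F in auto)
    finally show ?thesis by (simp add: power_mult_distrib)
  qed
  define h where "h f = Abs_ell2 (g f)" for f
  have h: "ell2_apply (h f) p = g f p" for f p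
    using square_summable_by_finite_sums[OF bnd] by (simp add: h_def Abs_ell2_inverse)
  have nh: "norm (h f) \<le> norm T * norm f" for f
    by (rule norm_le_by_finite_sums) (simp_all add: h bnd)
  have "bounded_linear h"
  proof (rule bounded_linear_intro[where K = "norm T"])
    fix f show "norm (h f) \<le> norm f * norm T" using nh[of f] by (simp add: mult.commute)
  qed (rule ell2_eqI; auto simp: h g_def ell2_coord blinfun.add_right blinfun.scaleR_right)+
  then have app: "blinfun_apply (amplify T) = h"
    unfolding amplify_def h_def g_def
    by (rule bounded_linear_Blinfun_apply)
  show "ell2_apply (blinfun_apply (amplify T) f) (i, j) =
      ell2_apply (blinfun_apply T (blinfun_apply (row_op i) f)) j"
    by (simp add: app h g_def)
  show "norm (amplify T :: ('i \<times> 'j) op) \<le> norm T"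
    by (rule norm_blinfun_bound) (simp_all add: app nh)
qed

lemma complex_linear_amplify [cl_intros]:
  "complex_linear T \<Longrightarrow> complex_linear (amplify T :: ('i \<times> 'j) op)"
  unfolding complex_linear_def
proof (intro allI ell2_eqI)
  fix c :: complex and x :: "('i \<times> 'j) ell2" and p :: "'i \<times> 'j"
  assume T: "\<forall>c x. blinfun_apply T (scaleC c x) = scaleC c (blinfun_apply T x)"
  have "blinfun_apply (row_op i) (scaleC c x) = scaleC c (blinfun_apply (row_op i) x)" for i
    by (rule ell2_eqI) (simp add: ell2_coord)
  then show "ell2_apply (blinfun_apply (amplify T) (scaleC c x)) p =
      ell2_apply (scaleC c (blinfun_apply (amplify T) x)) p"
    using T by (cases p) (simp add: amplify_apply ell2_coord)
qed

lemma bounded_linear_amplify: "bounded_linear (amplify :: 'j op \<Rightarrow> ('i \<times> 'j) op)"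
proof (rule bounded_linear_intro[where K = 1])
  fix S T :: "'j op" and r
  show "amplify (S + T) = amplify S + (amplify T :: ('i \<times> 'j) op)"
    by (intro blinfun_eqI ell2_eqI) (auto simp: amplify_apply blinfun.add_left ell2_coord)
  show "amplify (r *\<^sub>R T) = r *\<^sub>R (amplify T :: ('i \<times> 'j) op)"
    by (intro blinfun_eqI ell2_eqI) (auto simp: amplify_apply blinfun.scaleR_left)
qed (simp add: norm_amplify)

lemma ket_pair: "ket (i, j) = tensor_vec (ket i) (ket j)"
  by (rule ell2_eqI) (auto simp: ket.rep_eq tensor_vec.rep_eq split: prod.splits)

lemma scaleC_tensor_vec: "scaleC c (tensor_vec x y) = tensor_vec (scaleC c x) y"
  by (rule ell2_eqI) (auto simp: scaleC.rep_eq tensor_vec.rep_eq split: prod.splits)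

lemma amplify_tensor_vec:
  assumes "complex_linear T"
  shows "blinfun_apply (amplify T) (tensor_vec x y) = tensor_vec x (blinfun_apply T y)"
proof (rule ell2_eqI)
  fix p :: "'b \<times> 'a"
  have "blinfun_apply (row_op i) (tensor_vec x y) = scaleC (ell2_apply x i) y" for i
    by (rule ell2_eqI) (simp add: tensor_vec.rep_eq scaleC.rep_eq)
  then show "ell2_apply (blinfun_apply (amplify T) (tensor_vec x y)) p =
      ell2_apply (tensor_vec x (blinfun_apply T y)) p"
    by (cases p) (simp add: amplify_apply complex_linearD[OF assms] tensor_vec.rep_eq scaleC.rep_eq)
qed

lemma swap_tensor_vec:
  fixes x :: "'i ell2" and y :: "'j ell2"
  shows "blinfun_apply (perm_op prod.swap) (tensor_vec x y) = tensor_vec y x"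
proof (rule ell2_eqI)
  fix p :: "'j \<times> 'i"
  obtain j i where p: "p = (j, i)" by (cases p)
  have "Hilbert_Choice.inv prod.swap (j, i) = (i, j)" by (rule inv_f_eq) simp_all
  then show "ell2_apply (blinfun_apply (perm_op prod.swap) (tensor_vec x y)) p =
      ell2_apply (tensor_vec y x) p"
    by (simp add: p perm_op_eq partial_perm_op_apply tensor_vec.rep_eq)
qed

text \<open>Where both factors are complex-linear this is their tensor product.  In contrast to
  \<open>S \<otimes>\<^sub>o T\<close>, it is bounded linear in \<open>T\<close> without any condition on \<open>T\<close>, which is what the
  continuity and closedness arguments below need.\<close>

definition amplified_product :: "'i op \<Rightarrow> 'j op \<Rightarrow> ('i \<times> 'j) op" where
  "amplified_product S T =
     perm_op prod.swap o\<^sub>L amplify S o\<^sub>L perm_op prod.swap o\<^sub>L amplify T"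

lemma bounded_linear_amplified_product: "bounded_linear (amplified_product S)"
  unfolding amplified_product_def
  by (rule bounded_linear_compose[OF bounded_linear_compose_right bounded_linear_amplify])

lemma tensor_op_eq:
  assumes S: "complex_linear S" and T: "complex_linear T"
  shows "S \<otimes>\<^sub>o T = amplified_product S T"
  unfolding tensor_op_def
proof (rule the_equality)
  show tens: "\<forall>x y. blinfun_apply (amplified_product S T) (tensor_vec x y) =
      tensor_vec (blinfun_apply S x) (blinfun_apply T y)"
    by (simp add: amplified_product_def amplify_tensor_vec[OF S] amplify_tensor_vec[OF T]
        swap_tensor_vec)
  fix R assume "\<forall>x y. blinfun_apply R (tensor_vec x y) =
      tensor_vec (blinfun_apply S x) (blinfun_apply T y)"
  then show "R = amplified_product S T"
    using tens by (intro blinfun_ket_eqI) (auto simp: ket_pair scaleC_tensor_vec)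
qed

lemma tensor_op_apply:
  assumes S: "complex_linear S" and T: "complex_linear T"
  shows "blinfun_apply (S \<otimes>\<^sub>o T) (tensor_vec x y) = tensor_vec (blinfun_apply S x) (blinfun_apply T y)"
  by (simp add: tensor_op_eq[OF S T] amplified_product_def amplify_tensor_vec[OF S]
      amplify_tensor_vec[OF T] swap_tensor_vec)

lemma complex_linear_tensor_op [cl_intros]:
  "complex_linear S \<Longrightarrow> complex_linear T \<Longrightarrow> complex_linear (S \<otimes>\<^sub>o T)"
  by (simp add: tensor_op_eq amplified_product_def cl_intros perm_op_eq inj_on_def)

lemma mcoef_tensor_op:
  assumes "complex_linear S" "complex_linear T"
  shows "mcoef (i, j) (k, l) (S \<otimes>\<^sub>o T) = mcoef i k S * mcoef j l T"
  by (simp add: mcoef_def ket_pair tensor_op_apply assms tensor_vec.rep_eq)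

lemma tensor_op_eqI:
  fixes R R' :: "('i \<times> 'j) op"
  assumes "complex_linear R" "complex_linear R'"
    "\<And>i j k l. mcoef (i, j) (k, l) R = mcoef (i, j) (k, l) R'"
  shows "R = R'"
  by (rule op_eqI_mcoef) (use assms in auto)

lemma tensor_add_left: "\<lbrakk>complex_linear S; complex_linear S'; complex_linear T\<rbrakk> \<Longrightarrow>
    (S + S') \<otimes>\<^sub>o T = S \<otimes>\<^sub>o T + S' \<otimes>\<^sub>o T"
  by (rule tensor_op_eqI) (simp_all add: cl_intros mcoef_tensor_op mcoef_algebra algebra_simps)

lemma tensor_add_right: "\<lbrakk>complex_linear S; complex_linear T; complex_linear T'\<rbrakk> \<Longrightarrow>
    S \<otimes>\<^sub>o (T + T') = S \<otimes>\<^sub>o T + S \<otimes>\<^sub>o T'"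
  by (rule tensor_op_eqI) (simp_all add: cl_intros mcoef_tensor_op mcoef_algebra algebra_simps)

lemma tensor_zero_left [simp]: "complex_linear T \<Longrightarrow> 0 \<otimes>\<^sub>o T = 0"
  by (rule tensor_op_eqI) (simp_all add: cl_intros mcoef_tensor_op mcoef_algebra)

lemma tensor_zero_right [simp]: "complex_linear S \<Longrightarrow> S \<otimes>\<^sub>o 0 = 0"
  by (rule tensor_op_eqI) (simp_all add: cl_intros mcoef_tensor_op mcoef_algebra)

lemma tensor_scale_left: "\<lbrakk>complex_linear S; complex_linear T\<rbrakk> \<Longrightarrow>
    scale_op c S \<otimes>\<^sub>o T = scale_op c (S \<otimes>\<^sub>o T)"
  by (rule tensor_op_eqI) (simp_all add: cl_intros mcoef_tensor_op mcoef_algebra)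

lemma tensor_scale_right: "\<lbrakk>complex_linear S; complex_linear T\<rbrakk> \<Longrightarrow>
    S \<otimes>\<^sub>o scale_op c T = scale_op c (S \<otimes>\<^sub>o T)"
  by (rule tensor_op_eqI) (simp_all add: cl_intros mcoef_tensor_op mcoef_algebra)

lemma tensor_sum_left: "\<lbrakk>\<And>k. k \<in> F \<Longrightarrow> complex_linear (f k); complex_linear T\<rbrakk> \<Longrightarrow>
    (\<Sum>k\<in>F. f k) \<otimes>\<^sub>o T = (\<Sum>k\<in>F. f k \<otimes>\<^sub>o T)"
  by (induction F rule: infinite_finite_induct) (simp_all add: tensor_add_left cl_intros)

lemma tensor_sum_right: "\<lbrakk>\<And>k. k \<in> F \<Longrightarrow> complex_linear (f k); complex_linear S\<rbrakk> \<Longrightarrow>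
    S \<otimes>\<^sub>o (\<Sum>k\<in>F. f k) = (\<Sum>k\<in>F. S \<otimes>\<^sub>o f k)"
  by (induction F rule: infinite_finite_induct) (simp_all add: tensor_add_right cl_intros)

lemma tensor_compose:
  assumes "complex_linear S" "complex_linear S'" "complex_linear T" "complex_linear T'"
  shows "(S \<otimes>\<^sub>o T) o\<^sub>L (S' \<otimes>\<^sub>o T') = (S o\<^sub>L S') \<otimes>\<^sub>o (T o\<^sub>L T')"
proof (rule op_eqI_ket)
  fix p show "blinfun_apply ((S \<otimes>\<^sub>o T) o\<^sub>L (S' \<otimes>\<^sub>o T')) (ket p) =
      blinfun_apply ((S o\<^sub>L S') \<otimes>\<^sub>o (T o\<^sub>L T')) (ket p)"
    by (cases p) (simp add: ket_pair tensor_op_apply assms cl_intros)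
qed (simp_all add: assms cl_intros)

lemma adj_tensor: "complex_linear S \<Longrightarrow> complex_linear T \<Longrightarrow> adj (S \<otimes>\<^sub>o T) = adj S \<otimes>\<^sub>o adj T"
  by (rule adj_eqI_mcoef) (auto simp: cl_intros mcoef_tensor_op mcoef_adj)

lemma bij_assoc: "bij (\<lambda>((i, j), k). (i, j, k))"
  by (rule o_bij[where g = "\<lambda>(i, j, k). ((i, j), k)"]) auto

lemma complex_linear_flip [cl_intros]: "complex_linear T \<Longrightarrow> complex_linear (flip T)"
  by (simp add: flip_def cl_intros)

lemma complex_linear_reassoc [cl_intros]: "complex_linear T \<Longrightarrow> complex_linear (reassoc T)"
  by (simp add: reassoc_def cl_intros bij_assoc)

lemma mcoef_flip: "complex_linear T \<Longrightarrow> mcoef (j, i) (l, k) (flip T) = mcoef (i, j) (k, l) T"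
  using mcoef_reindex_op[OF bij_swap, of T "(i, j)" "(k, l)"] by (simp add: flip_def)

lemma mcoef_reassoc: "complex_linear T \<Longrightarrow>
    mcoef (i, j, k) (i', j', k') (reassoc T) = mcoef ((i, j), k) ((i', j'), k') T"
  using mcoef_reindex_op[OF bij_assoc, of T "((i, j), k)" "((i', j'), k')"]
  by (simp add: reassoc_def)

lemma flip_tensor: "complex_linear S \<Longrightarrow> complex_linear T \<Longrightarrow> flip (S \<otimes>\<^sub>o T) = T \<otimes>\<^sub>o S"
  by (rule tensor_op_eqI) (simp_all add: cl_intros mcoef_flip mcoef_tensor_op)

lemma flip_flip: "complex_linear T \<Longrightarrow> flip (flip T) = T"
  by (rule tensor_op_eqI) (simp_all add: cl_intros mcoef_flip)

lemma reassoc_tensor: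
  assumes "complex_linear R" "complex_linear S" "complex_linear T"
  shows "reassoc ((R \<otimes>\<^sub>o S) \<otimes>\<^sub>o T) = R \<otimes>\<^sub>o S \<otimes>\<^sub>o T"
  by (rule op_eqI_mcoef) (auto simp: cl_intros mcoef_reassoc mcoef_tensor_op assms)

lemma flip_add: "flip (S + T) = flip S + flip T"
  unfolding flip_def by (rule linear_add[OF bounded_linear.linear[OF bounded_linear_reindex_op]])

lemma flip_scale_op: "flip (scale_op c T) = scale_op c (flip T)"
  by (simp add: flip_def reindex_op_scale_op)

lemma reassoc_add: "reassoc (S + T) = reassoc S + reassoc T"
  unfolding reassoc_def by (rule linear_add[OF bounded_linear.linear[OF bounded_linear_reindex_op]])

lemma reassoc_scale_op: "reassoc (scale_op c T) = scale_op c (reassoc T)"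
  by (simp add: reassoc_def reindex_op_scale_op bij_assoc)

text \<open>This is the block of \<open>R\<close> at position \<open>(i, k)\<close> when operators on the product space are viewed as
  matrices of operators on the second factor, that is, the slice map of a matrix unit.\<close>

definition slice :: "'i \<Rightarrow> 'i \<Rightarrow> ('i \<times> 'j) op \<Rightarrow> 'j op" where
  "slice i k R = row_op i o\<^sub>L R o\<^sub>L col_op k"

lemma slice_tensor:
  assumes "complex_linear S" "complex_linear T"
  shows "slice i k (S \<otimes>\<^sub>o T) = scale_op (mcoef i k S) T"
proof (rule op_eqI_ket)
  fix j show "blinfun_apply (slice i k (S \<otimes>\<^sub>o T)) (ket j) =
      blinfun_apply (scale_op (mcoef i k S) T) (ket j)"
    by (rule ell2_eqI) (simp add: slice_def ket_pair tensor_op_apply assms tensor_vec.rep_eq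
        scale_op_apply scaleC.rep_eq mcoef_def)
qed (use assms in \<open>simp_all add: slice_def cl_intros\<close>)

lemma bounded_linear_slice: "bounded_linear (slice i k)"
  unfolding slice_def
  using bounded_linear_compose[OF bounded_linear_compose_left bounded_linear_compose_right] .

lemma slice_sum: "slice i k (\<Sum>x\<in>F. f x) = (\<Sum>x\<in>F. slice i k (f x))"
  by (rule linear_sum[OF bounded_linear.linear[OF bounded_linear_slice]])

lemma slice_add: "slice i k (S + T) = slice i k S + slice i k T"
  by (rule linear_add[OF bounded_linear.linear[OF bounded_linear_slice]])

lemma slice_scale_op: "slice i k (scale_op c T) = scale_op c (slice i k T)"
  by (rule blinfun_eqI) (simp add: slice_def scale_op_apply complex_linearD cl_intros)


section \<open>Direct sums of operators\<close>

lemma inl_vec_eq: "inl_vec x = blinfun_apply (partial_perm_op UNIV Inl) x"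
  by (rule ell2_eqI) (auto simp: inl_vec.rep_eq partial_perm_op_apply split: sum.splits)

lemma inr_vec_eq: "inr_vec x = blinfun_apply (partial_perm_op UNIV Inr) x"
  by (rule ell2_eqI) (auto simp: inr_vec.rep_eq partial_perm_op_apply split: sum.splits)

lemma inj_on_proj: "inj_on projl (range Inl)" "inj_on projr (range Inr)"
  by (auto simp: inj_on_def)

lemma inv_into_proj: "inv_into (range Inl) projl k = Inl k" "inv_into (range Inr) projr k = Inr k"
  by (rule inv_into_f_eq[OF inj_on_proj(1)] inv_into_f_eq[OF inj_on_proj(2)]; auto)+

lemma proj_inl_inr:
  "blinfun_apply (partial_perm_op (range Inl) projl) (inl_vec x) = x"
  "blinfun_apply (partial_perm_op (range Inl) projl) (inr_vec y) = 0"
  "blinfun_apply (partial_perm_op (range Inr) projr) (inl_vec x) = 0"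
  "blinfun_apply (partial_perm_op (range Inr) projr) (inr_vec y) = y"
  by (rule ell2_eqI; simp add: partial_perm_op_apply inj_on_proj inv_into_proj inl_vec.rep_eq
        inr_vec.rep_eq zero_ell2.rep_eq image_image)+

lemma scaleC_inl_inr: "scaleC c (inl_vec x) = inl_vec (scaleC c x)"
  "scaleC c (inr_vec y) = inr_vec (scaleC c y)"
  by (rule ell2_eqI; auto simp: scaleC.rep_eq inl_vec.rep_eq inr_vec.rep_eq split: sum.splits)+

lemma ket_Inl: "ket (Inl i) = inl_vec (ket i)" and ket_Inr: "ket (Inr i) = inr_vec (ket i)"
  by (rule ell2_eqI; auto simp: ket.rep_eq inl_vec.rep_eq inr_vec.rep_eq split: sum.splits)+

lemma dsum_op_eq: "S \<oplus>\<^sub>o T =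
    (partial_perm_op UNIV Inl o\<^sub>L S o\<^sub>L partial_perm_op (range Inl) projl) +
    (partial_perm_op UNIV Inr o\<^sub>L T o\<^sub>L partial_perm_op (range Inr) projr)" (is "_ = ?D")
  unfolding dsum_op_def
proof (rule the_equality)
  show D: "(\<forall>x. blinfun_apply ?D (inl_vec x) = inl_vec (blinfun_apply S x)) \<and>
      (\<forall>y. blinfun_apply ?D (inr_vec y) = inr_vec (blinfun_apply T y))"
    by (simp add: blinfun.add_left proj_inl_inr flip: inl_vec_eq inr_vec_eq)
  fix R assume R: "(\<forall>x. blinfun_apply R (inl_vec x) = inl_vec (blinfun_apply S x)) \<and>
      (\<forall>y. blinfun_apply R (inr_vec y) = inr_vec (blinfun_apply T y))"
  show "R = ?D"
  proof (rule blinfun_ket_eqI)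
    fix c k show "blinfun_apply R (scaleC c (ket k)) = blinfun_apply ?D (scaleC c (ket k))"
      by (cases k) (simp_all only: ket_Inl ket_Inr scaleC_inl_inr R D)
  qed
qed

lemma dsum_apply:
  "blinfun_apply (S \<oplus>\<^sub>o T) (inl_vec x) = inl_vec (blinfun_apply S x)"
  "blinfun_apply (S \<oplus>\<^sub>o T) (inr_vec y) = inr_vec (blinfun_apply T y)"
  by (simp_all add: dsum_op_eq blinfun.add_left proj_inl_inr flip: inl_vec_eq inr_vec_eq)

lemma complex_linear_dsum [cl_intros]:
  "complex_linear S \<Longrightarrow> complex_linear T \<Longrightarrow> complex_linear (S \<oplus>\<^sub>o T)"
  by (simp add: dsum_op_eq cl_intros inj_on_proj)

lemma mcoef_dsum:
  "mcoef (Inl i) (Inl j) (S \<oplus>\<^sub>o T) = mcoef i j S" "mcoef (Inr k) (Inr l) (S \<oplus>\<^sub>o T) = mcoef k l T"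
  "mcoef (Inl i) (Inr l) (S \<oplus>\<^sub>o T) = 0" "mcoef (Inr k) (Inl j) (S \<oplus>\<^sub>o T) = 0"
  by (simp_all add: mcoef_def ket_Inl ket_Inr dsum_apply inl_vec.rep_eq inr_vec.rep_eq)

lemma dsum_eqI:
  fixes R R' :: "('i + 'j) op"
  assumes "complex_linear R" "complex_linear R'"
    "\<And>i j. mcoef (Inl i) (Inl j) R = mcoef (Inl i) (Inl j) R'"
    "\<And>i j. mcoef (Inl i) (Inr j) R = mcoef (Inl i) (Inr j) R'"
    "\<And>i j. mcoef (Inr i) (Inl j) R = mcoef (Inr i) (Inl j) R'"
    "\<And>i j. mcoef (Inr i) (Inr j) R = mcoef (Inr i) (Inr j) R'"
  shows "R = R'"
proof (rule op_eqI_mcoef[OF assms(1,2)])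
  fix i j show "mcoef i j R = mcoef i j R'" using assms(3-6) by (cases i; cases j) auto
qed

lemma dsum_add: "\<lbrakk>complex_linear S; complex_linear T; complex_linear S'; complex_linear T'\<rbrakk> \<Longrightarrow>
    (S \<oplus>\<^sub>o T) + (S' \<oplus>\<^sub>o T') = (S + S') \<oplus>\<^sub>o (T + T')"
  by (rule dsum_eqI) (simp_all add: cl_intros mcoef_dsum mcoef_algebra)

lemma dsum_scale: "\<lbrakk>complex_linear S; complex_linear T\<rbrakk> \<Longrightarrow>
    scale_op c (S \<oplus>\<^sub>o T) = scale_op c S \<oplus>\<^sub>o scale_op c T"
  by (rule dsum_eqI) (simp_all add: cl_intros mcoef_dsum mcoef_algebra)

lemma dsum_zero: "0 \<oplus>\<^sub>o 0 = 0"
  by (rule dsum_eqI) (simp_all add: cl_intros mcoef_dsum mcoef_algebra)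

lemma dsum_compose:
  assumes "complex_linear S" "complex_linear T" "complex_linear S'" "complex_linear T'"
  shows "(S \<oplus>\<^sub>o T) o\<^sub>L (S' \<oplus>\<^sub>o T') = (S o\<^sub>L S') \<oplus>\<^sub>o (T o\<^sub>L T')"
proof (rule op_eqI_ket)
  fix k show "blinfun_apply ((S \<oplus>\<^sub>o T) o\<^sub>L (S' \<oplus>\<^sub>o T')) (ket k) =
      blinfun_apply ((S o\<^sub>L S') \<oplus>\<^sub>o (T o\<^sub>L T')) (ket k)"
    by (cases k) (simp_all add: ket_Inl ket_Inr dsum_apply)
qed (simp_all add: assms cl_intros)

lemma adj_dsum:
  assumes "complex_linear S" "complex_linear T"
  shows "adj (S \<oplus>\<^sub>o T) = adj S \<oplus>\<^sub>o adj T"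
proof (rule adj_eqI_mcoef)
  fix i j show "mcoef i j (adj S \<oplus>\<^sub>o adj T) = cnj (mcoef j i (S \<oplus>\<^sub>o T))"
    using assms by (cases i; cases j) (simp_all add: mcoef_dsum mcoef_adj)
qed (simp_all add: assms cl_intros)


section \<open>Finite-dimensional operator algebras\<close>

definition op_subspace :: "'i op set \<Rightarrow> bool" where
  "op_subspace B \<longleftrightarrow> 0 \<in> B \<and> (\<forall>a\<in>B. complex_linear a) \<and> (\<forall>a\<in>B. \<forall>b\<in>B. a + b \<in> B) \<and>
     (\<forall>c. \<forall>a\<in>B. scale_op c a \<in> B)"

lemma op_subspaceD:
  assumes "op_subspace B"
  shows "0 \<in> B" "a \<in> B \<Longrightarrow> complex_linear a" "a \<in> B \<Longrightarrow> b \<in> B \<Longrightarrow> a + b \<in> B"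
    "a \<in> B \<Longrightarrow> scale_op c a \<in> B"
  using assms by (auto simp: op_subspace_def)

lemma op_subspace_sum: "op_subspace B \<Longrightarrow> (\<And>k. k \<in> F \<Longrightarrow> f k \<in> B) \<Longrightarrow> (\<Sum>k\<in>F. f k) \<in> B"
  by (induction F rule: infinite_finite_induct) (simp_all add: op_subspaceD)

lemma op_subspace_span: "op_subspace B \<Longrightarrow> Y \<subseteq> B \<Longrightarrow> span Y \<subseteq> B"
  by (rule span_minimal) (auto simp: subspace_def op_subspaceD scaleR_scale_op)

lemma cstar_algebra_subspace: "cstar_algebra A \<Longrightarrow> op_subspace A"
  by (auto simp: cstar_algebra_def op_subspace_def)

lemma cstar_algebraD:
  assumes "cstar_algebra A"
  shows "a \<in> A \<Longrightarrow> b \<in> A \<Longrightarrow> a o\<^sub>L b \<in> A" "a \<in> A \<Longrightarrow> adj a \<in> A" "closed A"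
    "a \<in> A \<Longrightarrow> complex_linear a"
  using assms by (auto simp: cstar_algebra_def)

lemma cstar_generated_minimal: "cstar_algebra A \<Longrightarrow> Y \<subseteq> A \<Longrightarrow> cstar_generated Y \<subseteq> A"
  by (auto simp: cstar_generated_def)

lemma is_unit_unique: "is_unit A e \<Longrightarrow> is_unit A e' \<Longrightarrow> e = e'"
  unfolding is_unit_def by metis

lemma unit_of_eq: "is_unit A e \<Longrightarrow> unit_of A = e"
  unfolding unit_of_def using is_unit_unique by (blast intro: the_equality)

lemma complex_linear_onD:
  assumes "complex_linear_on A f"
  shows "a \<in> A \<Longrightarrow> b \<in> A \<Longrightarrow> f (a + b) = f a + f b"
    "a \<in> A \<Longrightarrow> f (scale_op c a) = scale_op c (f a)"
  using assms by (auto simp: complex_linear_on_def)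

lemma complex_linear_on_zero: "complex_linear_on A f \<Longrightarrow> op_subspace A \<Longrightarrow> f 0 = 0"
  using complex_linear_onD(2)[of A f 0 0] by (simp add: scale_op_algebra op_subspaceD)

lemma complex_linear_on_sum:
  assumes "complex_linear_on A f" "op_subspace A" "\<And>k. k \<in> F \<Longrightarrow> g k \<in> A"
  shows "f (\<Sum>k\<in>F. g k) = (\<Sum>k\<in>F. f (g k))"
  using assms(3)
  by (induction F rule: infinite_finite_induct)
     (simp_all add: complex_linear_on_zero[OF assms(1,2)] complex_linear_onD[OF assms(1)]
       op_subspace_sum[OF assms(2)])

lemma complex_linear_on_comp:
  assumes "complex_linear_on A f" "f \<in> A \<rightarrow> B" "complex_linear_on B g"
  shows "complex_linear_on A (\<lambda>a. g (f a))"
  using assms by (auto simp: complex_linear_on_def Pi_iff)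

lemma complex_linear_on_id: "complex_linear_on A id"
  by (simp add: complex_linear_on_def)

text \<open>A finite family \<open>b\<close> of operators for which each coordinate can be read off as a single matrix
  entry, at position \<open>(u x, v x)\<close>.  Group algebras, their direct sums and their tensor products
  have such bases.  Coordinates are then continuous functionals on all operators, so that linear
  spans are closed, linear maps are continuous, and slicing at \<open>(u x, v x)\<close> gives coordinates in a
  tensor product with an arbitrary second factor.\<close>

locale matrix_basis =
  fixes X :: "'x set" and b :: "'x \<Rightarrow> 'i op" and u v :: "'x \<Rightarrow> 'i"
  assumes finite_X: "finite X"
    and complex_linear_basis [cl_intros]: "x \<in> X \<Longrightarrow> complex_linear (b x)"
    and dual: "x \<in> X \<Longrightarrow> y \<in> X \<Longrightarrow> mcoef (u x) (v x) (b y) = (if x = y then 1 else 0)"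
begin

abbreviation coord :: "'x \<Rightarrow> 'i op \<Rightarrow> complex" where
  "coord x T \<equiv> mcoef (u x) (v x) T"

definition extend :: "('x \<Rightarrow> 'k op) \<Rightarrow> 'i op \<Rightarrow> 'k op" where
  "extend f T = (\<Sum>x\<in>X. scale_op (coord x T) (f x))"

definition lspan :: "'i op set" where
  "lspan = {T. T = extend b T}"

lemma bounded_linear_extend: "bounded_linear (extend f)"
  unfolding extend_def
  by (intro bounded_linear_sum bounded_linear_compose[OF bounded_linear_scale_op_left]
      bounded_linear_mcoef)

lemma extend_linear: "extend f (S + T) = extend f S + extend f T"
    "extend f (scale_op c T) = scale_op c (extend f T)" "extend f 0 = 0"
  by (simp_all add: extend_def mcoef_algebra scale_op_algebra scale_op_sum sum.distrib)

lemma complex_linear_on_extend: "complex_linear_on A (extend f)"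
  by (simp add: complex_linear_on_def extend_linear)

lemma extend_basis [simp]: "x \<in> X \<Longrightarrow> extend f (b x) = f x"
proof -
  assume x: "x \<in> X"
  have "extend f (b x) = (\<Sum>y\<in>X. if y = x then f y else 0)"
    unfolding extend_def by (rule sum.cong) (use x in \<open>auto simp: dual scale_op_algebra\<close>)
  then show ?thesis using x finite_X by simp
qed

lemma basis_in_lspan [simp]: "x \<in> X \<Longrightarrow> b x \<in> lspan"
  by (simp add: lspan_def)

lemma lspan_expand: "T \<in> lspan \<Longrightarrow> T = (\<Sum>x\<in>X. scale_op (coord x T) (b x))"
  by (simp add: lspan_def extend_def)

lemma complex_linear_lspan [cl_intros]: "T \<in> lspan \<Longrightarrow> complex_linear T"
  by (subst lspan_expand) (auto intro!: cl_intros)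

lemma op_subspace_lspan: "op_subspace lspan"
  by (auto simp: op_subspace_def cl_intros lspan_def extend_linear)

lemma closed_lspan: "closed lspan"
  unfolding lspan_def
  by (rule closed_Collect_eq)
     (use bounded_linear.linear linear_continuous_on[OF bounded_linear_extend] in auto)

lemma lspan_minimal:
  assumes "op_subspace B" "\<And>x. x \<in> X \<Longrightarrow> b x \<in> B"
  shows "lspan \<subseteq> B"
proof
  fix T assume "T \<in> lspan"
  then show "T \<in> B" using assms by (subst lspan_expand) (auto intro!: op_subspace_sum op_subspaceD)
qed

lemma linear_on_lspan_eqI:
  assumes f: "complex_linear_on lspan f" and g: "complex_linear_on lspan g"
    and eq: "\<And>x. x \<in> X \<Longrightarrow> f (b x) = g (b x)" and T: "T \<in> lspan"
  shows "f T = g T"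
proof -
  have formula: "h T = (\<Sum>x\<in>X. scale_op (coord x T) (h (b x)))" if h: "complex_linear_on lspan h" for h
    using T
    by (subst lspan_expand[OF T], subst complex_linear_on_sum[OF h op_subspace_lspan])
       (auto simp: op_subspaceD[OF op_subspace_lspan] complex_linear_onD[OF h])
  show ?thesis by (simp only: formula[OF f] formula[OF g] eq cong: sum.cong)
qed

lemma lspan_compose:
  assumes "\<And>x y. x \<in> X \<Longrightarrow> y \<in> X \<Longrightarrow> b x o\<^sub>L b y \<in> lspan" "S \<in> lspan" "T \<in> lspan"
  shows "S o\<^sub>L T \<in> lspan"
  using op_subspace_lspan
  by (subst lspan_expand[OF assms(2)], subst lspan_expand[OF assms(3)])
     (auto intro!: op_subspace_sum op_subspaceD(4) assms(1) simp: compose_sum_left compose_sum_right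
       scale_op_compose_left scale_op_compose_right cl_intros)

lemma cstar_algebra_lspan:
  assumes "\<And>x y. x \<in> X \<Longrightarrow> y \<in> X \<Longrightarrow> b x o\<^sub>L b y \<in> lspan" "\<And>x. x \<in> X \<Longrightarrow> adj (b x) \<in> lspan"
  shows "cstar_algebra lspan"
proof -
  have "adj T \<in> lspan" if "T \<in> lspan" for T
    using op_subspace_lspan
    by (subst lspan_expand[OF that])
       (auto intro!: op_subspace_sum op_subspaceD(4) assms(2) simp: adj_sum adj_scale_op cl_intros)
  then show ?thesis
    using lspan_compose[OF assms(1)] op_subspaceD[OF op_subspace_lspan] closed_lspan
    by (auto simp: cstar_algebra_def)
qed

text \<open>Multiplicativity is bilinear and compatibility with adjoints is conjugate-linear in the
  arguments, so both can be checked on basis elements; continuity comes for free because the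
  coordinates are continuous.\<close>

lemma unital_star_hom_extend:
  assumes C: "op_subspace C" and f: "\<And>x. x \<in> X \<Longrightarrow> f x \<in> C"
    and mult: "\<And>x y. x \<in> X \<Longrightarrow> y \<in> X \<Longrightarrow> b x o\<^sub>L b y \<in> lspan"
      "\<And>x y. x \<in> X \<Longrightarrow> y \<in> X \<Longrightarrow> extend f (b x o\<^sub>L b y) = f x o\<^sub>L f y"
    and adj: "\<And>x. x \<in> X \<Longrightarrow> adj (b x) \<in> lspan"
      "\<And>x. x \<in> X \<Longrightarrow> extend f (adj (b x)) = adj (f x)"
    and unit: "is_unit lspan e" "extend f e = unit_of C"
  shows "unital_star_hom lspan C (restrict (extend f) lspan)"
proof -
  let ?h = "restrict (extend f) lspan"
  have cl: "complex_linear (f x)" if "x \<in> X" for x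
    using op_subspaceD(2)[OF C f[OF that]] .
  have cstar: "cstar_algebra lspan" by (rule cstar_algebra_lspan[OF mult(1) adj(1)])
  have "extend f T \<in> C" for T
    unfolding extend_def by (intro op_subspace_sum[OF C] op_subspaceD(4)[OF C] f)
  then have 1: "?h \<in> lspan \<rightarrow>\<^sub>E C" by simp
  have 2: "complex_linear_on lspan ?h"
    using op_subspaceD[OF op_subspace_lspan] by (simp add: complex_linear_on_def extend_linear)
  have 3: "continuous_on lspan ?h"
    using linear_continuous_on[OF bounded_linear_extend] by (simp cong: continuous_on_cong)
  have 4: "?h (S o\<^sub>L T) = ?h S o\<^sub>L ?h T" if S: "S \<in> lspan" and T: "T \<in> lspan" for S T
  proof -
    have "extend f (S o\<^sub>L T) =
        extend f (\<Sum>x\<in>X. \<Sum>y\<in>X. scale_op (coord x S * coord y T) (b x o\<^sub>L b y))"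
      by (subst lspan_expand[OF S], subst lspan_expand[OF T])
         (simp add: compose_sum_left compose_sum_right scale_op_compose_left
           scale_op_compose_right scale_op_algebra scale_op_sum cl_intros,
          rule arg_cong[where f = "extend f"], rule sum.swap)
    also have "\<dots> = (\<Sum>x\<in>X. \<Sum>y\<in>X. scale_op (coord x S * coord y T) (f x o\<^sub>L f y))"
      by (simp add: linear_sum[OF bounded_linear.linear[OF bounded_linear_extend]] extend_linear
          mult(2))
    also have "\<dots> = extend f S o\<^sub>L extend f T"
      by (simp add: extend_def compose_sum_left compose_sum_right scale_op_compose_left
           scale_op_compose_right scale_op_algebra scale_op_sum cl, rule sum.swap)
    finally show ?thesis using S T cstar_algebraD(1)[OF cstar] by simp
  qed
  have 5: "?h (adj T) = adj (?h T)" if T: "T \<in> lspan" for T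
  proof -
    have "extend f (adj T) = extend f (\<Sum>x\<in>X. scale_op (cnj (coord x T)) (adj (b x)))"
      by (subst lspan_expand[OF T]) (simp add: adj_sum adj_scale_op cl_intros)
    also have "\<dots> = (\<Sum>x\<in>X. scale_op (cnj (coord x T)) (adj (f x)))"
      by (simp add: linear_sum[OF bounded_linear.linear[OF bounded_linear_extend]] extend_linear
          adj(2))
    also have "\<dots> = adj (extend f T)"
      by (simp add: extend_def adj_sum adj_scale_op cl complex_linear_scale_op)
    finally show ?thesis using T cstar_algebraD(2)[OF cstar] by simp
  qed
  have 6: "?h (unit_of lspan) = unit_of C"
    using unit by (simp add: unit_of_eq is_unit_def)
  from 1 2 3 4 5 6 show ?thesis unfolding unital_star_hom_def by blast
qed

lemma is_unit_lspanI:
  assumes "e \<in> lspan" "\<And>x. x \<in> X \<Longrightarrow> e o\<^sub>L b x = b x" "\<And>x. x \<in> X \<Longrightarrow> b x o\<^sub>L e = b x"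
  shows "is_unit lspan e"
  unfolding is_unit_def
proof (intro conjI ballI assms(1))
  fix T assume T: "T \<in> lspan"
  have "(\<lambda>a. e o\<^sub>L a) T = id T" "(\<lambda>a. a o\<^sub>L e) T = id T"
    by (rule linear_on_lspan_eqI[OF _ complex_linear_on_id _ T];
        auto simp: complex_linear_on_def compose_add scale_op_compose_left scale_op_compose_right
          complex_linear_lspan[OF assms(1)] assms)+
  then show "e o\<^sub>L T = T" "T o\<^sub>L e = T" by simp_all
qed

context
  fixes B :: "'j op set"
  assumes B: "op_subspace B" and closed_B: "closed B"
begin

text \<open>With a finite-dimensional first factor the algebraic tensor product is already closed: its
  elements are exactly the operators that are reassembled from their slices, and this condition is
  closed because slicing is continuous.\<close>

lemma
  shows min_tensor_lspan_iff: "R \<in> lspan \<otimes>\<^sub>C B \<longleftrightarrow> R = (\<Sum>x\<in>X. b x \<otimes>\<^sub>o slice (u x) (v x) R) \<and>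
     (\<forall>x\<in>X. slice (u x) (v x) R \<in> B)"
    and op_subspace_min_tensor: "op_subspace (lspan \<otimes>\<^sub>C B)"
proof -
  let ?s = "\<lambda>x. slice (u x) (v x)"
  define M where "M = {R. R = (\<Sum>x\<in>X. amplified_product (b x) (?s x R))} \<inter>
    (\<Inter>x\<in>X. ?s x -` B)"
  have M_iff: "R \<in> M \<longleftrightarrow> R = (\<Sum>x\<in>X. b x \<otimes>\<^sub>o ?s x R) \<and> (\<forall>x\<in>X. ?s x R \<in> B)" for R
  proof -
    have "(\<Sum>x\<in>X. amplified_product (b x) (?s x R)) = (\<Sum>x\<in>X. b x \<otimes>\<^sub>o ?s x R)"
      if "\<forall>x\<in>X. ?s x R \<in> B"
      by (rule sum.cong) (use that op_subspaceD(2)[OF B] in \<open>auto simp: tensor_op_eq cl_intros\<close>)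
    then show ?thesis by (auto simp: M_def)
  qed
  have sM: "op_subspace M"
    unfolding op_subspace_def
  proof (intro conjI ballI allI)
    show "0 \<in> M"
      by (auto simp: M_iff linear_0[OF bounded_linear.linear[OF bounded_linear_slice]]
          op_subspaceD[OF B] cl_intros intro!: sum.neutral[symmetric])
  next
    fix R assume "R \<in> M"
    then have "R = (\<Sum>x\<in>X. b x \<otimes>\<^sub>o ?s x R)" "\<forall>x\<in>X. complex_linear (?s x R)"
      by (auto simp: M_iff op_subspaceD[OF B])
    then show "complex_linear R" by (metis (no_types, lifting) complex_linear_sum
          complex_linear_tensor_op complex_linear_basis)
  next
    fix R R' assume "R \<in> M" "R' \<in> M"
    then have R: "R = (\<Sum>x\<in>X. b x \<otimes>\<^sub>o ?s x R)" "\<forall>x\<in>X. ?s x R \<in> B"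
      and R': "R' = (\<Sum>x\<in>X. b x \<otimes>\<^sub>o ?s x R')" "\<forall>x\<in>X. ?s x R' \<in> B"
      by (auto simp: M_iff)
    have "R + R' = (\<Sum>x\<in>X. b x \<otimes>\<^sub>o ?s x R) + (\<Sum>x\<in>X. b x \<otimes>\<^sub>o ?s x R')"
      using R(1) R'(1) by simp
    also have "\<dots> = (\<Sum>x\<in>X. b x \<otimes>\<^sub>o ?s x (R + R'))"
      using R(2) R'(2) by (auto simp: slice_add tensor_add_right cl_intros op_subspaceD[OF B]
          simp flip: sum.distrib intro!: sum.cong)
    finally have "R + R' = (\<Sum>x\<in>X. b x \<otimes>\<^sub>o ?s x (R + R'))" .
    moreover have "\<forall>x\<in>X. ?s x (R + R') \<in> B"
      using R(2) R'(2) by (simp add: slice_add op_subspaceD[OF B])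
    ultimately show "R + R' \<in> M" unfolding M_iff by blast
  next
    fix c R assume "R \<in> M"
    then have R: "R = (\<Sum>x\<in>X. b x \<otimes>\<^sub>o ?s x R)" "\<forall>x\<in>X. ?s x R \<in> B"
      by (auto simp: M_iff)
    have "scale_op c R = scale_op c (\<Sum>x\<in>X. b x \<otimes>\<^sub>o ?s x R)"
      using R(1) by simp
    also have "\<dots> = (\<Sum>x\<in>X. b x \<otimes>\<^sub>o ?s x (scale_op c R))"
      using R(2) by (auto simp: slice_scale_op tensor_scale_right cl_intros op_subspaceD[OF B]
          scale_op_sum intro!: sum.cong)
    finally have "scale_op c R = (\<Sum>x\<in>X. b x \<otimes>\<^sub>o ?s x (scale_op c R))" .
    moreover have "\<forall>x\<in>X. ?s x (scale_op c R) \<in> B"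
      using R(2) by (simp add: slice_scale_op op_subspaceD[OF B])
    ultimately show "scale_op c R \<in> M" unfolding M_iff by blast
  qed
  have "closed M"
    unfolding M_def
  proof (intro closed_Int closed_INT ballI)
    show "closed {R. R = (\<Sum>x\<in>X. amplified_product (b x) (?s x R))}"
      by (rule closed_Collect_eq)
         (auto intro!: linear_continuous_on bounded_linear_sum
           bounded_linear_compose[OF bounded_linear_amplified_product bounded_linear_slice])
    show "closed (?s x -` B)" for x
      by (rule closed_vimage[OF closed_B])
         (simp add: linear_continuous_at[OF bounded_linear_slice] continuous_on_eq_continuous_at)
  qed
  moreover have "alg_tensor lspan B \<subseteq> M"
    unfolding alg_tensor_def
  proof (intro op_subspace_span[OF sM] subsetI)
    fix R assume "R \<in> {a \<otimes>\<^sub>o q |a q. a \<in> lspan \<and> q \<in> B}"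
    then obtain a q where R: "R = a \<otimes>\<^sub>o q" "a \<in> lspan" "q \<in> B" by blast
    have q: "complex_linear q" using R(3) op_subspaceD(2)[OF B] by blast
    have s: "?s x R = scale_op (coord x a) q" for x
      using R q by (simp add: slice_tensor cl_intros)
    have "R = (\<Sum>x\<in>X. scale_op (coord x a) (b x)) \<otimes>\<^sub>o q"
      using R(1) lspan_expand[OF R(2)] by simp
    also have "\<dots> = (\<Sum>x\<in>X. b x \<otimes>\<^sub>o ?s x R)"
      using q by (simp add: s tensor_sum_left tensor_scale_left tensor_scale_right cl_intros)
    finally have "R = (\<Sum>x\<in>X. b x \<otimes>\<^sub>o ?s x R)" .
    moreover have "\<forall>x\<in>X. ?s x R \<in> B" using R(3) by (simp add: s op_subspaceD[OF B])
    ultimately show "R \<in> M" unfolding M_iff by blast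
  qed
  ultimately have "lspan \<otimes>\<^sub>C B \<subseteq> M"
    unfolding min_tensor_def by (rule closure_minimal[rotated])
  moreover have "M \<subseteq> alg_tensor lspan B"
  proof
    fix R assume "R \<in> M"
    then have R: "R = (\<Sum>x\<in>X. b x \<otimes>\<^sub>o ?s x R)" "\<forall>x\<in>X. ?s x R \<in> B"
      by (auto simp: M_iff)
    have "(\<Sum>x\<in>X. b x \<otimes>\<^sub>o ?s x R) \<in> alg_tensor lspan B"
      unfolding alg_tensor_def
      by (intro span_sum span_base) (use R(2) basis_in_lspan in blast)
    then show "R \<in> alg_tensor lspan B" using R(1) by simp
  qed
  moreover have "alg_tensor lspan B \<subseteq> lspan \<otimes>\<^sub>C B"
    by (simp add: min_tensor_def closure_subset)
  ultimately have M_eq: "lspan \<otimes>\<^sub>C B = M" by blast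
  show "op_subspace (lspan \<otimes>\<^sub>C B)" unfolding M_eq by (rule sM)
  show "R \<in> lspan \<otimes>\<^sub>C B \<longleftrightarrow> R = (\<Sum>x\<in>X. b x \<otimes>\<^sub>o ?s x R) \<and> (\<forall>x\<in>X. ?s x R \<in> B)"
    unfolding M_eq by (rule M_iff)
qed

lemma tensor_in_min_tensor: "a \<in> lspan \<Longrightarrow> q \<in> B \<Longrightarrow> a \<otimes>\<^sub>o q \<in> lspan \<otimes>\<^sub>C B"
  unfolding min_tensor_def alg_tensor_def
  by (intro closure_subset[THEN subsetD] span_base) auto

lemma min_tensor_expand:
  assumes "R \<in> lspan \<otimes>\<^sub>C B"
  shows "R = (\<Sum>x\<in>X. b x \<otimes>\<^sub>o slice (u x) (v x) R)" "x \<in> X \<Longrightarrow> slice (u x) (v x) R \<in> B"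
  using assms min_tensor_lspan_iff[of R] by auto

lemma min_tensor_compose:
  assumes mult: "\<And>x y. x \<in> X \<Longrightarrow> y \<in> X \<Longrightarrow> b x o\<^sub>L b y \<in> lspan"
    and multB: "\<And>p q. p \<in> B \<Longrightarrow> q \<in> B \<Longrightarrow> p o\<^sub>L q \<in> B"
    and R: "R \<in> lspan \<otimes>\<^sub>C B" and R': "R' \<in> lspan \<otimes>\<^sub>C B"
  shows "R o\<^sub>L R' \<in> lspan \<otimes>\<^sub>C B"
proof -
  note q = min_tensor_expand(2)[OF R] and q' = min_tensor_expand(2)[OF R']
  note cl = op_subspaceD(2)[OF B q] op_subspaceD(2)[OF B q']
  have "(\<Sum>x\<in>X. b x \<otimes>\<^sub>o slice (u x) (v x) R) o\<^sub>L (\<Sum>y\<in>X. b y \<otimes>\<^sub>o slice (u y) (v y) R') \<in> lspan \<otimes>\<^sub>C B"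
    unfolding compose_sum_left compose_sum_right
    by (auto intro!: op_subspace_sum[OF op_subspace_min_tensor] tensor_in_min_tensor mult multB q q'
        simp: tensor_compose cl cl_intros)
  then show ?thesis by (simp flip: min_tensor_expand(1)[OF R] min_tensor_expand(1)[OF R'])
qed

lemma is_unit_min_tensor:
  assumes e: "is_unit lspan e" and e': "is_unit B e'"
  shows "is_unit (lspan \<otimes>\<^sub>C B) (e \<otimes>\<^sub>o e')"
  unfolding is_unit_def
proof (intro conjI ballI)
  have mem: "e \<in> lspan" "e' \<in> B" using e e' by (auto simp: is_unit_def)
  then show "e \<otimes>\<^sub>o e' \<in> lspan \<otimes>\<^sub>C B" by (rule tensor_in_min_tensor)
  fix R assume R: "R \<in> lspan \<otimes>\<^sub>C B"
  note q = min_tensor_expand(2)[OF R]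
  note cl = op_subspaceD(2)[OF B q] op_subspaceD(2)[OF B mem(2)] complex_linear_lspan[OF mem(1)]
  have "(e \<otimes>\<^sub>o e') o\<^sub>L (\<Sum>x\<in>X. b x \<otimes>\<^sub>o slice (u x) (v x) R) = (\<Sum>x\<in>X. b x \<otimes>\<^sub>o slice (u x) (v x) R)"
    "(\<Sum>x\<in>X. b x \<otimes>\<^sub>o slice (u x) (v x) R) o\<^sub>L (e \<otimes>\<^sub>o e') = (\<Sum>x\<in>X. b x \<otimes>\<^sub>o slice (u x) (v x) R)"
    unfolding compose_sum_left compose_sum_right
    using e e' q by (auto intro!: sum.cong simp: tensor_compose cl cl_intros is_unit_def)
  then show "(e \<otimes>\<^sub>o e') o\<^sub>L R = R" "R o\<^sub>L (e \<otimes>\<^sub>o e') = R"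
    by (simp_all flip: min_tensor_expand(1)[OF R])
qed

text \<open>The candidate is \<open>R \<mapsto> \<Sum>x. \<phi> (b x) (slice x R)\<close>.  Linearity in the first argument makes it
  correct on all elementary tensors, and every element is a finite sum of these, so that
  it is the only one.\<close>

lemma
  assumes lin1: "\<And>q. q \<in> B \<Longrightarrow> complex_linear_on lspan (\<lambda>a. \<phi> a q)"
    and lin2: "\<And>a. a \<in> lspan \<Longrightarrow> complex_linear_on B (\<phi> a)"
    and cont: "\<And>x. x \<in> X \<Longrightarrow> continuous_on B (\<phi> (b x))"
  shows complex_linear_on_tensor_lift: "complex_linear_on (lspan \<otimes>\<^sub>C B) (tensor_lift lspan B \<phi>)"
    and tensor_lift_tensor: "a \<in> lspan \<Longrightarrow> q \<in> B \<Longrightarrow> tensor_lift lspan B \<phi> (a \<otimes>\<^sub>o q) = \<phi> a q"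
proof -
  let ?s = "\<lambda>x. slice (u x) (v x)"
  let ?P = "\<lambda>h. h \<in> extensional (lspan \<otimes>\<^sub>C B) \<and> complex_linear_on (lspan \<otimes>\<^sub>C B) h \<and>
     continuous_on (lspan \<otimes>\<^sub>C B) h \<and> (\<forall>a\<in>lspan. \<forall>q\<in>B. h (a \<otimes>\<^sub>o q) = \<phi> a q)"
  define h where "h = restrict (\<lambda>R. \<Sum>x\<in>X. \<phi> (b x) (?s x R)) (lspan \<otimes>\<^sub>C B)"
  note sub = op_subspaceD[OF op_subspace_min_tensor]
  have "?P h"
  proof (intro conjI ballI)
    show "h \<in> extensional (lspan \<otimes>\<^sub>C B)" by (simp add: h_def)
    show "complex_linear_on (lspan \<otimes>\<^sub>C B) h"
      unfolding complex_linear_on_def h_def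
      by (auto simp: sub slice_add slice_scale_op complex_linear_onD[OF lin2] min_tensor_expand(2)
          sum.distrib scale_op_sum)
    have "continuous_on (lspan \<otimes>\<^sub>C B) (\<lambda>R. \<Sum>x\<in>X. \<phi> (b x) (?s x R))"
      by (intro continuous_on_sum continuous_on_compose2[OF cont]
          linear_continuous_on[OF bounded_linear_slice]) (auto simp: min_tensor_expand(2))
    then show "continuous_on (lspan \<otimes>\<^sub>C B) h" by (simp add: h_def cong: continuous_on_cong)
    fix a q assume a: "a \<in> lspan" and q: "q \<in> B"
    have "h (a \<otimes>\<^sub>o q) = (\<Sum>x\<in>X. \<phi> (scale_op (coord x a) (b x)) q)"
      using a q op_subspaceD(2)[OF B q]
      by (simp add: h_def tensor_in_min_tensor slice_tensor cl_intros complex_linear_onD[OF lin1]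
          complex_linear_onD[OF lin2])
    also have "\<dots> = \<phi> (\<Sum>x\<in>X. scale_op (coord x a) (b x)) q"
      by (rule complex_linear_on_sum[OF lin1[OF q] op_subspace_lspan, symmetric])
         (simp add: op_subspaceD[OF op_subspace_lspan])
    finally show "h (a \<otimes>\<^sub>o q) = \<phi> a q" by (simp flip: lspan_expand[OF a])
  qed
  moreover have "g = h" if g: "?P g" for g
  proof
    fix R
    show "g R = h R"
    proof (cases "R \<in> lspan \<otimes>\<^sub>C B")
      case True
      have formula: "k R = (\<Sum>x\<in>X. \<phi> (b x) (?s x R))" if k: "?P k" for k
      proof -
        have "k R = (\<Sum>x\<in>X. k (b x \<otimes>\<^sub>o ?s x R))"
          by (subst min_tensor_expand(1)[OF True],
              rule complex_linear_on_sum[OF _ op_subspace_min_tensor])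
             (use k min_tensor_expand(2)[OF True] in \<open>auto intro: tensor_in_min_tensor\<close>)
        then show ?thesis using k min_tensor_expand(2)[OF True] by simp
      qed
      show ?thesis by (simp only: formula[OF g] formula[OF \<open>?P h\<close>])
    next
      case False
      then show ?thesis using g \<open>?P h\<close> by (simp add: extensional_def)
    qed
  qed
  ultimately have "?P (tensor_lift lspan B \<phi>)"
    unfolding tensor_lift_def by (rule theI)
  then show "complex_linear_on (lspan \<otimes>\<^sub>C B) (tensor_lift lspan B \<phi>)"
    "a \<in> lspan \<Longrightarrow> q \<in> B \<Longrightarrow> tensor_lift lspan B \<phi> (a \<otimes>\<^sub>o q) = \<phi> a q" by auto
qed

lemma
  assumes f: "complex_linear_on lspan f" "\<And>a. a \<in> lspan \<Longrightarrow> complex_linear (f a)"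
    and g: "complex_linear_on B g" "\<And>q. q \<in> B \<Longrightarrow> complex_linear (g q)" "continuous_on B g"
  shows complex_linear_on_tensor_map: "complex_linear_on (lspan \<otimes>\<^sub>C B) (tensor_map lspan B f g)"
    and tensor_map_tensor: "a \<in> lspan \<Longrightarrow> q \<in> B \<Longrightarrow> tensor_map lspan B f g (a \<otimes>\<^sub>o q) = f a \<otimes>\<^sub>o g q"
proof -
  have 1: "complex_linear_on lspan (\<lambda>a. f a \<otimes>\<^sub>o g q)" if "q \<in> B" for q
    using that f(2) g(2)
    by (simp add: complex_linear_on_def complex_linear_onD[OF f(1)] tensor_add_left tensor_scale_left)
  have 2: "complex_linear_on B (\<lambda>q. f a \<otimes>\<^sub>o g q)" if "a \<in> lspan" for a
    using that f(2) g(2)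
    by (simp add: complex_linear_on_def complex_linear_onD[OF g(1)] tensor_add_right tensor_scale_right)
  have 3: "continuous_on B (\<lambda>q. f (b x) \<otimes>\<^sub>o g q)" if "x \<in> X" for x
  proof -
    have "continuous_on B (\<lambda>q. amplified_product (f (b x)) (g q))"
      by (rule bounded_linear.continuous_on[OF bounded_linear_amplified_product g(3)])
    then show ?thesis
      using that f(2) g(2) by (simp add: tensor_op_eq cong: continuous_on_cong)
  qed
  show "complex_linear_on (lspan \<otimes>\<^sub>C B) (tensor_map lspan B f g)"
    "a \<in> lspan \<Longrightarrow> q \<in> B \<Longrightarrow> tensor_map lspan B f g (a \<otimes>\<^sub>o q) = f a \<otimes>\<^sub>o g q"
    unfolding tensor_map_def
    by (rule complex_linear_on_tensor_lift tensor_lift_tensor; use 1 2 3 in simp)+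
qed

lemma tensor_map_add_tensor:
  assumes "complex_linear_on lspan f" "\<And>a. a \<in> lspan \<Longrightarrow> complex_linear (f a)"
    and "complex_linear_on B g" "\<And>q. q \<in> B \<Longrightarrow> complex_linear (g q)" "continuous_on B g"
    and "a \<in> lspan" "a' \<in> lspan" "q \<in> B" "q' \<in> B"
  shows "tensor_map lspan B f g (a \<otimes>\<^sub>o q + a' \<otimes>\<^sub>o q') = f a \<otimes>\<^sub>o g q + f a' \<otimes>\<^sub>o g q'"
  using assms
  by (simp add: complex_linear_onD(1)[OF complex_linear_on_tensor_map]
      tensor_in_min_tensor tensor_map_tensor)

text \<open>The form in which the density conditions for quantum groups and their actions are verified: it
  is enough to reach the elementary tensors \<open>b x \<otimes> q\<close>.\<close>

lemma closure_span_eq_min_tensor: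
  assumes "Y \<subseteq> lspan \<otimes>\<^sub>C B" "\<And>x q. x \<in> X \<Longrightarrow> q \<in> B \<Longrightarrow> b x \<otimes>\<^sub>o q \<in> span Y"
  shows "closure (span Y) = lspan \<otimes>\<^sub>C B"
proof
  have "closed (lspan \<otimes>\<^sub>C B)" by (simp add: min_tensor_def)
  then show "closure (span Y) \<subseteq> lspan \<otimes>\<^sub>C B"
    by (rule closure_minimal[OF op_subspace_span[OF op_subspace_min_tensor assms(1)]])
  have "R \<in> span Y" if R: "R \<in> lspan \<otimes>\<^sub>C B" for R
    by (subst min_tensor_expand(1)[OF R]) (intro span_sum assms(2) min_tensor_expand(2)[OF R])
  then show "lspan \<otimes>\<^sub>C B \<subseteq> closure (span Y)" using closure_subset by blast
qed

end

end


section \<open>The left regular representation\<close>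

context group
begin

lemma inj_on_left_mult: "g \<in> carrier G \<Longrightarrow> inj_on (\<lambda>h. g \<otimes> h) (carrier G)"
  by (auto simp: inj_on_def)

lemma left_reg_eq: "g \<in> carrier G \<Longrightarrow> left_reg G g = partial_perm_op (carrier G) (\<lambda>h. g \<otimes> h)"
  unfolding left_reg_def
  by (rule the_op_eq) (simp_all add: cl_intros partial_perm_op_ket inj_on_left_mult)

lemma left_reg_ket: "g \<in> carrier G \<Longrightarrow>
    blinfun_apply (left_reg G g) (ket h) = (if h \<in> carrier G then ket (g \<otimes> h) else 0)"
  by (simp add: left_reg_eq partial_perm_op_ket inj_on_left_mult)

lemma complex_linear_left_reg [simp]: "g \<in> carrier G \<Longrightarrow> complex_linear (left_reg G g)"
  by (simp add: left_reg_eq cl_intros inj_on_left_mult)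

lemma mcoef_left_reg: "g \<in> carrier G \<Longrightarrow>
    mcoef k h (left_reg G g) = (if h \<in> carrier G \<and> k = g \<otimes> h then 1 else 0)"
  by (simp add: mcoef_def left_reg_ket ket.rep_eq zero_ell2.rep_eq)

lemma left_reg_compose [simp]: "g \<in> carrier G \<Longrightarrow> h \<in> carrier G \<Longrightarrow>
    left_reg G g o\<^sub>L left_reg G h = left_reg G (g \<otimes> h)"
  by (rule op_eqI_ket) (simp_all add: cl_intros left_reg_ket m_assoc)

lemma adj_left_reg [simp]: "g \<in> carrier G \<Longrightarrow> adj (left_reg G g) = left_reg G (inv g)"
  by (rule adj_eqI_mcoef) (auto simp: mcoef_left_reg m_assoc[symmetric])

end


section \<open>The double of a finite group along an involutive automorphism\<close>

text \<open>For a finite group \<open>G\<close> with an automorphism \<open>\<theta>\<close> that is its own inverse, the algebra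
  \<open>C*(G) \<oplus> C*(G)\<close> becomes a compact quantum group that acts on \<open>C*(G)\<close>.  Writing \<open>e j g\<close> for
  \<open>\<lambda>\<^sub>g\<close> in the summand with index \<open>j\<close> and adding indices modulo two, the structure maps are
  \<open>\<Delta> (e i g) = \<Sum>j. e j g \<otimes> e (i - j) (\<theta>\<^sup>j g)\<close> and \<open>\<alpha> (\<lambda>\<^sub>g) = \<Sum>j. \<lambda>\<^sub>h \<otimes> e j g\<close> with
  \<open>h = \<theta>\<^sup>j g\<close>.  Since \<open>\<theta>\<close> is multiplicative these are *-homomorphisms; since \<open>\<theta>\<^sup>j\<close> depends on \<open>j\<close> modulo two
  only, \<open>\<theta>\<close> can be iterated along sums of indices, which gives coassociativity and the coaction
  identity.\<close>

locale involutive_group = group G for G (structure) +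
  fixes \<theta> :: "'a \<Rightarrow> 'a"
  assumes finite_carrier: "finite (carrier G)"
    and \<theta>_hom: "\<theta> \<in> hom G G"
    and \<theta>_involutive: "g \<in> carrier G \<Longrightarrow> \<theta> (\<theta> g) = g"
begin

lemma \<theta>_closed [simp]: "g \<in> carrier G \<Longrightarrow> \<theta> g \<in> carrier G"
  using \<theta>_hom by (rule hom_in_carrier)

lemma \<theta>_mult [simp]: "g \<in> carrier G \<Longrightarrow> h \<in> carrier G \<Longrightarrow> \<theta> (g \<otimes> h) = \<theta> g \<otimes> \<theta> h"
  using \<theta>_hom by (rule hom_mult)

lemma \<theta>_one [simp]: "\<theta> \<one> = \<one>"
  using \<theta>_hom by (rule hom_one) (rule is_group)+

lemma \<theta>_inv [simp]: "g \<in> carrier G \<Longrightarrow> \<theta> (inv g) = inv (\<theta> g)"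
  by (rule inv_equality[symmetric]) (simp_all flip: \<theta>_mult)

lemma \<theta>_eq_one_iff: "g \<in> carrier G \<Longrightarrow> \<theta> g = \<one> \<longleftrightarrow> g = \<one>"
  by (metis \<theta>_involutive \<theta>_one)

declare \<theta>_involutive [simp]

abbreviation lam :: "'a \<Rightarrow> 'a op" where "lam \<equiv> left_reg G"

sublocale CS: matrix_basis "carrier G" lam "\<lambda>g. g" "\<lambda>_. \<one>"
  by unfold_locales (simp_all add: finite_carrier mcoef_left_reg)

lemma cstar_algebra_CS: "cstar_algebra CS.lspan"
  by (rule CS.cstar_algebra_lspan) simp_all

lemma reduced_group_cstar_eq: "reduced_group_cstar G = CS.lspan"
proof
  show "reduced_group_cstar G \<subseteq> CS.lspan"
    unfolding reduced_group_cstar_def by (rule cstar_generated_minimal[OF cstar_algebra_CS]) auto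
  show "CS.lspan \<subseteq> reduced_group_cstar G"
    unfolding reduced_group_cstar_def cstar_generated_def
    by (intro Inter_greatest CS.lspan_minimal) (auto intro: cstar_algebra_subspace)
qed

lemma is_unit_CS: "is_unit CS.lspan (lam \<one>)"
  by (rule CS.is_unit_lspanI) simp_all

text \<open>Summand indices are Booleans: \<open>False\<close> is the first summand and the zero of the index group,
  addition is exclusive disjunction.\<close>

definition e :: "bool \<Rightarrow> 'a \<Rightarrow> ('a + 'a) op" where
  "e j g = (if j then 0 \<oplus>\<^sub>o lam g else lam g \<oplus>\<^sub>o 0)"

lemma complex_linear_e [simp]: "g \<in> carrier G \<Longrightarrow> complex_linear (e j g)"
  by (simp add: e_def cl_intros)

lemma e_compose [simp]: "g \<in> carrier G \<Longrightarrow> h \<in> carrier G \<Longrightarrow>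
    e i g o\<^sub>L e j h = (if i = j then e i (g \<otimes> h) else 0)"
  by (simp add: e_def dsum_compose cl_intros dsum_zero)

lemma adj_e [simp]: "g \<in> carrier G \<Longrightarrow> adj (e j g) = e j (inv g)"
  by (simp add: e_def adj_dsum cl_intros)

sublocale Q: matrix_basis "UNIV \<times> carrier G" "\<lambda>(j, g). e j g"
  "\<lambda>(j, g). if j then Inr g else Inl g" "\<lambda>(j, g). if j then Inr \<one> else Inl \<one>"
proof
  show "finite ((UNIV :: bool set) \<times> carrier G)" by (simp add: finite_carrier)
next
  fix x y :: "bool \<times> 'a" assume "x \<in> UNIV \<times> carrier G" "y \<in> UNIV \<times> carrier G"
  then obtain i g j h where xy: "x = (i, g)" "y = (j, h)" "g \<in> carrier G" "h \<in> carrier G" by auto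
  show "mcoef (case x of (j, g) \<Rightarrow> if j then Inr g else Inl g)
      (case x of (j, g) \<Rightarrow> if j then Inr \<one> else Inl \<one>)
      (case y of (j, g) \<Rightarrow> e j g) = (if x = y then 1 else 0)"
    unfolding xy(1,2) using xy(3,4)
    by (cases i; cases j) (simp_all add: e_def mcoef_dsum mcoef_left_reg mcoef_algebra)
qed auto

lemma Q_extend_e [simp]: "g \<in> carrier G \<Longrightarrow> Q.extend f (e j g) = f (j, g)"
  using Q.extend_basis[of "(j, g)" f] by simp

lemma e_in_Q [simp]: "g \<in> carrier G \<Longrightarrow> e j g \<in> Q.lspan"
  using Q.basis_in_lspan[of "(j, g)"] by simp

lemma zero_in_Q [simp]: "0 \<in> Q.lspan"
  by (rule op_subspaceD(1)[OF Q.op_subspace_lspan])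

lemma cstar_algebra_Q: "cstar_algebra Q.lspan"
  by (rule Q.cstar_algebra_lspan) auto

text \<open>The direct sum is spanned by the two copies of the group because each inclusion
  \<open>T \<mapsto> T \<oplus> 0\<close> and \<open>T \<mapsto> 0 \<oplus> T\<close> is linear.\<close>

lemma dsum_eq_Q: "reduced_group_cstar G \<oplus>\<^sub>C reduced_group_cstar G = Q.lspan"
proof
  note sub = op_subspaceD[OF CS.op_subspace_lspan]
  have "op_subspace (CS.lspan \<oplus>\<^sub>C CS.lspan)"
    unfolding op_subspace_def
  proof (intro conjI ballI allI)
    show "0 \<in> CS.lspan \<oplus>\<^sub>C CS.lspan"
      unfolding cstar_dsum_def using dsum_zero sub(1) by force
  next
    fix a b assume "a \<in> CS.lspan \<oplus>\<^sub>C CS.lspan" "b \<in> CS.lspan \<oplus>\<^sub>C CS.lspan"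
    then obtain p q p' q' where "a = p \<oplus>\<^sub>o q" "b = p' \<oplus>\<^sub>o q'"
      "p \<in> CS.lspan" "q \<in> CS.lspan" "p' \<in> CS.lspan" "q' \<in> CS.lspan"
      unfolding cstar_dsum_def by blast
    moreover from this have "a + b = (p + p') \<oplus>\<^sub>o (q + q')" by (simp add: dsum_add cl_intros)
    ultimately show "a + b \<in> CS.lspan \<oplus>\<^sub>C CS.lspan"
      unfolding cstar_dsum_def using sub(3) by blast
  next
    fix c a assume "a \<in> CS.lspan \<oplus>\<^sub>C CS.lspan"
    then obtain p q where "a = p \<oplus>\<^sub>o q" "p \<in> CS.lspan" "q \<in> CS.lspan"
      unfolding cstar_dsum_def by blast
    moreover from this have "scale_op c a = scale_op c p \<oplus>\<^sub>o scale_op c q"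
      by (simp add: dsum_scale cl_intros)
    ultimately show "scale_op c a \<in> CS.lspan \<oplus>\<^sub>C CS.lspan"
      unfolding cstar_dsum_def using sub(4) by blast
  qed (auto simp: cstar_dsum_def cl_intros)
  moreover have "lam g \<oplus>\<^sub>o 0 \<in> CS.lspan \<oplus>\<^sub>C CS.lspan" "0 \<oplus>\<^sub>o lam g \<in> CS.lspan \<oplus>\<^sub>C CS.lspan"
    if "g \<in> carrier G" for g
    unfolding cstar_dsum_def using sub(1) CS.basis_in_lspan[OF that] by blast+
  ultimately show "Q.lspan \<subseteq> reduced_group_cstar G \<oplus>\<^sub>C reduced_group_cstar G"
    unfolding reduced_group_cstar_eq by (intro Q.lspan_minimal) (auto simp: e_def)
next
  have half: "T \<oplus>\<^sub>o 0 \<in> Q.lspan" "0 \<oplus>\<^sub>o T \<in> Q.lspan" if "T \<in> CS.lspan" for T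
  proof -
    have lin: "complex_linear_on CS.lspan (\<lambda>T. T \<oplus>\<^sub>o 0)" "complex_linear_on CS.lspan (\<lambda>T. 0 \<oplus>\<^sub>o T)"
      by (auto simp: complex_linear_on_def dsum_add dsum_scale cl_intros scale_op_algebra)
    have "T \<oplus>\<^sub>o 0 = CS.extend (e False) T" "0 \<oplus>\<^sub>o T = CS.extend (e True) T"
      by (rule CS.linear_on_lspan_eqI[OF lin(1) CS.complex_linear_on_extend _ that]
            CS.linear_on_lspan_eqI[OF lin(2) CS.complex_linear_on_extend _ that]; simp add: e_def)+
    moreover have "CS.extend (e j) T \<in> Q.lspan" for j
      unfolding CS.extend_def
      by (intro op_subspace_sum[OF Q.op_subspace_lspan] op_subspaceD(4)[OF Q.op_subspace_lspan]) simp
    ultimately show "T \<oplus>\<^sub>o 0 \<in> Q.lspan" "0 \<oplus>\<^sub>o T \<in> Q.lspan" by simp_all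
  qed
  show "reduced_group_cstar G \<oplus>\<^sub>C reduced_group_cstar G \<subseteq> Q.lspan"
  proof
    fix R assume "R \<in> reduced_group_cstar G \<oplus>\<^sub>C reduced_group_cstar G"
    then obtain S T where R: "R = S \<oplus>\<^sub>o T" "S \<in> CS.lspan" "T \<in> CS.lspan"
      unfolding cstar_dsum_def reduced_group_cstar_eq by blast
    then have "R = (S \<oplus>\<^sub>o 0) + (0 \<oplus>\<^sub>o T)" by (simp add: dsum_add cl_intros)
    then show "R \<in> Q.lspan"
      using half R op_subspaceD(3)[OF Q.op_subspace_lspan] by simp
  qed
qed

lemma is_unit_Q: "is_unit Q.lspan (e False \<one> + e True \<one>)"
  by (rule Q.is_unit_lspanI)
     (auto simp: compose_add intro!: op_subspaceD(3)[OF Q.op_subspace_lspan])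

lemmas unit_of_Q = unit_of_eq[OF is_unit_Q]

lemmas Q_closed_subspace = Q.op_subspace_lspan Q.closed_lspan

lemma unit_of_QQ: "unit_of (Q.lspan \<otimes>\<^sub>C Q.lspan) =
    (e False \<one> + e True \<one>) \<otimes>\<^sub>o (e False \<one> + e True \<one>)"
  by (rule unit_of_eq[OF Q.is_unit_min_tensor[OF Q_closed_subspace is_unit_Q is_unit_Q]])

lemma unit_of_CSQ: "unit_of (CS.lspan \<otimes>\<^sub>C Q.lspan) = lam \<one> \<otimes>\<^sub>o (e False \<one> + e True \<one>)"
  by (rule unit_of_eq[OF CS.is_unit_min_tensor[OF Q_closed_subspace is_unit_CS is_unit_Q]])

definition \<Delta> :: "('a + 'a) op \<Rightarrow> (('a + 'a) \<times> ('a + 'a)) op" where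
  "\<Delta> = restrict (Q.extend (\<lambda>(i, g). e False g \<otimes>\<^sub>o e i g + e True g \<otimes>\<^sub>o e (\<not> i) (\<theta> g))) Q.lspan"

definition \<alpha> :: "'a op \<Rightarrow> ('a \<times> ('a + 'a)) op" where
  "\<alpha> = restrict (CS.extend (\<lambda>g. lam g \<otimes>\<^sub>o e False g + lam (\<theta> g) \<otimes>\<^sub>o e True g)) CS.lspan"

lemma \<Delta>_e: "g \<in> carrier G \<Longrightarrow> \<Delta> (e i g) = e False g \<otimes>\<^sub>o e i g + e True g \<otimes>\<^sub>o e (\<not> i) (\<theta> g)"
  by (simp add: \<Delta>_def)

lemma \<alpha>_lam: "g \<in> carrier G \<Longrightarrow> \<alpha> (lam g) = lam g \<otimes>\<^sub>o e False g + lam (\<theta> g) \<otimes>\<^sub>o e True g"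
  by (simp add: \<alpha>_def)

lemma unital_star_hom_\<Delta>: "unital_star_hom Q.lspan (Q.lspan \<otimes>\<^sub>C Q.lspan) \<Delta>"
  unfolding \<Delta>_def
proof (rule Q.unital_star_hom_extend[OF Q.op_subspace_min_tensor[OF Q_closed_subspace]])
  show "is_unit Q.lspan (e False \<one> + e True \<one>)" by (rule is_unit_Q)
qed (auto simp: compose_add tensor_compose adj_add adj_tensor cl_intros tensor_add_left
    tensor_add_right unit_of_QQ Q.extend_linear algebra_simps
    intro!: op_subspaceD(3)[OF Q.op_subspace_min_tensor[OF Q_closed_subspace]] Q.tensor_in_min_tensor[OF Q_closed_subspace])

lemma unital_star_hom_\<alpha>: "unital_star_hom CS.lspan (CS.lspan \<otimes>\<^sub>C Q.lspan) \<alpha>"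
  unfolding \<alpha>_def
proof (rule CS.unital_star_hom_extend[OF CS.op_subspace_min_tensor[OF Q_closed_subspace]])
  show "is_unit CS.lspan (lam \<one>)" by (rule is_unit_CS)
qed (auto simp: compose_add tensor_compose adj_add adj_tensor cl_intros tensor_add_left
    tensor_add_right unit_of_CSQ CS.extend_linear algebra_simps
    intro!: op_subspaceD(3)[OF CS.op_subspace_min_tensor[OF Q_closed_subspace]] CS.tensor_in_min_tensor[OF Q_closed_subspace])

lemma
  shows \<Delta>_linear: "complex_linear_on Q.lspan \<Delta>"
    and \<Delta>_mem: "q \<in> Q.lspan \<Longrightarrow> \<Delta> q \<in> Q.lspan \<otimes>\<^sub>C Q.lspan"
    and \<Delta>_cont: "continuous_on Q.lspan \<Delta>"
  using unital_star_hom_\<Delta> by (auto simp: unital_star_hom_def)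

lemma
  shows \<alpha>_linear: "complex_linear_on CS.lspan \<alpha>"
    and \<alpha>_mem: "a \<in> CS.lspan \<Longrightarrow> \<alpha> a \<in> CS.lspan \<otimes>\<^sub>C Q.lspan"
  using unital_star_hom_\<alpha> by (auto simp: unital_star_hom_def)

lemmas complex_linear_QQ = op_subspaceD(2)[OF Q.op_subspace_min_tensor[OF Q_closed_subspace]]
lemmas complex_linear_CSQ = op_subspaceD(2)[OF CS.op_subspace_min_tensor[OF Q_closed_subspace]]

lemma \<Delta>_coassociative:
  assumes a: "a \<in> Q.lspan"
  shows "reassoc (tensor_map Q.lspan Q.lspan \<Delta> id (\<Delta> a)) = tensor_map Q.lspan Q.lspan id \<Delta> (\<Delta> a)"
proof (rule Q.linear_on_lspan_eqI[OF _ _ _ a])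
  have cl\<Delta>: "complex_linear (\<Delta> q)" if "q \<in> Q.lspan" for q
    using that by (intro complex_linear_QQ \<Delta>_mem)
  have 1: "complex_linear_on (Q.lspan \<otimes>\<^sub>C Q.lspan) (tensor_map Q.lspan Q.lspan \<Delta> id)"
    by (rule Q.complex_linear_on_tensor_map[OF Q_closed_subspace])
       (simp_all add: \<Delta>_linear cl\<Delta> complex_linear_on_id Q.complex_linear_lspan)
  have 2: "complex_linear_on (Q.lspan \<otimes>\<^sub>C Q.lspan) (tensor_map Q.lspan Q.lspan id \<Delta>)"
    by (rule Q.complex_linear_on_tensor_map[OF Q_closed_subspace])
       (simp_all add: \<Delta>_linear \<Delta>_cont cl\<Delta> complex_linear_on_id Q.complex_linear_lspan)
  have \<Delta>: "\<Delta> \<in> Q.lspan \<rightarrow> Q.lspan \<otimes>\<^sub>C Q.lspan" using \<Delta>_mem by auto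
  show "complex_linear_on Q.lspan (\<lambda>a. tensor_map Q.lspan Q.lspan id \<Delta> (\<Delta> a))"
    by (rule complex_linear_on_comp[OF \<Delta>_linear \<Delta> 2])
  show "complex_linear_on Q.lspan (\<lambda>a. reassoc (tensor_map Q.lspan Q.lspan \<Delta> id (\<Delta> a)))"
    using complex_linear_on_comp[OF \<Delta>_linear \<Delta> 1]
    by (simp add: complex_linear_on_def reassoc_add reassoc_scale_op)
  fix x assume "x \<in> (UNIV :: bool set) \<times> carrier G"
  then obtain i g where x: "x = (i, g)" and g: "g \<in> carrier G" by auto
  have "reassoc (tensor_map Q.lspan Q.lspan \<Delta> id (\<Delta> (e i g))) =
      tensor_map Q.lspan Q.lspan id \<Delta> (\<Delta> (e i g))"
    using g
    by (simp add: \<Delta>_e Q.tensor_map_add_tensor[OF Q_closed_subspace] \<Delta>_linear \<Delta>_cont cl\<Delta> complex_linear_on_id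
        Q.complex_linear_lspan tensor_add_left tensor_add_right cl_intros reassoc_add reassoc_tensor
        algebra_simps)
  then show "reassoc (tensor_map Q.lspan Q.lspan \<Delta> id (\<Delta> (case x of (j, g) \<Rightarrow> e j g))) =
      tensor_map Q.lspan Q.lspan id \<Delta> (\<Delta> (case x of (j, g) \<Rightarrow> e j g))"
    by (simp add: x)
qed

lemma compose_in_QQ: "R \<in> Q.lspan \<otimes>\<^sub>C Q.lspan \<Longrightarrow> R' \<in> Q.lspan \<otimes>\<^sub>C Q.lspan \<Longrightarrow>
    R o\<^sub>L R' \<in> Q.lspan \<otimes>\<^sub>C Q.lspan"
  by (rule Q.min_tensor_compose[OF Q_closed_subspace])
     (auto intro: cstar_algebraD(1)[OF cstar_algebra_Q])

lemma compose_in_CSQ: "R \<in> CS.lspan \<otimes>\<^sub>C Q.lspan \<Longrightarrow> R' \<in> CS.lspan \<otimes>\<^sub>C Q.lspan \<Longrightarrow>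
    R o\<^sub>L R' \<in> CS.lspan \<otimes>\<^sub>C Q.lspan"
  by (rule CS.min_tensor_compose[OF Q_closed_subspace])
     (auto intro: cstar_algebraD(1)[OF cstar_algebra_Q])

lemma unit_in_Q: "unit_of Q.lspan \<in> Q.lspan"
  using is_unit_Q by (auto simp: unit_of_Q is_unit_def)

lemma unit_compose_Q:
  assumes "q \<in> Q.lspan" shows "(e False \<one> o\<^sub>L q) + (e True \<one> o\<^sub>L q) = q"
  using is_unit_Q assms by (simp add: is_unit_def flip: compose_add)

lemma compose_assoc: "(R o\<^sub>L S) o\<^sub>L T = R o\<^sub>L (S o\<^sub>L T)"
  by (rule blinfun_eqI) simp

lemma e_compose_compose: "g \<in> carrier G \<Longrightarrow> h \<in> carrier G \<Longrightarrow>
    e i g o\<^sub>L (e j h o\<^sub>L T) = (if i = j then e i (g \<otimes> h) o\<^sub>L T else 0)"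
  by (simp flip: compose_assoc)

lemma compose_Q: "p \<in> Q.lspan \<Longrightarrow> q \<in> Q.lspan \<Longrightarrow> p o\<^sub>L q \<in> Q.lspan"
  by (rule cstar_algebraD(1)[OF cstar_algebra_Q])

lemma \<Delta>_cancellation:
  "closure (span {\<Delta> a o\<^sub>L (unit_of Q.lspan \<otimes>\<^sub>o b) |a b. a \<in> Q.lspan \<and> b \<in> Q.lspan}) = Q.lspan \<otimes>\<^sub>C Q.lspan"
  (is "closure (span ?Y) = _")
proof (rule Q.closure_span_eq_min_tensor[OF Q_closed_subspace])
  show "?Y \<subseteq> Q.lspan \<otimes>\<^sub>C Q.lspan"
    by (auto intro!: compose_in_QQ \<Delta>_mem Q.tensor_in_min_tensor[OF Q_closed_subspace] unit_in_Q)
  fix x q assume "x \<in> (UNIV :: bool set) \<times> carrier G" and q: "q \<in> Q.lspan"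
  then obtain j g where x: "x = (j, g)" and g: "g \<in> carrier G" by auto
  have clq: "complex_linear q" "complex_linear (e i h o\<^sub>L q)" if "h \<in> carrier G" for i h
    using q that by (auto simp: cl_intros Q.complex_linear_lspan)
  have *: "\<Delta> (e i g) o\<^sub>L (unit_of Q.lspan \<otimes>\<^sub>o (e k (inv (if j then \<theta> g else g)) o\<^sub>L q)) \<in> span ?Y" for i k
    by (rule span_base) (use g q in \<open>auto intro!: exI conjI compose_Q\<close>)
  \<comment> \<open>Multiplying by \<open>e k (inv (\<theta>\<^sup>j g))\<close> in the second leg isolates the summand of \<open>\<Delta>\<close>
      whose first leg has index \<open>j\<close>.\<close>
  have "e j g \<otimes>\<^sub>o q =
      (\<Delta> (e j g) o\<^sub>L (unit_of Q.lspan \<otimes>\<^sub>o (e False (inv (if j then \<theta> g else g)) o\<^sub>L q))) +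
      (\<Delta> (e (\<not> j) g) o\<^sub>L (unit_of Q.lspan \<otimes>\<^sub>o (e True (inv (if j then \<theta> g else g)) o\<^sub>L q)))"
    using g q clq
    by (cases j) (simp_all add: \<Delta>_e unit_of_Q compose_add tensor_compose cl_intros e_compose_compose
      flip: tensor_add_right add: unit_compose_Q)
  also have "\<dots> \<in> span ?Y" by (intro span_add *)
  finally show "(case x of (j, g) \<Rightarrow> e j g) \<otimes>\<^sub>o q \<in> span ?Y" by (simp add: x)
qed

lemma \<Delta>_cancellation_right:
  "closure (span {\<Delta> a o\<^sub>L (b \<otimes>\<^sub>o unit_of Q.lspan) |a b. a \<in> Q.lspan \<and> b \<in> Q.lspan}) = Q.lspan \<otimes>\<^sub>C Q.lspan"
  (is "closure (span ?Y) = _")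
proof (rule Q.closure_span_eq_min_tensor[OF Q_closed_subspace])
  show "?Y \<subseteq> Q.lspan \<otimes>\<^sub>C Q.lspan"
    by (auto intro!: compose_in_QQ \<Delta>_mem Q.tensor_in_min_tensor[OF Q_closed_subspace] unit_in_Q)
  fix x q assume "x \<in> (UNIV :: bool set) \<times> carrier G" and q: "q \<in> Q.lspan"
  then obtain j g where x: "x = (j, g)" and g: "g \<in> carrier G" by auto
  have *: "e j g \<otimes>\<^sub>o scale_op c (e k h) \<in> span ?Y" if h: "h \<in> carrier G" for c k h
  proof -
    \<comment> \<open>The summand of \<open>\<Delta>\<close> with first index \<open>j\<close> applies \<open>\<theta>\<^sup>j\<close> in the second leg, which \<open>h'\<close> undoes.\<close>
    define h' where "h' = (if j then \<theta> h else h)"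
    have h': "h' \<in> carrier G" using h by (simp add: h'_def)
    have "e j g \<otimes>\<^sub>o scale_op c (e k h) =
        \<Delta> (scale_op c (e (j \<noteq> k) h')) o\<^sub>L (e j (inv h' \<otimes> g) \<otimes>\<^sub>o unit_of Q.lspan)"
      using g h
      by (cases j) (simp_all add: complex_linear_onD[OF \<Delta>_linear] h'_def \<Delta>_e unit_of_Q compose_add
          tensor_compose cl_intros tensor_scale_right scale_op_compose_left inv_solve_left
          m_assoc[symmetric])
    also have "\<dots> \<in> span ?Y"
      using g h' op_subspaceD(4)[OF Q.op_subspace_lspan]
      by (intro span_base) (auto intro!: exI conjI)
    finally show ?thesis .
  qed
  have "e j g \<otimes>\<^sub>o q = (\<Sum>y\<in>UNIV \<times> carrier G. e j g \<otimes>\<^sub>o scale_op (Q.coord y q) (case y of (k, h) \<Rightarrow> e k h))"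
    using g by (subst Q.lspan_expand[OF q]) (auto simp: tensor_sum_right cl_intros)
  also have "\<dots> \<in> span ?Y" by (rule span_sum) (auto intro: *)
  finally show "(case x of (j, g) \<Rightarrow> e j g) \<otimes>\<^sub>o q \<in> span ?Y" by (simp add: x)
qed

lemma compact_quantum_group_\<Delta>: "compact_quantum_group Q.lspan \<Delta>"
  unfolding compact_quantum_group_def unital_cstar_algebra_def
  using cstar_algebra_Q is_unit_Q unital_star_hom_\<Delta> \<Delta>_coassociative \<Delta>_cancellation \<Delta>_cancellation_right
  by blast

lemma \<alpha>_coaction:
  assumes a: "a \<in> CS.lspan"
  shows "reassoc (tensor_map CS.lspan Q.lspan \<alpha> id (\<alpha> a)) =
    tensor_map CS.lspan Q.lspan id (\<lambda>q. flip (\<Delta> q)) (\<alpha> a)"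
proof (rule CS.linear_on_lspan_eqI[OF _ _ _ a])
  have cl\<alpha>: "complex_linear (\<alpha> q)" if "q \<in> CS.lspan" for q
    using that by (intro complex_linear_CSQ \<alpha>_mem)
  have cl\<Delta>: "complex_linear (flip (\<Delta> q))" if "q \<in> Q.lspan" for q
    using that by (intro complex_linear_flip complex_linear_QQ \<Delta>_mem)
  have lin: "complex_linear_on Q.lspan (\<lambda>q. flip (\<Delta> q))"
    using \<Delta>_linear by (simp add: complex_linear_on_def flip_add flip_scale_op)
  have cont: "continuous_on Q.lspan (\<lambda>q. flip (\<Delta> q))"
    unfolding flip_def by (rule bounded_linear.continuous_on[OF bounded_linear_reindex_op \<Delta>_cont])
  have 1: "complex_linear_on (CS.lspan \<otimes>\<^sub>C Q.lspan) (tensor_map CS.lspan Q.lspan \<alpha> id)"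
    by (rule CS.complex_linear_on_tensor_map[OF Q_closed_subspace])
       (simp_all add: \<alpha>_linear cl\<alpha> complex_linear_on_id Q.complex_linear_lspan)
  have 2: "complex_linear_on (CS.lspan \<otimes>\<^sub>C Q.lspan) (tensor_map CS.lspan Q.lspan id (\<lambda>q. flip (\<Delta> q)))"
    by (rule CS.complex_linear_on_tensor_map[OF Q_closed_subspace])
       (simp_all add: lin cont cl\<Delta> complex_linear_on_id CS.complex_linear_lspan)
  have \<alpha>: "\<alpha> \<in> CS.lspan \<rightarrow> CS.lspan \<otimes>\<^sub>C Q.lspan" using \<alpha>_mem by auto
  show "complex_linear_on CS.lspan (\<lambda>a. tensor_map CS.lspan Q.lspan id (\<lambda>q. flip (\<Delta> q)) (\<alpha> a))"
    by (rule complex_linear_on_comp[OF \<alpha>_linear \<alpha> 2])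
  show "complex_linear_on CS.lspan (\<lambda>a. reassoc (tensor_map CS.lspan Q.lspan \<alpha> id (\<alpha> a)))"
    using complex_linear_on_comp[OF \<alpha>_linear \<alpha> 1]
    by (simp add: complex_linear_on_def reassoc_add reassoc_scale_op)
  fix g assume g: "g \<in> carrier G"
  show "reassoc (tensor_map CS.lspan Q.lspan \<alpha> id (\<alpha> (lam g))) =
      tensor_map CS.lspan Q.lspan id (\<lambda>q. flip (\<Delta> q)) (\<alpha> (lam g))"
    using g
    by (simp add: \<alpha>_lam CS.tensor_map_add_tensor[OF Q_closed_subspace] \<alpha>_linear cl\<alpha> complex_linear_on_id
        lin cont cl\<Delta> CS.complex_linear_lspan Q.complex_linear_lspan)
       (simp add: \<Delta>_e \<alpha>_lam tensor_add_left tensor_add_right cl_intros reassoc_add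
        reassoc_tensor flip_add flip_tensor algebra_simps)
qed

lemma \<alpha>_density:
  "closure (span {\<alpha> a o\<^sub>L (unit_of CS.lspan \<otimes>\<^sub>o q) |a q. a \<in> CS.lspan \<and> q \<in> Q.lspan}) = CS.lspan \<otimes>\<^sub>C Q.lspan"
  (is "closure (span ?Y) = _")
proof (rule CS.closure_span_eq_min_tensor[OF Q_closed_subspace])
  note unit = unit_of_eq[OF is_unit_CS]
  show "?Y \<subseteq> CS.lspan \<otimes>\<^sub>C Q.lspan"
    by (auto intro!: compose_in_CSQ \<alpha>_mem CS.tensor_in_min_tensor[OF Q_closed_subspace] simp: unit)
  fix g q assume g: "g \<in> carrier G" and q: "q \<in> Q.lspan"
  have clq: "complex_linear q" using q by (rule Q.complex_linear_lspan)
  have *: "\<alpha> (lam h) o\<^sub>L (unit_of CS.lspan \<otimes>\<^sub>o (e k (inv h) o\<^sub>L q)) \<in> span ?Y"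
    if "h \<in> carrier G" for h k
    by (rule span_base) (use that q in \<open>auto intro!: exI conjI compose_Q\<close>)
  have "lam g \<otimes>\<^sub>o q =
      (\<alpha> (lam g) o\<^sub>L (unit_of CS.lspan \<otimes>\<^sub>o (e False (inv g) o\<^sub>L q))) +
      (\<alpha> (lam (\<theta> g)) o\<^sub>L (unit_of CS.lspan \<otimes>\<^sub>o (e True (inv (\<theta> g)) o\<^sub>L q)))"
    using g q clq
    by (simp add: \<alpha>_lam unit compose_add tensor_compose cl_intros e_compose_compose
      flip: tensor_add_right add: unit_compose_Q)
  also have "\<dots> \<in> span ?Y" using g by (intro span_add *) simp_all
  finally show "lam g \<otimes>\<^sub>o q \<in> span ?Y" .
qed

lemma cqg_action_\<alpha>: "cqg_action Q.lspan \<Delta> CS.lspan \<alpha>"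
  unfolding cqg_action_def using unital_star_hom_\<alpha> \<alpha>_coaction \<alpha>_density by blast

lemma canonical_trace_eq: "canonical_trace G a = mcoef \<one> \<one> a"
  by (simp add: canonical_trace_def mcoef_def cinner_ket_left)

lemma \<alpha>_trace:
  assumes a: "a \<in> CS.lspan"
  shows "tensor_lift CS.lspan Q.lspan (\<lambda>b q. scale_op (canonical_trace G b) q) (\<alpha> a) =
    scale_op (canonical_trace G a) (unit_of Q.lspan)"
  unfolding canonical_trace_eq
proof (rule CS.linear_on_lspan_eqI[OF _ _ _ a])
  let ?\<phi> = "\<lambda>b q. scale_op (mcoef \<one> \<one> b) q"
  have \<phi>: "complex_linear_on CS.lspan (\<lambda>a. ?\<phi> a q)" "complex_linear_on Q.lspan (?\<phi> a)"
    "continuous_on Q.lspan (?\<phi> a)" for a :: "'a op" and q :: "('a + 'a) op"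
    by (simp_all add: complex_linear_on_def mcoef_algebra scale_op_algebra
        mult.commute linear_continuous_on[OF bounded_linear_scale_op])
  have lin: "complex_linear_on (CS.lspan \<otimes>\<^sub>C Q.lspan) (tensor_lift CS.lspan Q.lspan ?\<phi>)"
    by (rule CS.complex_linear_on_tensor_lift[OF Q_closed_subspace]) (rule \<phi>)+
  have \<alpha>: "\<alpha> \<in> CS.lspan \<rightarrow> CS.lspan \<otimes>\<^sub>C Q.lspan" using \<alpha>_mem by auto
  show "complex_linear_on CS.lspan (\<lambda>a. tensor_lift CS.lspan Q.lspan ?\<phi> (\<alpha> a))"
    by (rule complex_linear_on_comp[OF \<alpha>_linear \<alpha> lin])
  show "complex_linear_on CS.lspan (\<lambda>a. scale_op (mcoef \<one> \<one> a) (unit_of Q.lspan))"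
    by (rule \<phi>)
  fix g assume g: "g \<in> carrier G"
  have val: "tensor_lift CS.lspan Q.lspan ?\<phi> (a \<otimes>\<^sub>o q) = ?\<phi> a q"
    if "a \<in> CS.lspan" "q \<in> Q.lspan" for a q
    by (rule CS.tensor_lift_tensor[OF Q_closed_subspace \<phi> that])
  show "tensor_lift CS.lspan Q.lspan ?\<phi> (\<alpha> (lam g)) = scale_op (mcoef \<one> \<one> (lam g)) (unit_of Q.lspan)"
    using g \<theta>_eq_one_iff[OF g]
    by (auto simp: \<alpha>_lam complex_linear_onD(1)[OF lin] CS.tensor_in_min_tensor[OF Q_closed_subspace] val
        mcoef_left_reg scale_op_algebra unit_of_Q)
qed

text \<open>Applying \<open>\<theta>\<close> letter by letter exchanges the words for \<open>g\<close> with words for \<open>\<theta> g\<close> of the same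
  length.\<close>

lemma word_length_\<theta>:
  assumes S: "S \<subseteq> carrier G" "\<theta> ` S \<subseteq> S" and g: "g \<in> carrier G"
  shows "word_length G S (\<theta> g) = word_length G S g"
proof -
  let ?ev = "\<lambda>w. foldr (\<lambda>x y. x \<otimes> y) w \<one>"
  have ev: "?ev w \<in> carrier G \<and> ?ev (map \<theta> w) = \<theta> (?ev w)" if "set w \<subseteq> S" for w
    using that S(1) by (induction w) auto
  have "\<exists>w'. set w' \<subseteq> S \<and> length w' = length w \<and> ?ev w' = \<theta> (?ev w)" if "set w \<subseteq> S" for w
    using that S(2) ev[OF that] by (intro exI[of _ "map \<theta> w"]) auto
  then have "(\<exists>w. set w \<subseteq> S \<and> length w = n \<and> ?ev w = \<theta> g) \<longleftrightarrow>
      (\<exists>w. set w \<subseteq> S \<and> length w = n \<and> ?ev w = g)" for n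
    using g \<theta>_involutive by metis
  then show ?thesis by (simp add: word_length_def)
qed

lemma isometric_action_\<alpha>:
  assumes S: "S \<subseteq> carrier G" "\<theta> ` S \<subseteq> S"
  shows "isometric_action G S Q.lspan \<Delta> \<alpha>"
  unfolding isometric_action_def reduced_group_cstar_eq
proof (intro conjI ballI compact_quantum_group_\<Delta> cqg_action_\<alpha> \<alpha>_trace)
  fix g assume g: "g \<in> carrier G"
  show "\<alpha> (lam g) \<in> span {lam g' \<otimes>\<^sub>o q |g' q. g' \<in> carrier G \<and>
      word_length G S g' = word_length G S g \<and> q \<in> Q.lspan}"
    unfolding \<alpha>_lam[OF g]
    by (intro span_add span_base) (use g word_length_\<theta>[OF S g] e_in_Q \<theta>_closed in blast)+
qed

end


section \<open>Morphisms out of the double\<close>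

lemma closed_complex_linear: "closed {T. complex_linear T}"
  unfolding complex_linear_def
proof (intro closed_Collect_all closed_Collect_eq)
  fix c :: complex and x :: "'a ell2"
  show "continuous_on UNIV (\<lambda>T :: 'a ell2 \<Rightarrow>\<^sub>L 'b ell2. blinfun_apply T (scaleC c x))"
    by (intro linear_continuous_on blinfun.bounded_linear_left)
  show "continuous_on UNIV (\<lambda>T :: 'a ell2 \<Rightarrow>\<^sub>L 'b ell2. scaleC c (blinfun_apply T x))"
    by (intro linear_continuous_on bounded_linear_compose[OF bounded_linear_scaleC
          blinfun.bounded_linear_left])
qed

text \<open>Complex linearity survives limits, so it holds in the completed tensor product of algebras of
  arbitrary dimension.\<close>

lemma complex_linear_min_tensor:
  assumes "op_subspace A" "op_subspace B" "R \<in> A \<otimes>\<^sub>C B"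
  shows "complex_linear R"
proof -
  have "op_subspace {T. complex_linear T}" by (auto simp: op_subspace_def cl_intros)
  then have "alg_tensor A B \<subseteq> {T. complex_linear T}"
    unfolding alg_tensor_def
    by (rule op_subspace_span) (auto intro!: cl_intros dest: op_subspaceD(2)[OF assms(1)]
        op_subspaceD(2)[OF assms(2)])
  then have "A \<otimes>\<^sub>C B \<subseteq> {T. complex_linear T}"
    unfolding min_tensor_def by (rule closure_minimal) (rule closed_complex_linear)
  then show ?thesis using assms(3) by blast
qed

lemma unital_star_homD:
  assumes "unital_star_hom A B f"
  shows "a \<in> A \<Longrightarrow> f a \<in> B" "complex_linear_on A f" "continuous_on A f"
    "a \<in> A \<Longrightarrow> b \<in> A \<Longrightarrow> f (a o\<^sub>L b) = f a o\<^sub>L f b" "a \<in> A \<Longrightarrow> f (adj a) = adj (f a)"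
    "f (unit_of A) = unit_of B" "f \<in> extensional A"
  using assms by (auto simp: unital_star_hom_def PiE_def)

context involutive_group
begin

definition twist :: "bool \<Rightarrow> 'a \<Rightarrow> 'a" where
  "twist j g = (if j then \<theta> g else g)"

lemma twist_simps [simp]: "twist False g = g" "twist True g = \<theta> g"
  by (simp_all add: twist_def)

lemma twist_closed [simp]: "g \<in> carrier G \<Longrightarrow> twist j g \<in> carrier G"
  by (simp add: twist_def)

lemma twist_mult [simp]: "g \<in> carrier G \<Longrightarrow> h \<in> carrier G \<Longrightarrow> twist j (g \<otimes> h) = twist j g \<otimes> twist j h"
  by (simp add: twist_def)

lemma twist_one [simp]: "twist j \<one> = \<one>"
  by (simp add: twist_def)

lemma twist_inv [simp]: "g \<in> carrier G \<Longrightarrow> twist j (inv g) = inv (twist j g)"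
  by (simp add: twist_def)

lemma slice_lam [simp]:
  assumes "g \<in> carrier G" "complex_linear q"
  shows "slice h \<one> (lam g \<otimes>\<^sub>o q) = (if h = g then q else 0)"
  using assms by (simp add: slice_tensor mcoef_left_reg scale_op_algebra)

lemma tensor_lam_cancel:
  assumes "lam g \<otimes>\<^sub>o q = lam g \<otimes>\<^sub>o q'" "g \<in> carrier G" "complex_linear q" "complex_linear q'"
  shows "q = q'"
  using arg_cong[OF assms(1), of "slice g \<one>"] assms(2-4) by simp

text \<open>The action sees the elements \<open>e i g\<close> separately only where \<open>\<theta>\<close> moves \<open>g\<close>, and elsewhere
  only their sum over \<open>i\<close>.  This determines a multiplicative linear map nevertheless: a single
  moved element \<open>k\<close> gives \<open>e i \<one> = e i k \<cdot> e i (inv k)\<close>, and multiplying the sum by \<open>e i \<one>\<close>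
  separates its two terms.\<close>

lemma double_hom_eqI:
  assumes f: "complex_linear_on Q.lspan f" and f': "complex_linear_on Q.lspan f'"
    and mult: "\<And>p q. p \<in> Q.lspan \<Longrightarrow> q \<in> Q.lspan \<Longrightarrow> f (p o\<^sub>L q) = f p o\<^sub>L f q"
      "\<And>p q. p \<in> Q.lspan \<Longrightarrow> q \<in> Q.lspan \<Longrightarrow> f' (p o\<^sub>L q) = f' p o\<^sub>L f' q"
    and nontrivial: "k \<in> carrier G" "\<theta> k \<noteq> k"
    and moved: "\<And>g i. g \<in> carrier G \<Longrightarrow> \<theta> g \<noteq> g \<Longrightarrow> f (e i g) = f' (e i g)"
    and fixed: "\<And>g. g \<in> carrier G \<Longrightarrow> \<theta> g = g \<Longrightarrow>
      f (e False g + e True g) = f' (e False g + e True g)"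
    and q: "q \<in> Q.lspan"
  shows "f q = f' q"
proof (rule Q.linear_on_lspan_eqI[OF f f' _ q])
  note sub = op_subspaceD[OF Q.op_subspace_lspan]
  have k': "\<theta> (inv k) \<noteq> inv k" using nontrivial by (simp add: inv_eq_1_iff) (metis \<theta>_closed inv_inv)
  have one: "f (e i \<one>) = f' (e i \<one>)" for i
  proof -
    have "e i \<one> = e i k o\<^sub>L e i (inv k)" using nontrivial by simp
    then show ?thesis using moved[OF nontrivial, of i] moved[OF _ k', of i] nontrivial
      by (simp only: mult e_in_Q inv_closed)
  qed
  fix x assume "x \<in> (UNIV :: bool set) \<times> carrier G"
  then obtain i g where x: "x = (i, g)" and g: "g \<in> carrier G" by auto
  have "f (e i g) = f' (e i g)"
  proof (cases "\<theta> g = g")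
    case True
    have "e i g = e i \<one> o\<^sub>L (e False g + e True g)" using g by (simp add: compose_add)
    then show ?thesis using g one[of i] fixed[OF g True] by (simp only: mult sub(3) e_in_Q one_closed)
  next
    case False
    then show ?thesis using g by (rule moved[rotated])
  qed
  then show "f (case x of (j, g) \<Rightarrow> e j g) = f' (case x of (j, g) \<Rightarrow> e j g)" by (simp add: x)
qed

context
  fixes Q' :: "'q op set" and \<alpha>' :: "'a op \<Rightarrow> ('a \<times> 'q) op" and unit'
  assumes cstar': "cstar_algebra Q'" and unit': "is_unit Q' unit'"
    and hom': "unital_star_hom CS.lspan (CS.lspan \<otimes>\<^sub>C Q') \<alpha>'"
begin

lemma op_subspace_Q': "op_subspace Q'" and closed_Q': "closed Q'"
  using cstar' by (simp_all add: cstar_algebra_subspace cstar_algebraD)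

lemma complex_linear_Q': "q \<in> Q' \<Longrightarrow> complex_linear q"
  by (rule op_subspaceD(2)[OF op_subspace_Q'])

lemma coaction_mem: "g \<in> carrier G \<Longrightarrow> \<alpha>' (lam g) \<in> CS.lspan \<otimes>\<^sub>C Q'"
  by (simp add: unital_star_homD(1)[OF hom'])

lemma complex_linear_coaction: "g \<in> carrier G \<Longrightarrow> complex_linear (\<alpha>' (lam g))"
  using op_subspaceD(2)[OF CS.op_subspace_min_tensor[OF op_subspace_Q' closed_Q']] coaction_mem by blast

lemma coaction_mult: "g \<in> carrier G \<Longrightarrow> h \<in> carrier G \<Longrightarrow>
    \<alpha>' (lam g) o\<^sub>L \<alpha>' (lam h) = \<alpha>' (lam (g \<otimes> h))"
  by (simp flip: unital_star_homD(4)[OF hom'])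

lemma coaction_adj: "g \<in> carrier G \<Longrightarrow> adj (\<alpha>' (lam g)) = \<alpha>' (lam (inv g))"
  by (simp flip: unital_star_homD(5)[OF hom'])

lemma coaction_one: "\<alpha>' (lam \<one>) = lam \<one> \<otimes>\<^sub>o unit'"
  using unital_star_homD(6)[OF hom'] unit_of_eq[OF is_unit_CS]
    unit_of_eq[OF CS.is_unit_min_tensor[OF op_subspace_Q' closed_Q' is_unit_CS unit']] by simp

lemma coaction_unit: "g \<in> carrier G \<Longrightarrow> \<alpha>' (lam g) o\<^sub>L (lam \<one> \<otimes>\<^sub>o unit') = \<alpha>' (lam g)"
  using coaction_mult[of g \<one>] by (simp add: coaction_one)

text \<open>Suppose that a partition of unity in \<open>Q'\<close> cuts the coaction into two blocks, the first
  diagonal and the second supported on the graph of \<open>\<theta>\<close>.  The block entries \<open>\<pi> j g\<close> inherit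
  multiplicativity and adjoints from the coaction, as the projections commute with it, and are
  orthogonal for different \<open>j\<close>.  They are thus a representation of the double in \<open>Q'\<close>.\<close>

context
  fixes P :: "bool \<Rightarrow> 'q op"
  assumes P_mem: "P j \<in> Q'" and P_compose: "P i o\<^sub>L P j = (if i = j then P i else 0)"
    and adj_P: "adj (P j) = P j" and P_sum: "P False + P True = unit'"
    and blocks: "g \<in> carrier G \<Longrightarrow> \<exists>r\<in>Q'. \<alpha>' (lam g) o\<^sub>L (lam \<one> \<otimes>\<^sub>o P j) = lam (twist j g) \<otimes>\<^sub>o r \<and>
      (lam \<one> \<otimes>\<^sub>o P j) o\<^sub>L \<alpha>' (lam g) = lam (twist j g) \<otimes>\<^sub>o r"
begin

definition \<pi> :: "bool \<Rightarrow> 'a \<Rightarrow> 'q op" where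
  "\<pi> j g = slice (twist j g) \<one> (\<alpha>' (lam g) o\<^sub>L (lam \<one> \<otimes>\<^sub>o P j))"

lemma
  assumes g: "g \<in> carrier G"
  shows \<pi>_mem: "\<pi> j g \<in> Q'"
    and coaction_P: "\<alpha>' (lam g) o\<^sub>L (lam \<one> \<otimes>\<^sub>o P j) = lam (twist j g) \<otimes>\<^sub>o \<pi> j g"
    and P_coaction: "(lam \<one> \<otimes>\<^sub>o P j) o\<^sub>L \<alpha>' (lam g) = lam (twist j g) \<otimes>\<^sub>o \<pi> j g"
proof -
  obtain r where r: "r \<in> Q'" "\<alpha>' (lam g) o\<^sub>L (lam \<one> \<otimes>\<^sub>o P j) = lam (twist j g) \<otimes>\<^sub>o r"
      "(lam \<one> \<otimes>\<^sub>o P j) o\<^sub>L \<alpha>' (lam g) = lam (twist j g) \<otimes>\<^sub>o r"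
    using blocks[OF g] by blast
  moreover have "\<pi> j g = r" using r(1) g by (simp add: \<pi>_def r(2) complex_linear_Q')
  ultimately show "\<pi> j g \<in> Q'" "\<alpha>' (lam g) o\<^sub>L (lam \<one> \<otimes>\<^sub>o P j) = lam (twist j g) \<otimes>\<^sub>o \<pi> j g"
    "(lam \<one> \<otimes>\<^sub>o P j) o\<^sub>L \<alpha>' (lam g) = lam (twist j g) \<otimes>\<^sub>o \<pi> j g" by simp_all
qed

lemma complex_linear_\<pi>: "g \<in> carrier G \<Longrightarrow> complex_linear (\<pi> j g)"
  by (rule complex_linear_Q'[OF \<pi>_mem])

lemma complex_linear_P: "complex_linear (P j)"
  by (rule complex_linear_Q'[OF P_mem])

lemmas cl' = complex_linear_\<pi> complex_linear_P complex_linear_coaction complex_linear_compose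
  complex_linear_tensor_op

lemma lam_P_compose: "(lam \<one> \<otimes>\<^sub>o P i) o\<^sub>L (lam \<one> \<otimes>\<^sub>o P j) = (if i = j then lam \<one> \<otimes>\<^sub>o P i else 0)"
  by (simp add: tensor_compose cl' P_compose)

lemma \<pi>_P:
  assumes g: "g \<in> carrier G"
  shows "\<pi> j g o\<^sub>L P i = (if i = j then \<pi> j g else 0)" "P i o\<^sub>L \<pi> j g = (if i = j then \<pi> j g else 0)"
proof -
  have "lam (twist j g) \<otimes>\<^sub>o (\<pi> j g o\<^sub>L P i) = (lam (twist j g) \<otimes>\<^sub>o \<pi> j g) o\<^sub>L (lam \<one> \<otimes>\<^sub>o P i)"
    using g by (simp add: tensor_compose cl')
  also have "\<dots> = \<alpha>' (lam g) o\<^sub>L ((lam \<one> \<otimes>\<^sub>o P j) o\<^sub>L (lam \<one> \<otimes>\<^sub>o P i))"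
    by (simp only: compose_assoc flip: coaction_P[OF g])
  also have "\<dots> = lam (twist j g) \<otimes>\<^sub>o (if i = j then \<pi> j g else 0)"
    using g by (auto simp: lam_P_compose coaction_P)
  finally show "\<pi> j g o\<^sub>L P i = (if i = j then \<pi> j g else 0)"
    by (rule tensor_lam_cancel) (use g in \<open>auto simp: cl' complex_linear_zero\<close>)
  have "lam (twist j g) \<otimes>\<^sub>o (P i o\<^sub>L \<pi> j g) = (lam \<one> \<otimes>\<^sub>o P i) o\<^sub>L (lam (twist j g) \<otimes>\<^sub>o \<pi> j g)"
    using g by (simp add: tensor_compose cl')
  also have "\<dots> = ((lam \<one> \<otimes>\<^sub>o P i) o\<^sub>L (lam \<one> \<otimes>\<^sub>o P j)) o\<^sub>L \<alpha>' (lam g)"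
    by (simp only: compose_assoc flip: P_coaction[OF g])
  also have "\<dots> = lam (twist j g) \<otimes>\<^sub>o (if i = j then \<pi> j g else 0)"
    using g by (auto simp: lam_P_compose P_coaction)
  finally show "P i o\<^sub>L \<pi> j g = (if i = j then \<pi> j g else 0)"
    by (rule tensor_lam_cancel) (use g in \<open>auto simp: cl' complex_linear_zero\<close>)
qed

lemma \<pi>_mult:
  assumes g: "g \<in> carrier G" and h: "h \<in> carrier G"
  shows "\<pi> i g o\<^sub>L \<pi> j h = (if i = j then \<pi> i (g \<otimes> h) else 0)"
proof (cases "i = j")
  case True
  let ?E = "lam \<one> \<otimes>\<^sub>o P j"
  \<comment> \<open>The projection commutes with the coaction, so one copy of it absorbs the other.\<close>
  have "?E o\<^sub>L (\<alpha>' (lam h) o\<^sub>L ?E) = (?E o\<^sub>L ?E) o\<^sub>L \<alpha>' (lam h)"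
    by (simp only: coaction_P[OF h] flip: P_coaction[OF h] compose_assoc)
  also have "\<dots> = \<alpha>' (lam h) o\<^sub>L ?E"
    by (simp add: lam_P_compose coaction_P[OF h] P_coaction[OF h])
  finally have *: "?E o\<^sub>L (\<alpha>' (lam h) o\<^sub>L ?E) = \<alpha>' (lam h) o\<^sub>L ?E" .
  have "lam (twist j (g \<otimes> h)) \<otimes>\<^sub>o (\<pi> j g o\<^sub>L \<pi> j h) =
      (\<alpha>' (lam g) o\<^sub>L ?E) o\<^sub>L (\<alpha>' (lam h) o\<^sub>L ?E)"
    using g h by (simp add: coaction_P tensor_compose cl')
  also have "\<dots> = (\<alpha>' (lam g) o\<^sub>L \<alpha>' (lam h)) o\<^sub>L ?E"
    by (simp only: compose_assoc *)
  also have "\<dots> = lam (twist j (g \<otimes> h)) \<otimes>\<^sub>o \<pi> j (g \<otimes> h)"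
    using g h by (simp only: coaction_mult coaction_P m_closed)
  finally have "\<pi> j g o\<^sub>L \<pi> j h = \<pi> j (g \<otimes> h)"
    by (rule tensor_lam_cancel) (use g h in \<open>auto simp: cl'\<close>)
  then show ?thesis using True by simp
next
  case False
  have "\<pi> i g o\<^sub>L \<pi> j h = (\<pi> i g o\<^sub>L P i) o\<^sub>L \<pi> j h" using g by (simp add: \<pi>_P)
  also have "\<dots> = 0" using False h by (simp add: compose_assoc \<pi>_P)
  finally show ?thesis using False by simp
qed

lemma adj_\<pi>:
  assumes g: "g \<in> carrier G"
  shows "adj (\<pi> j g) = \<pi> j (inv g)"
proof -
  have "lam (twist j (inv g)) \<otimes>\<^sub>o adj (\<pi> j g) = adj (\<alpha>' (lam g) o\<^sub>L (lam \<one> \<otimes>\<^sub>o P j))"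
    using g by (simp add: coaction_P adj_tensor cl')
  also have "\<dots> = lam (twist j (inv g)) \<otimes>\<^sub>o \<pi> j (inv g)"
    using g by (simp add: adj_compose cl' adj_tensor adj_P coaction_adj P_coaction)
  finally show ?thesis by (rule tensor_lam_cancel) (use g in \<open>auto simp: cl' complex_linear_adj\<close>)
qed

lemma \<pi>_one: "\<pi> j \<one> = P j"
proof -
  have "lam \<one> \<otimes>\<^sub>o \<pi> j \<one> = lam \<one> \<otimes>\<^sub>o P j"
    using coaction_P[of \<one> j] unit' P_mem[of j] complex_linear_Q'[of unit']
    by (simp add: coaction_one tensor_compose cl' is_unit_def)
  then show ?thesis by (rule tensor_lam_cancel) (simp_all add: cl')
qed

lemma coaction_decomposition:
  assumes g: "g \<in> carrier G"
  shows "\<alpha>' (lam g) = lam g \<otimes>\<^sub>o \<pi> False g + lam (\<theta> g) \<otimes>\<^sub>o \<pi> True g"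
proof -
  have "\<alpha>' (lam g) = \<alpha>' (lam g) o\<^sub>L (lam \<one> \<otimes>\<^sub>o (P False + P True))"
    using g by (simp add: P_sum coaction_unit)
  also have "\<dots> = lam g \<otimes>\<^sub>o \<pi> False g + lam (\<theta> g) \<otimes>\<^sub>o \<pi> True g"
    using g by (simp add: tensor_add_right cl' compose_add coaction_P)
  finally show ?thesis .
qed

definition \<Phi> :: "('a + 'a) op \<Rightarrow> 'q op" where
  "\<Phi> = restrict (Q.extend (\<lambda>(j, g). \<pi> j g)) Q.lspan"

lemma \<Phi>_e: "g \<in> carrier G \<Longrightarrow> \<Phi> (e j g) = \<pi> j g"
  by (simp add: \<Phi>_def)

lemma unital_star_hom_\<Phi>: "unital_star_hom Q.lspan Q' \<Phi>"
  unfolding \<Phi>_def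
proof (rule Q.unital_star_hom_extend[OF op_subspace_Q'])
  show "is_unit Q.lspan (e False \<one> + e True \<one>)" by (rule is_unit_Q)
  show "Q.extend (\<lambda>(j, g). \<pi> j g) (e False \<one> + e True \<one>) = unit_of Q'"
    by (simp add: Q.extend_linear \<pi>_one P_sum unit_of_eq[OF unit'])
qed (auto simp: \<pi>_mem \<pi>_mult adj_\<pi> Q.extend_linear)

lemma \<Phi>_intertwines:
  assumes a: "a \<in> CS.lspan"
  shows "tensor_map CS.lspan Q.lspan id \<Phi> (\<alpha> a) = \<alpha>' a"
proof (rule CS.linear_on_lspan_eqI[OF _ _ _ a])
  note \<Phi> = unital_star_homD[OF unital_star_hom_\<Phi>]
  have cl\<Phi>: "complex_linear (\<Phi> q)" if "q \<in> Q.lspan" for q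
    by (rule complex_linear_Q'[OF \<Phi>(1)[OF that]])
  have "complex_linear_on (CS.lspan \<otimes>\<^sub>C Q.lspan) (tensor_map CS.lspan Q.lspan id \<Phi>)"
    by (rule CS.complex_linear_on_tensor_map[OF Q_closed_subspace])
       (simp_all add: \<Phi> cl\<Phi> complex_linear_on_id CS.complex_linear_lspan)
  then show "complex_linear_on CS.lspan (\<lambda>a. tensor_map CS.lspan Q.lspan id \<Phi> (\<alpha> a))"
    by (rule complex_linear_on_comp[OF \<alpha>_linear, rotated]) (use \<alpha>_mem in auto)
  show "complex_linear_on CS.lspan \<alpha>'" by (rule unital_star_homD(2)[OF hom'])
  fix g assume "g \<in> carrier G"
  then show "tensor_map CS.lspan Q.lspan id \<Phi> (\<alpha> (lam g)) = \<alpha>' (lam g)"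
    by (simp add: \<alpha>_lam CS.tensor_map_add_tensor[OF Q_closed_subspace] complex_linear_on_id \<Phi>(2,3) cl\<Phi>
        CS.complex_linear_lspan \<Phi>_e coaction_decomposition)
qed

context
  fixes \<Delta>' :: "'q op \<Rightarrow> ('q \<times> 'q) op" and k
  assumes hom\<Delta>': "unital_star_hom Q' (Q' \<otimes>\<^sub>C Q') \<Delta>'"
    and coaction': "a \<in> CS.lspan \<Longrightarrow> reassoc (tensor_map CS.lspan Q' \<alpha>' id (\<alpha>' a)) =
      tensor_map CS.lspan Q' id (\<lambda>q. flip (\<Delta>' q)) (\<alpha>' a)"
    and nontrivial: "k \<in> carrier G" "\<theta> k \<noteq> k"
begin

lemma complex_linear_\<Delta>': "q \<in> Q' \<Longrightarrow> complex_linear (\<Delta>' q)"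
  using complex_linear_min_tensor[OF op_subspace_Q' op_subspace_Q'] unital_star_homD(1)[OF hom\<Delta>'] by blast

text \<open>The coaction identity on \<open>\<lambda>\<^sub>g\<close>, sorted by the first leg.  The two terms of each side can be told
  apart exactly where \<open>\<theta>\<close> moves \<open>g\<close>.\<close>

lemma coaction_blocks:
  assumes g: "g \<in> carrier G"
  shows "lam g \<otimes>\<^sub>o (\<pi> False g \<otimes>\<^sub>o \<pi> False g + \<pi> True (\<theta> g) \<otimes>\<^sub>o \<pi> True g) +
      lam (\<theta> g) \<otimes>\<^sub>o (\<pi> True g \<otimes>\<^sub>o \<pi> False g + \<pi> False (\<theta> g) \<otimes>\<^sub>o \<pi> True g) =
    lam g \<otimes>\<^sub>o flip (\<Delta>' (\<pi> False g)) + lam (\<theta> g) \<otimes>\<^sub>o flip (\<Delta>' (\<pi> True g))"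
proof -
  have cl\<alpha>': "complex_linear (\<alpha>' a)" if "a \<in> CS.lspan" for a
    using that op_subspaceD(2)[OF CS.op_subspace_min_tensor[OF op_subspace_Q' closed_Q']]
      unital_star_homD(1)[OF hom'] by blast
  note hd = unital_star_homD[OF hom\<Delta>']
  have lin: "complex_linear_on Q' (\<lambda>q. flip (\<Delta>' q))"
    using hd(2) by (simp add: complex_linear_on_def flip_add flip_scale_op)
  have cont: "continuous_on Q' (\<lambda>q. flip (\<Delta>' q))"
    unfolding flip_def by (rule bounded_linear.continuous_on[OF bounded_linear_reindex_op hd(3)])
  have "tensor_map CS.lspan Q' \<alpha>' id (lam g \<otimes>\<^sub>o \<pi> False g + lam (\<theta> g) \<otimes>\<^sub>o \<pi> True g) =
      \<alpha>' (lam g) \<otimes>\<^sub>o \<pi> False g + \<alpha>' (lam (\<theta> g)) \<otimes>\<^sub>o \<pi> True g"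
    using g by (simp add: CS.tensor_map_add_tensor[OF op_subspace_Q' closed_Q'] unital_star_homD(2)[OF hom']
        cl\<alpha>' complex_linear_on_id complex_linear_Q' \<pi>_mem)
  then have "reassoc (tensor_map CS.lspan Q' \<alpha>' id (\<alpha>' (lam g))) =
      reassoc (\<alpha>' (lam g) \<otimes>\<^sub>o \<pi> False g + \<alpha>' (lam (\<theta> g)) \<otimes>\<^sub>o \<pi> True g)"
    by (simp only: flip: coaction_decomposition[OF g])
  moreover have "tensor_map CS.lspan Q' id (\<lambda>q. flip (\<Delta>' q)) (\<alpha>' (lam g)) =
      lam g \<otimes>\<^sub>o flip (\<Delta>' (\<pi> False g)) + lam (\<theta> g) \<otimes>\<^sub>o flip (\<Delta>' (\<pi> True g))"
    using g
    by (simp add: coaction_decomposition[OF g] CS.tensor_map_add_tensor[OF op_subspace_Q' closed_Q'] lin cont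
        complex_linear_on_id complex_linear_\<Delta>' complex_linear_flip \<pi>_mem CS.complex_linear_lspan)
  ultimately have "reassoc (\<alpha>' (lam g) \<otimes>\<^sub>o \<pi> False g + \<alpha>' (lam (\<theta> g)) \<otimes>\<^sub>o \<pi> True g) =
      lam g \<otimes>\<^sub>o flip (\<Delta>' (\<pi> False g)) + lam (\<theta> g) \<otimes>\<^sub>o flip (\<Delta>' (\<pi> True g))"
    using coaction'[OF CS.basis_in_lspan[OF g]] by simp
  then show ?thesis
    using g
    by (simp add: coaction_decomposition tensor_add_left tensor_add_right cl' complex_linear_add
        reassoc_add reassoc_tensor algebra_simps)
qed

text \<open>Where \<open>\<theta>\<close> moves \<open>g\<close>, the two blocks of the coaction identity separate and give the
  coproduct of each \<open>\<pi> i g\<close>.  Elsewhere only the sum over \<open>i\<close> is visible, and multiplying by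
  \<open>\<pi> i \<one>\<close>, which is a product of the first kind, separates them again.\<close>

lemma \<Delta>'_\<pi>_moved:
  assumes g: "g \<in> carrier G" "\<theta> g \<noteq> g"
  shows "\<Delta>' (\<pi> i g) = \<pi> False g \<otimes>\<^sub>o \<pi> i g + \<pi> True g \<otimes>\<^sub>o \<pi> (\<not> i) (\<theta> g)"
proof -
  have cl: "complex_linear (flip (\<Delta>' (\<pi> i g)))" for i
    using g(1) by (intro complex_linear_flip complex_linear_\<Delta>' \<pi>_mem)
  have "flip (\<Delta>' (\<pi> False g)) = \<pi> False g \<otimes>\<^sub>o \<pi> False g + \<pi> True (\<theta> g) \<otimes>\<^sub>o \<pi> True g"
    using arg_cong[OF coaction_blocks[OF g(1)], of "slice g \<one>"] g cl
    by (simp add: slice_add cl' complex_linear_add not_sym[OF g(2)])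
  moreover have "flip (\<Delta>' (\<pi> True g)) = \<pi> True g \<otimes>\<^sub>o \<pi> False g + \<pi> False (\<theta> g) \<otimes>\<^sub>o \<pi> True g"
    using arg_cong[OF coaction_blocks[OF g(1)], of "slice (\<theta> g) \<one>"] g cl
    by (simp add: slice_add cl' complex_linear_add)
  ultimately have "flip (flip (\<Delta>' (\<pi> i g))) =
      flip (if i then \<pi> True g \<otimes>\<^sub>o \<pi> False g + \<pi> False (\<theta> g) \<otimes>\<^sub>o \<pi> True g
        else \<pi> False g \<otimes>\<^sub>o \<pi> False g + \<pi> True (\<theta> g) \<otimes>\<^sub>o \<pi> True g)" by simp
  then show ?thesis
    using g(1)
    by (cases i) (simp_all add: flip_flip complex_linear_\<Delta>' \<pi>_mem flip_add flip_tensor cl' add.commute)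
qed

lemma \<Delta>'_compose: "p \<in> Q' \<Longrightarrow> q \<in> Q' \<Longrightarrow> \<Delta>' (p o\<^sub>L q) = \<Delta>' p o\<^sub>L \<Delta>' q"
  by (rule unital_star_homD(4)[OF hom\<Delta>'])

lemma \<Delta>'_\<pi>_one: "\<Delta>' (\<pi> i \<one>) = \<pi> False \<one> \<otimes>\<^sub>o \<pi> i \<one> + \<pi> True \<one> \<otimes>\<^sub>o \<pi> (\<not> i) \<one>"
proof -
  have k': "\<theta> (inv k) \<noteq> inv k" using nontrivial by simp (metis \<theta>_closed inv_inv)
  have "\<Delta>' (\<pi> i \<one>) = \<Delta>' (\<pi> i k o\<^sub>L \<pi> i (inv k))"
    using nontrivial(1) by (simp add: \<pi>_mult)
  also have "\<dots> = \<Delta>' (\<pi> i k) o\<^sub>L \<Delta>' (\<pi> i (inv k))"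
    using nontrivial(1) by (simp add: \<Delta>'_compose \<pi>_mem)
  also have "\<dots> = \<pi> False \<one> \<otimes>\<^sub>o \<pi> i \<one> + \<pi> True \<one> \<otimes>\<^sub>o \<pi> (\<not> i) \<one>"
    using nontrivial(1) \<Delta>'_\<pi>_moved[OF nontrivial] \<Delta>'_\<pi>_moved[OF _ k']
    by (cases i) (simp_all add: compose_add tensor_compose cl' \<pi>_mult complex_linear_zero)
  finally show ?thesis .
qed

lemma \<Delta>'_\<pi>:
  assumes g: "g \<in> carrier G"
  shows "\<Delta>' (\<pi> i g) = \<pi> False g \<otimes>\<^sub>o \<pi> i g + \<pi> True g \<otimes>\<^sub>o \<pi> (\<not> i) (\<theta> g)"
proof (cases "\<theta> g = g")
  case True
  let ?q = "\<pi> False g + \<pi> True g"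
  have q: "?q \<in> Q'" using g by (intro op_subspaceD(3)[OF op_subspace_Q'] \<pi>_mem)
  have clq: "complex_linear ?q" by (rule complex_linear_Q'[OF q])
  have cl: "complex_linear (flip (\<Delta>' (\<pi> i g)))" for i
    using g by (intro complex_linear_flip complex_linear_\<Delta>' \<pi>_mem)
  have "?q \<otimes>\<^sub>o ?q = flip (\<Delta>' (\<pi> False g)) + flip (\<Delta>' (\<pi> True g))"
    using arg_cong[OF coaction_blocks[OF g], of "slice g \<one>"] g cl True
    by (simp add: slice_add cl' complex_linear_add tensor_add_left tensor_add_right algebra_simps)
  also have "\<dots> = flip (\<Delta>' ?q)"
    using g by (simp add: complex_linear_onD(1)[OF unital_star_homD(2)[OF hom\<Delta>']] \<pi>_mem flip_add)
  finally have "flip (?q \<otimes>\<^sub>o ?q) = flip (flip (\<Delta>' ?q))" by simp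
  then have \<Delta>q: "\<Delta>' ?q = ?q \<otimes>\<^sub>o ?q"
    by (simp add: flip_tensor clq flip_flip complex_linear_\<Delta>' q)
  have "\<Delta>' (\<pi> i g) = \<Delta>' (\<pi> i \<one> o\<^sub>L ?q)"
    using g by (cases i) (simp_all add: compose_add \<pi>_mult)
  also have "\<dots> = \<Delta>' (\<pi> i \<one>) o\<^sub>L \<Delta>' ?q"
    by (rule \<Delta>'_compose) (simp_all add: \<pi>_mem q)
  also have "\<dots> = \<pi> False g \<otimes>\<^sub>o \<pi> i g + \<pi> True g \<otimes>\<^sub>o \<pi> (\<not> i) (\<theta> g)"
    using g True by (cases i) (simp_all add: \<Delta>'_\<pi>_one \<Delta>q compose_add tensor_compose cl' clq \<pi>_mult)
  finally show ?thesis .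
qed (rule \<Delta>'_\<pi>_moved[OF g])

lemma cqg_morphism_\<Phi>: "cqg_morphism Q.lspan \<Delta> Q' \<Delta>' \<Phi>"
  unfolding cqg_morphism_def
proof (intro conjI ballI unital_star_hom_\<Phi>)
  fix q assume q: "q \<in> Q.lspan"
  note \<Phi> = unital_star_homD[OF unital_star_hom_\<Phi>]
  have cl\<Phi>: "complex_linear (\<Phi> q)" if "q \<in> Q.lspan" for q
    by (rule complex_linear_Q'[OF \<Phi>(1)[OF that]])
  show "tensor_map Q.lspan Q.lspan \<Phi> \<Phi> (\<Delta> q) = \<Delta>' (\<Phi> q)"
  proof (rule Q.linear_on_lspan_eqI[OF _ _ _ q])
    have "complex_linear_on (Q.lspan \<otimes>\<^sub>C Q.lspan) (tensor_map Q.lspan Q.lspan \<Phi> \<Phi>)"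
      by (rule Q.complex_linear_on_tensor_map[OF Q_closed_subspace]) (simp_all add: \<Phi>(2,3) cl\<Phi>)
    then show "complex_linear_on Q.lspan (\<lambda>q. tensor_map Q.lspan Q.lspan \<Phi> \<Phi> (\<Delta> q))"
      by (rule complex_linear_on_comp[OF \<Delta>_linear, rotated]) (use \<Delta>_mem in auto)
    show "complex_linear_on Q.lspan (\<lambda>q. \<Delta>' (\<Phi> q))"
      by (rule complex_linear_on_comp[OF \<Phi>(2) _ unital_star_homD(2)[OF hom\<Delta>']]) (use \<Phi>(1) in auto)
    fix x assume "x \<in> (UNIV :: bool set) \<times> carrier G"
    then obtain i g where x: "x = (i, g)" and g: "g \<in> carrier G" by auto
    have "tensor_map Q.lspan Q.lspan \<Phi> \<Phi> (\<Delta> (e i g)) = \<Delta>' (\<Phi> (e i g))"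
      using g by (simp add: \<Delta>_e Q.tensor_map_add_tensor[OF Q_closed_subspace] \<Phi>(2,3) cl\<Phi> \<Phi>_e \<Delta>'_\<pi>)
    then show "tensor_map Q.lspan Q.lspan \<Phi> \<Phi> (\<Delta> (case x of (j, g) \<Rightarrow> e j g)) =
        \<Delta>' (\<Phi> (case x of (j, g) \<Rightarrow> e j g))" by (simp add: x)
  qed
qed

lemma ex1_morphism: "\<exists>!\<Phi>. isometric_action_morphism G Q.lspan \<Delta> \<alpha> Q' \<Delta>' \<alpha>' \<Phi>"
proof (rule ex1I)
  show "isometric_action_morphism G Q.lspan \<Delta> \<alpha> Q' \<Delta>' \<alpha>' \<Phi>"
    unfolding isometric_action_morphism_def reduced_group_cstar_eq
    using cqg_morphism_\<Phi> \<Phi>_intertwines by blast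
  fix \<Psi> assume "isometric_action_morphism G Q.lspan \<Delta> \<alpha> Q' \<Delta>' \<alpha>' \<Psi>"
  then have hom\<Psi>: "unital_star_hom Q.lspan Q' \<Psi>"
    and inter: "\<And>a. a \<in> CS.lspan \<Longrightarrow> tensor_map CS.lspan Q.lspan id \<Psi> (\<alpha> a) = \<alpha>' a"
    unfolding isometric_action_morphism_def reduced_group_cstar_eq cqg_morphism_def by blast+
  note \<Psi> = unital_star_homD[OF hom\<Psi>] and \<Phi> = unital_star_homD[OF unital_star_hom_\<Phi>]
  have cl\<Psi>: "complex_linear (\<Psi> q)" if "q \<in> Q.lspan" for q
    by (rule complex_linear_Q'[OF \<Psi>(1)[OF that]])
  have eq: "lam g \<otimes>\<^sub>o \<Psi> (e False g) + lam (\<theta> g) \<otimes>\<^sub>o \<Psi> (e True g) =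
      lam g \<otimes>\<^sub>o \<pi> False g + lam (\<theta> g) \<otimes>\<^sub>o \<pi> True g" if g: "g \<in> carrier G" for g
    using inter[OF CS.basis_in_lspan[OF g]] g
    by (simp add: \<alpha>_lam CS.tensor_map_add_tensor[OF Q_closed_subspace] complex_linear_on_id \<Psi>(2,3) cl\<Psi>
        CS.complex_linear_lspan coaction_decomposition)
  show "\<Psi> = \<Phi>"
  proof
    fix q show "\<Psi> q = \<Phi> q"
    proof (cases "q \<in> Q.lspan")
      case True
      show ?thesis
      proof (rule double_hom_eqI[OF \<Psi>(2) \<Phi>(2) \<Psi>(4) \<Phi>(4) nontrivial _ _ True])
        fix g i assume g: "g \<in> carrier G" "\<theta> g \<noteq> g"
        then show "\<Psi> (e i g) = \<Phi> (e i g)"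
          using arg_cong[OF eq[OF g(1)], of "slice (twist i g) \<one>"]
          by (cases i) (simp_all add: slice_add cl\<Psi> cl' \<Phi>_e not_sym[OF g(2)])
      next
        fix g assume g: "g \<in> carrier G" "\<theta> g = g"
        then show "\<Psi> (e False g + e True g) = \<Phi> (e False g + e True g)"
          using arg_cong[OF eq[OF g(1)], of "slice g \<one>"]
          by (simp add: slice_add cl\<Psi> cl' \<Phi>_e complex_linear_onD(1)[OF \<Psi>(2)]
              complex_linear_onD(1)[OF \<Phi>(2)])
      qed
    next
      case False
      then show ?thesis using \<Psi>(7) \<Phi>(7) by (simp add: extensional_def)
    qed
  qed
qed

end

end

end

end


section \<open>The symmetric group on three letters\<close>

definition r3 :: "nat \<Rightarrow> nat" where "r3 = t3 \<circ> t3"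
definition u3 :: "nat \<Rightarrow> nat" where "u3 = t3 \<circ> s3"
definition v3 :: "nat \<Rightarrow> nat" where "v3 = r3 \<circ> s3"

lemma t3_apply: "t3 x = (if x = 1 then 2 else if x = 2 then 3 else if x = 3 then 1 else x)"
  by (auto simp: t3_def transpose_def)

lemma s3_apply: "s3 x = (if x = 1 then 2 else if x = 2 then 1 else x)"
  by (auto simp: s3_def transpose_def)

lemmas S3_apply = t3_apply s3_apply r3_def u3_def v3_def

interpretation S3: group S3
  by (rule sym_group_is_group)

lemma S3_gens_closed: "t3 \<in> carrier S3" "s3 \<in> carrier S3"
proof -
  have 1: "{1, 2, 3} = {1..3 :: nat}" by auto
  show "t3 \<in> carrier S3"
    using cycle_permutes[of "[1, 2, 3 :: nat]"] 1 by (simp add: t3_def sym_group_carrier)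
  have "s3 permutes {1, 2}" using cycle_permutes[of "[1, 2 :: nat]"] by (simp add: s3_def)
  then show "s3 \<in> carrier S3"
    by (auto simp: sym_group_carrier intro: permutes_subset)
qed

lemma S3_table:
  "t3 \<otimes>\<^bsub>S3\<^esub> t3 = r3" "t3 \<otimes>\<^bsub>S3\<^esub> r3 = \<one>\<^bsub>S3\<^esub>" "t3 \<otimes>\<^bsub>S3\<^esub> s3 = u3"
  "r3 \<otimes>\<^bsub>S3\<^esub> t3 = \<one>\<^bsub>S3\<^esub>" "r3 \<otimes>\<^bsub>S3\<^esub> r3 = t3" "r3 \<otimes>\<^bsub>S3\<^esub> s3 = v3"
  "s3 \<otimes>\<^bsub>S3\<^esub> t3 = v3" "s3 \<otimes>\<^bsub>S3\<^esub> r3 = u3" "s3 \<otimes>\<^bsub>S3\<^esub> s3 = \<one>\<^bsub>S3\<^esub>"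
  by (rule ext; simp add: sym_group_mult sym_group_one S3_apply)+

lemma S3_closed [simp]: "t3 \<in> carrier S3" "r3 \<in> carrier S3" "s3 \<in> carrier S3"
  "u3 \<in> carrier S3" "v3 \<in> carrier S3"
proof -
  show "t3 \<in> carrier S3" "s3 \<in> carrier S3" by (rule S3_gens_closed)+
  then show "r3 \<in> carrier S3" using S3.m_closed S3_table(1) by metis
  then show "u3 \<in> carrier S3" "v3 \<in> carrier S3"
    using S3.m_closed S3_gens_closed S3_table(3,6) by metis+
qed

lemma neq_at_1_or_2: "p 1 \<noteq> q 1 \<or> p 2 \<noteq> q (2 :: nat) \<Longrightarrow> p \<noteq> q"
  by auto

lemma S3_neq:
  "\<one>\<^bsub>S3\<^esub> \<noteq> t3" "\<one>\<^bsub>S3\<^esub> \<noteq> r3" "\<one>\<^bsub>S3\<^esub> \<noteq> s3" "\<one>\<^bsub>S3\<^esub> \<noteq> u3" "\<one>\<^bsub>S3\<^esub> \<noteq> v3"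
  "t3 \<noteq> r3" "t3 \<noteq> s3" "t3 \<noteq> u3" "t3 \<noteq> v3" "r3 \<noteq> s3"
  "r3 \<noteq> u3" "r3 \<noteq> v3" "s3 \<noteq> u3" "s3 \<noteq> v3" "u3 \<noteq> v3"
  by (rule neq_at_1_or_2; simp add: sym_group_one S3_apply)+

lemmas S3_neqs [simp] = S3_neq S3_neq[THEN not_sym]

lemma S3_carrier: "carrier S3 = {\<one>\<^bsub>S3\<^esub>, t3, r3, s3, u3, v3}"
proof -
  have "card (set [\<one>\<^bsub>S3\<^esub>, t3, r3, s3, u3, v3]) = card (carrier S3)"
    using distinct_card[of "[\<one>\<^bsub>S3\<^esub>, t3, r3, s3, u3, v3]"] by (simp add: sym_group_card_carrier fact_numeral)
  moreover have "finite (carrier S3)"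
    using sym_group_card_carrier[of 3] card.infinite by fastforce
  ultimately have "set [\<one>\<^bsub>S3\<^esub>, t3, r3, s3, u3, v3] = carrier S3"
    by (intro card_subset_eq) simp_all
  then show ?thesis by simp
qed

lemma S3_inv [simp]: "inv\<^bsub>S3\<^esub> t3 = r3" "inv\<^bsub>S3\<^esub> r3 = t3" "inv\<^bsub>S3\<^esub> s3 = s3"
  "Hilbert_Choice.inv t3 = r3" "Hilbert_Choice.inv r3 = t3" "Hilbert_Choice.inv s3 = s3"
proof -
  show 1: "inv\<^bsub>S3\<^esub> t3 = r3" "inv\<^bsub>S3\<^esub> r3 = t3" "inv\<^bsub>S3\<^esub> s3 = s3"
    by (rule S3.inv_equality; simp add: S3_table)+
  show "Hilbert_Choice.inv t3 = r3" "Hilbert_Choice.inv r3 = t3" "Hilbert_Choice.inv s3 = s3"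
    using 1 by (simp_all add: sym_group_inv_equality)
qed

text \<open>The group is finite, so its generators already generate it as a semigroup.\<close>

lemma S3_induct [consumes 1, case_names t s mult]:
  assumes "g \<in> carrier S3" and t: "P t3" and s: "P s3"
    and mult: "\<And>g h. g \<in> carrier S3 \<Longrightarrow> h \<in> carrier S3 \<Longrightarrow> P g \<Longrightarrow> P h \<Longrightarrow> P (g \<otimes>\<^bsub>S3\<^esub> h)"
  shows "P g"
proof -
  have r: "P r3" using mult[of t3 t3] t by (simp add: S3_table)
  have "P \<one>\<^bsub>S3\<^esub>" "P u3" "P v3"
    using mult[of t3 r3] mult[of t3 s3] mult[of r3 s3] t r s by (simp_all add: S3_table)
  then show ?thesis using assms(1) t r s by (auto simp: S3_carrier)
qed

text \<open>Conjugation by \<open>s\<close> inverts \<open>t\<close> and fixes \<open>s\<close>, hence preserves the generating set.  It is the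
  involution along which the double is formed.\<close>

definition conj3 :: "(nat \<Rightarrow> nat) \<Rightarrow> nat \<Rightarrow> nat" where
  "conj3 g = s3 \<otimes>\<^bsub>S3\<^esub> g \<otimes>\<^bsub>S3\<^esub> s3"

lemma s3_s3_cancel: "g \<in> carrier S3 \<Longrightarrow> s3 \<otimes>\<^bsub>S3\<^esub> (s3 \<otimes>\<^bsub>S3\<^esub> g) = g"
  by (simp add: S3_table flip: S3.m_assoc)

interpretation D: involutive_group S3 conj3
proof
  show "finite (carrier S3)" by (simp add: S3_carrier)
  show "conj3 \<in> hom S3 S3"
    by (rule homI) (simp_all add: conj3_def S3.m_assoc s3_s3_cancel)
  fix g assume "g \<in> carrier S3"
  then show "conj3 (conj3 g) = g" by (simp add: conj3_def S3.m_assoc S3_table s3_s3_cancel)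
qed

lemma conj3_simps [simp]: "conj3 t3 = r3" "conj3 r3 = t3" "conj3 s3 = s3"
proof -
  have "v3 \<otimes>\<^bsub>S3\<^esub> s3 = r3" "u3 \<otimes>\<^bsub>S3\<^esub> s3 = t3"
    by (simp_all add: S3.m_assoc S3_table flip: S3_table(3,6))
  then show "conj3 t3 = r3" "conj3 r3 = t3" "conj3 s3 = s3"
    by (simp_all add: conj3_def S3_table)
qed

lemma gens3_eq: "gens3 = {t3, r3, s3}"
  unfolding gens3_def by (simp del: sym_group_inv_equality)

lemma symmetric_generating_set_gens3: "symmetric_generating_set S3 gens3"
  unfolding symmetric_generating_set_def
proof (intro conjI equalityI ballI)
  have gen: "t3 \<in> generate S3 gens3" "s3 \<in> generate S3 gens3"
    by (auto simp: gens3_eq intro: generate.incl)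
  show "carrier S3 \<subseteq> generate S3 gens3"
  proof
    fix g assume "g \<in> carrier S3"
    then show "g \<in> generate S3 gens3"
      by (induction rule: S3_induct) (auto intro: gen generate.eng)
  qed
  show "generate S3 gens3 \<subseteq> carrier S3"
    by (rule S3.generate_incl) (simp add: gens3_eq)
qed (auto simp: gens3_eq)

subsection \<open>Word length\<close>

lemma word_length_attained:
  assumes "g \<in> carrier S3"
  shows "\<exists>w. set w \<subseteq> gens3 \<and> length w = word_length S3 gens3 g \<and>
    foldr (\<lambda>x y. x \<otimes>\<^bsub>S3\<^esub> y) w \<one>\<^bsub>S3\<^esub> = g"
proof -
  let ?ev = "\<lambda>w. foldr (\<lambda>x y. x \<otimes>\<^bsub>S3\<^esub> y) w \<one>\<^bsub>S3\<^esub>"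
  have gens: "gens3 \<subseteq> carrier S3" by (simp add: gens3_eq)
  have closed: "?ev w \<in> carrier S3" if "set w \<subseteq> gens3" for w
    using that gens by (induction w) auto
  have append: "?ev (w @ w') = ?ev w \<otimes>\<^bsub>S3\<^esub> ?ev w'" if "set w \<subseteq> gens3" "set w' \<subseteq> gens3" for w w'
    using that(1)
  proof (induction w)
    case Nil
    then show ?case using closed[OF that(2)] by simp
  next
    case (Cons x w)
    then show ?case using closed[of w] closed[OF that(2)] gens by (auto simp: S3.m_assoc)
  qed
  have "\<exists>w. set w \<subseteq> gens3 \<and> ?ev w = g"
    using assms
  proof (induction rule: S3_induct)
    case t
    show ?case by (rule exI[of _ "[t3]"]) (simp add: gens3_eq)
  next
    case s
    show ?case by (rule exI[of _ "[s3]"]) (simp add: gens3_eq)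
  next
    case (mult g h)
    then obtain w w' where "set w \<subseteq> gens3" "?ev w = g" "set w' \<subseteq> gens3" "?ev w' = h" by blast
    then show ?case by (intro exI[of _ "w @ w'"]) (simp add: append del: foldr_append)
  qed
  then have "\<exists>n w. set w \<subseteq> gens3 \<and> length w = n \<and> ?ev w = g" by blast
  then show ?thesis unfolding word_length_def by (rule LeastI_ex)
qed

lemma word_length_eq_0:
  assumes "g \<in> carrier S3" "word_length S3 gens3 g = 0"
  shows "g = \<one>\<^bsub>S3\<^esub>"
  using word_length_attained[OF assms(1)] assms(2) by auto

lemma word_length_eq_1:
  assumes "g \<in> carrier S3" "word_length S3 gens3 g = 1"
  shows "g \<in> gens3"
proof -
  obtain w where "set w \<subseteq> gens3" "length w = 1" "foldr (\<lambda>x y. x \<otimes>\<^bsub>S3\<^esub> y) w \<one>\<^bsub>S3\<^esub> = g"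
    using word_length_attained[OF assms(1)] assms(2) by auto
  then show ?thesis by (auto simp: length_Suc_conv gens3_eq)
qed

lemma word_length_gens:
  assumes "g \<in> gens3"
  shows "word_length S3 gens3 g = 1"
proof -
  have g: "g \<in> carrier S3" "g \<noteq> \<one>\<^bsub>S3\<^esub>" using assms by (auto simp: gens3_eq)
  have "word_length S3 gens3 g \<le> 1"
    unfolding word_length_def by (rule Least_le) (use assms g in \<open>auto intro!: exI[of _ "[g]"]\<close>)
  then show ?thesis using word_length_eq_0[OF g(1)] g(2) by linarith
qed

text \<open>The element \<open>v3 = s t\<close> is not a generator, so its length exceeds one.\<close>

lemma word_length_not_v3:
  assumes "g \<in> {\<one>\<^bsub>S3\<^esub>, t3, r3, s3}"
  shows "word_length S3 gens3 g \<noteq> word_length S3 gens3 v3"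
proof -
  have "word_length S3 gens3 \<one>\<^bsub>S3\<^esub> \<le> 0"
    unfolding word_length_def by (rule Least_le) auto
  moreover have "g = \<one>\<^bsub>S3\<^esub> \<or> g \<in> gens3" using assms by (auto simp: gens3_eq)
  ultimately have "word_length S3 gens3 g \<le> 1" using word_length_gens[of g] by auto
  moreover have "word_length S3 gens3 v3 \<noteq> 0" using word_length_eq_0[of v3] by auto
  moreover have "word_length S3 gens3 v3 \<noteq> 1" using word_length_eq_1[of v3] by (auto simp: gens3_eq)
  ultimately show ?thesis by linarith
qed


section \<open>The fundamental corepresentation\<close>

lemma CS3_eq: "CS3 = D.CS.lspan"
  by (rule D.reduced_group_cstar_eq)

lemma Q3_eq: "Q3 = D.Q.lspan"
  by (rule D.dsum_eq_Q)

lemma E3_eq: "E3 = D.e False t3" and F3_eq: "F3 = D.e True t3"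
  and L3_eq: "L3 = D.e False s3 + D.e True s3"
  by (simp_all add: E3_def F3_def L3_def D.e_def dsum_add complex_linear_zero)

lemma U3_entries:
  "U3 $ 1 $ 1 = D.e False t3" "U3 $ 1 $ 2 = D.e True t3" "U3 $ 1 $ 3 = 0"
  "U3 $ 2 $ 1 = D.e True r3" "U3 $ 2 $ 2 = D.e False r3" "U3 $ 2 $ 3 = 0"
  "U3 $ 3 $ 1 = 0" "U3 $ 3 $ 2 = 0" "U3 $ 3 $ 3 = D.e False s3 + D.e True s3"
  by (simp_all add: U3_def E3_eq F3_eq L3_eq S3_table)

lemma L3_compose: "g \<in> carrier S3 \<Longrightarrow> D.e i g o\<^sub>L (D.e False s3 + D.e True s3) = D.e i (g \<otimes>\<^bsub>S3\<^esub> s3)"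
  by (cases i) (simp_all add: compose_add)

lemma L3_in_Q: "D.e False s3 + D.e True s3 \<in> D.Q.lspan"
  by (intro op_subspaceD(3)[OF D.Q.op_subspace_lspan]) simp_all

text \<open>\<open>E\<close>, \<open>F\<close> and \<open>L\<close> generate: the projections onto the two summands are the cubes of \<open>E\<close> and
  \<open>F\<close>, and they split \<open>L\<close>.\<close>

lemma Q3_generation:
  assumes g: "g \<in> carrier S3"
    and EFL: "P (D.e False t3)" "P (D.e True t3)" "P (D.e False s3 + D.e True s3)"
    and mult: "\<And>p q. p \<in> D.Q.lspan \<Longrightarrow> q \<in> D.Q.lspan \<Longrightarrow> P p \<Longrightarrow> P q \<Longrightarrow> P (p o\<^sub>L q)"
  shows "P (D.e i g)"
proof -
  have "\<forall>i. P (D.e i g)"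
    using g
  proof (induction rule: S3_induct)
    case t
    show ?case using EFL(1,2) by (metis (full_types))
  next
    case s
    show ?case
    proof
      fix i
      have t: "P (D.e i t3)" using EFL(1,2) by (cases i) auto
      have r: "P (D.e i r3)"
        using mult[of "D.e i t3" "D.e i t3"] t by (simp add: S3_table)
      have "P (D.e i \<one>\<^bsub>S3\<^esub>)"
        using mult[of "D.e i t3" "D.e i r3"] r t by (simp add: S3_table)
      then show "P (D.e i s3)"
        using mult[of "D.e i \<one>\<^bsub>S3\<^esub>" "D.e False s3 + D.e True s3"] EFL(3) L3_in_Q
        by (simp add: L3_compose)
    qed
  next
    case (mult g h)
    show ?case
    proof
      fix i show "P (D.e i (g \<otimes>\<^bsub>S3\<^esub> h))"
        using assms(5)[of "D.e i g" "D.e i h"] mult by simp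
    qed
  qed
  then show ?thesis ..
qed

lemma Q3_hom_eqI:
  assumes f: "unital_star_hom D.Q.lspan C f" and f': "unital_star_hom D.Q.lspan C' f'"
    and EFL: "f (D.e False t3) = f' (D.e False t3)" "f (D.e True t3) = f' (D.e True t3)"
      "f (D.e False s3 + D.e True s3) = f' (D.e False s3 + D.e True s3)"
  shows "f = f'"
proof
  fix q show "f q = f' q"
  proof (cases "q \<in> D.Q.lspan")
    case True
    have "f (D.e i g) = f' (D.e i g)" if "g \<in> carrier S3" for i g
      using that EFL
      by (rule Q3_generation) (simp add: unital_star_homD(4)[OF f] unital_star_homD(4)[OF f'])
    then show ?thesis
      by (intro D.Q.linear_on_lspan_eqI[OF unital_star_homD(2)[OF f] unital_star_homD(2)[OF f'] _ True])
         auto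
  next
    case False
    then show ?thesis
      using unital_star_homD(7)[OF f] unital_star_homD(7)[OF f'] by (simp add: extensional_def)
  qed
qed

lemma cstar_generated_U3: "cstar_generated {U3 $ i $ j |i j. True} = D.Q.lspan"
proof
  have "U3 $ i $ j \<in> D.Q.lspan" for i j
    using exhaust_3[of i] exhaust_3[of j] by (auto simp: U3_entries L3_in_Q)
  then show "cstar_generated {U3 $ i $ j |i j. True} \<subseteq> D.Q.lspan"
    by (intro cstar_generated_minimal[OF D.cstar_algebra_Q]) auto
  show "D.Q.lspan \<subseteq> cstar_generated {U3 $ i $ j |i j. True}"
    unfolding cstar_generated_def
  proof (rule Inter_greatest)
    fix A assume "A \<in> {A. cstar_algebra A \<and> {U3 $ i $ j |i j. True} \<subseteq> A}"
    then have A: "cstar_algebra A" and U: "\<And>i j. U3 $ i $ j \<in> A" by auto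
    have "D.e i g \<in> A" if "g \<in> carrier S3" for i g
      using that U[of 1 1] U[of 1 2] U[of 3 3] unfolding U3_entries
      by (rule Q3_generation) (rule cstar_algebraD(1)[OF A])
    then show "D.Q.lspan \<subseteq> A"
      by (intro D.Q.lspan_minimal cstar_algebra_subspace[OF A]) auto
  qed
qed

lemma unitary_U3: "unitary_matrix D.Q.lspan U3"
  unfolding unitary_matrix_def forall_3 sum_3 U3_entries D.unit_of_Q
  by (simp add: adj_add compose_add S3_table)

lemma corepresentation_U3: "corepresentation D.Q.lspan D.\<Delta> U3"
  unfolding corepresentation_def forall_3 sum_3 U3_entries
  by (simp add: D.\<Delta>_e L3_in_Q complex_linear_onD(1)[OF D.\<Delta>_linear] complex_linear_add
      complex_linear_on_zero[OF D.\<Delta>_linear D.Q.op_subspace_lspan] complex_linear_zero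
      tensor_add_left tensor_add_right algebra_simps)

lemma fundamental_U3: "fundamental_corepresentation D.Q.lspan D.\<Delta> U3"
  unfolding fundamental_corepresentation_def
  by (intro conjI corepresentation_U3 unitary_U3 cstar_generated_U3)

lemma \<Delta>_unique:
  assumes hom: "unital_star_hom D.Q.lspan (D.Q.lspan \<otimes>\<^sub>C D.Q.lspan) \<Delta>"
    and fund: "fundamental_corepresentation D.Q.lspan \<Delta> U3"
  shows "\<Delta> = D.\<Delta>"
proof (rule Q3_hom_eqI[OF hom D.unital_star_hom_\<Delta>])
  have "\<Delta> (U3 $ i $ j) = D.\<Delta> (U3 $ i $ j)" for i j
    using fund fundamental_U3 unfolding fundamental_corepresentation_def corepresentation_def by simp
  then show "\<Delta> (D.e False t3) = D.\<Delta> (D.e False t3)" "\<Delta> (D.e True t3) = D.\<Delta> (D.e True t3)"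
    "\<Delta> (D.e False s3 + D.e True s3) = D.\<Delta> (D.e False s3 + D.e True s3)"
    by (metis U3_entries)+
qed

lemma \<alpha>_gens: "D.\<alpha> (lam3 t3) = lam3 t3 \<otimes>\<^sub>o E3 + lam3 (inv\<^bsub>S3\<^esub> t3) \<otimes>\<^sub>o F3"
  "D.\<alpha> (lam3 s3) = lam3 s3 \<otimes>\<^sub>o L3"
  by (simp_all add: D.\<alpha>_lam E3_eq F3_eq L3_eq tensor_add_right)

lemma \<alpha>_unique:
  assumes hom: "unital_star_hom D.CS.lspan C \<alpha>" and hom': "unital_star_hom D.CS.lspan C' \<alpha>'"
    and eq: "\<alpha> (lam3 t3) = \<alpha>' (lam3 t3)" "\<alpha> (lam3 s3) = \<alpha>' (lam3 s3)"
  shows "\<alpha> = \<alpha>'"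
proof
  fix a show "\<alpha> a = \<alpha>' a"
  proof (cases "a \<in> D.CS.lspan")
    case True
    have "\<alpha> (lam3 g) = \<alpha>' (lam3 g)" if "g \<in> carrier S3" for g
      using that
    proof (induction rule: S3_induct)
      case (mult g h)
      then show ?case
        using unital_star_homD(4)[OF hom, of "lam3 g" "lam3 h"]
          unital_star_homD(4)[OF hom', of "lam3 g" "lam3 h"] by simp
    qed (rule eq)+
    then show ?thesis
      by (rule D.CS.linear_on_lspan_eqI[OF unital_star_homD(2)[OF hom] unital_star_homD(2)[OF hom'] _ True])
  next
    case False
    then show ?thesis
      using unital_star_homD(7)[OF hom] unital_star_homD(7)[OF hom'] by (simp add: extensional_def)
  qed
qed


section \<open>The universal property\<close>

lemma slice_of_level:
  assumes sub: "op_subspace Q'" and h: "h \<in> carrier S3" "\<not> P h"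
    and R: "R \<in> span {lam3 g \<otimes>\<^sub>o q |g q. g \<in> carrier S3 \<and> P g \<and> q \<in> Q'}"
  shows "slice h \<one>\<^bsub>S3\<^esub> R = 0"
proof -
  note lin = bounded_linear.linear[OF bounded_linear_slice]
  have "subspace {R. slice h \<one>\<^bsub>S3\<^esub> R = 0}"
    using linear_subspace_kernel[OF lin] .
  moreover have "{lam3 g \<otimes>\<^sub>o q |g q. g \<in> carrier S3 \<and> P g \<and> q \<in> Q'} \<subseteq> {R. slice h \<one>\<^bsub>S3\<^esub> R = 0}"
    using h op_subspaceD(2)[OF sub] by auto
  ultimately show ?thesis using R span_minimal by blast
qed

context
  fixes Q' :: "'q op set" and \<alpha>' :: "(nat \<Rightarrow> nat) op \<Rightarrow> ((nat \<Rightarrow> nat) \<times> 'q) op" and unit'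
  assumes cstar': "cstar_algebra Q'" and unit': "is_unit Q' unit'"
    and hom': "unital_star_hom D.CS.lspan (D.CS.lspan \<otimes>\<^sub>C Q') \<alpha>'"
    and levels: "g \<in> carrier S3 \<Longrightarrow> h \<in> carrier S3 \<Longrightarrow>
      word_length S3 gens3 h \<noteq> word_length S3 gens3 g \<Longrightarrow> slice h \<one>\<^bsub>S3\<^esub> (\<alpha>' (lam3 g)) = 0"
begin

text \<open>Preservation of length confines the image of a generator to the three coefficients at the
  generators.\<close>

lemma coaction_on_gens3:
  assumes g: "g \<in> gens3"
  shows "\<alpha>' (lam3 g) = lam3 t3 \<otimes>\<^sub>o slice t3 \<one>\<^bsub>S3\<^esub> (\<alpha>' (lam3 g)) +
    (lam3 r3 \<otimes>\<^sub>o slice r3 \<one>\<^bsub>S3\<^esub> (\<alpha>' (lam3 g)) + lam3 s3 \<otimes>\<^sub>o slice s3 \<one>\<^bsub>S3\<^esub> (\<alpha>' (lam3 g)))"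
    and "h \<in> carrier S3 \<Longrightarrow> slice h \<one>\<^bsub>S3\<^esub> (\<alpha>' (lam3 g)) \<in> Q'"
proof -
  note expand = D.CS.min_tensor_expand[OF cstar_algebra_subspace[OF cstar'] cstar_algebraD(3)[OF cstar']
      D.coaction_mem[OF cstar' unit' hom']]
  have gc: "g \<in> carrier S3" using g by (auto simp: gens3_eq)
  have "slice h \<one>\<^bsub>S3\<^esub> (\<alpha>' (lam3 g)) = 0" if "h \<in> {\<one>\<^bsub>S3\<^esub>, u3, v3}" for h
  proof (rule levels[OF gc])
    show h: "h \<in> carrier S3" using that by auto
    have "h \<notin> gens3" using that by (auto simp: gens3_eq)
    then show "word_length S3 gens3 h \<noteq> word_length S3 gens3 g"
      using word_length_gens[OF g] word_length_eq_1[OF h] by auto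
  qed
  then show "\<alpha>' (lam3 g) = lam3 t3 \<otimes>\<^sub>o slice t3 \<one>\<^bsub>S3\<^esub> (\<alpha>' (lam3 g)) +
    (lam3 r3 \<otimes>\<^sub>o slice r3 \<one>\<^bsub>S3\<^esub> (\<alpha>' (lam3 g)) + lam3 s3 \<otimes>\<^sub>o slice s3 \<one>\<^bsub>S3\<^esub> (\<alpha>' (lam3 g)))"
    using expand(1)[OF gc] by (simp add: S3_carrier)
  show "slice h \<one>\<^bsub>S3\<^esub> (\<alpha>' (lam3 g)) \<in> Q'" if "h \<in> carrier S3"
    by (rule expand(2)[OF gc that])
qed

text \<open>The relations of the group and the length condition force the coaction on the generators into
  the asserted form.  Write \<open>\<lambda>\<^sub>t \<mapsto> \<lambda>\<^sub>t \<otimes> A + \<lambda>\<^sub>r \<otimes> B + \<lambda>\<^sub>s \<otimes> C\<close>, where \<open>r\<close> is the inverse of \<open>t\<close>, and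
  \<open>\<lambda>\<^sub>s \<mapsto> \<lambda>\<^sub>t \<otimes> K + \<lambda>\<^sub>r \<otimes> M + \<lambda>\<^sub>s \<otimes> L\<close>.  Comparing coefficients in \<open>t t = r\<close> gives \<open>C = 0\<close> and
  identifies the adjoints of \<open>A\<close> and \<open>B\<close> with their squares; \<open>t r = \<one>\<close> gives that the cubes of \<open>A\<close> and \<open>B\<close> sum to
  one and that \<open>A\<close> and \<open>B\<close> are orthogonal.  As \<open>s t\<close> has length two, its coefficients of length at most one
  vanish, which eliminates \<open>M\<close> and then its adjoint \<open>K\<close>.  Finally \<open>s t = r s\<close> tells
  how \<open>L\<close> moves past \<open>A\<close> and \<open>B\<close>.\<close>

lemma coaction_generators:
  obtains A B L where "A \<in> Q'" "B \<in> Q'" "L \<in> Q'"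
    "\<alpha>' (lam3 t3) = lam3 t3 \<otimes>\<^sub>o A + lam3 r3 \<otimes>\<^sub>o B" "\<alpha>' (lam3 s3) = lam3 s3 \<otimes>\<^sub>o L"
    "adj A = A o\<^sub>L A" "adj B = B o\<^sub>L B" "A o\<^sub>L B = 0" "B o\<^sub>L A = 0"
    "(A o\<^sub>L (A o\<^sub>L A)) + (B o\<^sub>L (B o\<^sub>L B)) = unit'"
    "A o\<^sub>L (A o\<^sub>L (A o\<^sub>L A)) = A" "B o\<^sub>L (B o\<^sub>L (B o\<^sub>L B)) = B"
    "L o\<^sub>L A = A o\<^sub>L (A o\<^sub>L L)" "L o\<^sub>L B = B o\<^sub>L (B o\<^sub>L L)"
proof -
  note mult = D.coaction_mult[OF cstar' unit' hom'] and star = D.coaction_adj[OF cstar' unit' hom']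
    and one = D.coaction_one[OF cstar' unit' hom']
  define A where "A = slice t3 \<one>\<^bsub>S3\<^esub> (\<alpha>' (lam3 t3))"
  define B where "B = slice r3 \<one>\<^bsub>S3\<^esub> (\<alpha>' (lam3 t3))"
  define C where "C = slice s3 \<one>\<^bsub>S3\<^esub> (\<alpha>' (lam3 t3))"
  define K where "K = slice t3 \<one>\<^bsub>S3\<^esub> (\<alpha>' (lam3 s3))"
  define M where "M = slice r3 \<one>\<^bsub>S3\<^esub> (\<alpha>' (lam3 s3))"
  define L where "L = slice s3 \<one>\<^bsub>S3\<^esub> (\<alpha>' (lam3 s3))"
  have gens: "t3 \<in> gens3" "s3 \<in> gens3" by (simp_all add: gens3_eq)
  have in_Q': "A \<in> Q'" "B \<in> Q'" "C \<in> Q'" "K \<in> Q'" "M \<in> Q'" "L \<in> Q'"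
    unfolding A_def B_def C_def K_def M_def L_def
    by (auto intro!: coaction_on_gens3(2) simp: gens)
  note clQ = cstar_algebraD(4)[OF cstar']
  note cl = clQ[OF in_Q'(1)] clQ[OF in_Q'(2)] clQ[OF in_Q'(3)] clQ[OF in_Q'(4)] clQ[OF in_Q'(5)]
    clQ[OF in_Q'(6)] complex_linear_compose complex_linear_adj complex_linear_tensor_op
    complex_linear_add complex_linear_zero
  have cl_unit: "complex_linear unit'" using unit' clQ by (auto simp: is_unit_def)
  have t0: "\<alpha>' (lam3 t3) = lam3 t3 \<otimes>\<^sub>o A + (lam3 r3 \<otimes>\<^sub>o B + lam3 s3 \<otimes>\<^sub>o C)"
    unfolding A_def B_def C_def by (rule coaction_on_gens3(1)[OF gens(1)])
  have s0: "\<alpha>' (lam3 s3) = lam3 t3 \<otimes>\<^sub>o K + (lam3 r3 \<otimes>\<^sub>o M + lam3 s3 \<otimes>\<^sub>o L)"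
    unfolding K_def M_def L_def by (rule coaction_on_gens3(1)[OF gens(2)])
  note expand = compose_add tensor_compose slice_add cl S3_table
  have tt: "\<alpha>' (lam3 t3) o\<^sub>L \<alpha>' (lam3 t3) = adj (\<alpha>' (lam3 t3))"
    by (simp add: mult star S3_table)
  \<comment> \<open>No product of two of the three generators equals \<open>s\<close>, so \<open>t t = inv t\<close> kills \<open>C\<close>.\<close>
  have "adj C = 0"
    using arg_cong[OF tt, of "slice s3 \<one>\<^bsub>S3\<^esub>"] unfolding t0
    by (simp add: adj_add adj_tensor expand)
  then have C: "C = 0" using adj_adj[of C] cl by simp
  have t: "\<alpha>' (lam3 t3) = lam3 t3 \<otimes>\<^sub>o A + lam3 r3 \<otimes>\<^sub>o B" using t0 by (simp add: C)
  have A: "adj A = A o\<^sub>L A" and B: "adj B = B o\<^sub>L B"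
    using arg_cong[OF tt, of "slice r3 \<one>\<^bsub>S3\<^esub>"] arg_cong[OF tt, of "slice t3 \<one>\<^bsub>S3\<^esub>"] unfolding t
    by (simp_all add: adj_add adj_tensor expand)
  have r: "\<alpha>' (lam3 r3) = lam3 r3 \<otimes>\<^sub>o (A o\<^sub>L A) + lam3 t3 \<otimes>\<^sub>o (B o\<^sub>L B)"
    using star[of t3] unfolding t by (simp add: adj_add adj_tensor expand A B)
  have tr: "\<alpha>' (lam3 t3) o\<^sub>L \<alpha>' (lam3 r3) = lam3 \<one>\<^bsub>S3\<^esub> \<otimes>\<^sub>o unit'"
    by (simp_all add: mult S3_table one)
  have AB: "A o\<^sub>L (B o\<^sub>L B) = 0" "B o\<^sub>L (A o\<^sub>L A) = 0"
    and sum: "(A o\<^sub>L (A o\<^sub>L A)) + (B o\<^sub>L (B o\<^sub>L B)) = unit'"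
    using arg_cong[OF tr, of "slice r3 \<one>\<^bsub>S3\<^esub>"] arg_cong[OF tr, of "slice t3 \<one>\<^bsub>S3\<^esub>"]
      arg_cong[OF tr, of "slice \<one>\<^bsub>S3\<^esub> \<one>\<^bsub>S3\<^esub>"] unfolding t r
    by (simp_all add: expand cl_unit)
  have unitr: "q o\<^sub>L unit' = q" "unit' o\<^sub>L q = q" if "q \<in> Q'" for q
    using unit' that by (auto simp: is_unit_def)
  have AB0: "A o\<^sub>L B = 0" "B o\<^sub>L A = 0"
  proof -
    have "A o\<^sub>L B = A o\<^sub>L (B o\<^sub>L ((A o\<^sub>L (A o\<^sub>L A)) + (B o\<^sub>L (B o\<^sub>L B))))"
      by (simp add: sum unitr in_Q')
    also have "\<dots> = ((A o\<^sub>L (B o\<^sub>L (A o\<^sub>L A))) o\<^sub>L A) + ((A o\<^sub>L (B o\<^sub>L B)) o\<^sub>L (B o\<^sub>L B))"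
      by (simp only: compose_add D.compose_assoc)
    finally show "A o\<^sub>L B = 0" by (simp add: AB)
    have "B o\<^sub>L A = B o\<^sub>L (A o\<^sub>L ((A o\<^sub>L (A o\<^sub>L A)) + (B o\<^sub>L (B o\<^sub>L B))))"
      by (simp add: sum unitr in_Q')
    also have "\<dots> = ((B o\<^sub>L (A o\<^sub>L A)) o\<^sub>L (A o\<^sub>L A)) + ((B o\<^sub>L (A o\<^sub>L (B o\<^sub>L B))) o\<^sub>L B)"
      by (simp only: compose_add D.compose_assoc)
    finally show "B o\<^sub>L A = 0" by (simp add: AB)
  qed
  have AAA: "A = A o\<^sub>L (A o\<^sub>L (A o\<^sub>L A))" and BBB: "B = B o\<^sub>L (B o\<^sub>L (B o\<^sub>L B))"
  proof -
    have "A = A o\<^sub>L ((A o\<^sub>L (A o\<^sub>L A)) + (B o\<^sub>L (B o\<^sub>L B)))" by (simp add: sum unitr in_Q')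
    also have "\<dots> = (A o\<^sub>L (A o\<^sub>L (A o\<^sub>L A))) + ((A o\<^sub>L B) o\<^sub>L (B o\<^sub>L B))"
      by (simp only: compose_add D.compose_assoc)
    finally show "A = A o\<^sub>L (A o\<^sub>L (A o\<^sub>L A))" by (simp add: AB0)
    have "B = B o\<^sub>L ((A o\<^sub>L (A o\<^sub>L A)) + (B o\<^sub>L (B o\<^sub>L B)))" by (simp add: sum unitr in_Q')
    also have "\<dots> = ((B o\<^sub>L A) o\<^sub>L (A o\<^sub>L A)) + (B o\<^sub>L (B o\<^sub>L (B o\<^sub>L B)))"
      by (simp only: compose_add D.compose_assoc)
    finally show "B = B o\<^sub>L (B o\<^sub>L (B o\<^sub>L B))" by (simp add: AB0)
  qed
  \<comment> \<open>The product \<open>s t\<close> has length two, so its coefficients of length at most one vanish.\<close>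
  have st: "slice h \<one>\<^bsub>S3\<^esub> (\<alpha>' (lam3 s3) o\<^sub>L \<alpha>' (lam3 t3)) = 0" if "h \<in> {\<one>\<^bsub>S3\<^esub>, t3, r3, s3}" for h
    using levels[of v3 h] word_length_not_v3[OF that] that by (auto simp: mult S3_table)
  have KM: "M o\<^sub>L B = 0" "K o\<^sub>L A = 0" "(K o\<^sub>L B) + (M o\<^sub>L A) = 0"
    using st[of t3] st[of r3] st[of "\<one>\<^bsub>S3\<^esub>"] unfolding t s0
    by (simp_all add: expand add.commute)
  \<comment> \<open>\<open>M\<close> is killed by both members of the partition of unity.\<close>
  have "M o\<^sub>L (A o\<^sub>L (A o\<^sub>L A)) = ((K o\<^sub>L B) + (M o\<^sub>L A)) o\<^sub>L (A o\<^sub>L A)"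
    by (simp add: compose_add D.compose_assoc AB)
  then have "M o\<^sub>L ((A o\<^sub>L (A o\<^sub>L A)) + (B o\<^sub>L (B o\<^sub>L B))) = (M o\<^sub>L B) o\<^sub>L (B o\<^sub>L B)"
    by (simp add: KM(3) compose_add D.compose_assoc)
  then have M: "M = 0" by (simp add: sum unitr in_Q' KM(1))
  have ss: "adj (\<alpha>' (lam3 s3)) = \<alpha>' (lam3 s3)" by (simp add: star)
  have "adj M = K"
    using arg_cong[OF ss, of "slice t3 \<one>\<^bsub>S3\<^esub>"] unfolding s0
    by (simp add: adj_add adj_tensor expand)
  then have K: "K = 0" by (simp add: M)
  have s: "\<alpha>' (lam3 s3) = lam3 s3 \<otimes>\<^sub>o L" using s0 by (simp add: K M)
  have comm: "\<alpha>' (lam3 s3) o\<^sub>L \<alpha>' (lam3 t3) = \<alpha>' (lam3 r3) o\<^sub>L \<alpha>' (lam3 s3)"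
    by (simp add: mult S3_table)
  have "L o\<^sub>L A = A o\<^sub>L (A o\<^sub>L L)" "L o\<^sub>L B = B o\<^sub>L (B o\<^sub>L L)"
    using arg_cong[OF comm, of "slice v3 \<one>\<^bsub>S3\<^esub>"] arg_cong[OF comm, of "slice u3 \<one>\<^bsub>S3\<^esub>"] unfolding t s r
    by (simp_all add: expand D.compose_assoc)
  then show ?thesis
    using that[OF in_Q'(1,2,6) t s A B AB0 sum AAA[symmetric] BBB[symmetric]] by blast
qed

text \<open>The partition of unity consists of the cubes of \<open>A\<close> and \<open>B\<close>.  Its block structure is inherited by
  products, so it only has to be seen on the two generators.\<close>

lemma coaction_partition:
  obtains P where "\<And>j. P j \<in> Q'" "\<And>i j. P i o\<^sub>L P j = (if i = j then P i else 0)"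
    "\<And>j. adj (P j) = P j" "P False + P True = unit'"
    "\<And>g j. g \<in> carrier S3 \<Longrightarrow> \<exists>r\<in>Q'.
      \<alpha>' (lam3 g) o\<^sub>L (lam3 \<one>\<^bsub>S3\<^esub> \<otimes>\<^sub>o P j) = lam3 (D.twist j g) \<otimes>\<^sub>o r \<and>
      (lam3 \<one>\<^bsub>S3\<^esub> \<otimes>\<^sub>o P j) o\<^sub>L \<alpha>' (lam3 g) = lam3 (D.twist j g) \<otimes>\<^sub>o r"
proof -
  obtain A B L where in_Q': "A \<in> Q'" "B \<in> Q'" "L \<in> Q'"
    and t: "\<alpha>' (lam3 t3) = lam3 t3 \<otimes>\<^sub>o A + lam3 r3 \<otimes>\<^sub>o B" and s: "\<alpha>' (lam3 s3) = lam3 s3 \<otimes>\<^sub>o L"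
    and adj: "adj A = A o\<^sub>L A" "adj B = B o\<^sub>L B" and AB: "A o\<^sub>L B = 0" "B o\<^sub>L A = 0"
    and sum: "(A o\<^sub>L (A o\<^sub>L A)) + (B o\<^sub>L (B o\<^sub>L B)) = unit'"
    and idem: "A o\<^sub>L (A o\<^sub>L (A o\<^sub>L A)) = A" "B o\<^sub>L (B o\<^sub>L (B o\<^sub>L B)) = B"
    and L: "L o\<^sub>L A = A o\<^sub>L (A o\<^sub>L L)" "L o\<^sub>L B = B o\<^sub>L (B o\<^sub>L L)"
    by (rule coaction_generators)
  have AB': "A o\<^sub>L (B o\<^sub>L X) = 0" "B o\<^sub>L (A o\<^sub>L X) = 0"
    and idem': "A o\<^sub>L (A o\<^sub>L (A o\<^sub>L (A o\<^sub>L X))) = A o\<^sub>L X"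
      "B o\<^sub>L (B o\<^sub>L (B o\<^sub>L (B o\<^sub>L X))) = B o\<^sub>L X"
    and L': "L o\<^sub>L (A o\<^sub>L X) = A o\<^sub>L (A o\<^sub>L (L o\<^sub>L X))" "L o\<^sub>L (B o\<^sub>L X) = B o\<^sub>L (B o\<^sub>L (L o\<^sub>L X))" for X
    using arg_cong[OF AB(1), of "\<lambda>Y. Y o\<^sub>L X"] arg_cong[OF AB(2), of "\<lambda>Y. Y o\<^sub>L X"]
      arg_cong[OF idem(1), of "\<lambda>Y. Y o\<^sub>L X"] arg_cong[OF idem(2), of "\<lambda>Y. Y o\<^sub>L X"]
      arg_cong[OF L(1), of "\<lambda>Y. Y o\<^sub>L X"] arg_cong[OF L(2), of "\<lambda>Y. Y o\<^sub>L X"]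
    by (simp_all add: D.compose_assoc)
  note rewrite = D.compose_assoc AB AB' idem idem' L L'
  note clQ = cstar_algebraD(4)[OF cstar'] and mult = D.coaction_mult[OF cstar' unit' hom']
  note cl = clQ[OF in_Q'(1)] clQ[OF in_Q'(2)] clQ[OF in_Q'(3)] complex_linear_compose
  define P where "P j = (if j then B o\<^sub>L (B o\<^sub>L B) else A o\<^sub>L (A o\<^sub>L A))" for j
  have PQ: "P j \<in> Q'" for j
    using in_Q' cstar_algebraD(1)[OF cstar'] by (simp add: P_def)
  have PP: "P i o\<^sub>L P j = (if i = j then P i else 0)" for i j
    by (cases i; cases j) (simp_all add: P_def rewrite)
  have adjP: "adj (P j) = P j" for j
    by (cases j) (simp_all add: P_def adj_compose cl adj rewrite)
  have blocks: "\<exists>r\<in>Q'. \<alpha>' (lam3 g) o\<^sub>L (lam3 \<one>\<^bsub>S3\<^esub> \<otimes>\<^sub>o P j) = lam3 (D.twist j g) \<otimes>\<^sub>o r \<and>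
      (lam3 \<one>\<^bsub>S3\<^esub> \<otimes>\<^sub>o P j) o\<^sub>L \<alpha>' (lam3 g) = lam3 (D.twist j g) \<otimes>\<^sub>o r"
    if "g \<in> carrier S3" for g j
    using that
  proof (induction rule: S3_induct)
    case t
    show ?case
      by (rule bexI[of _ "if j then B else A"])
         (simp_all add: \<open>\<alpha>' (lam3 t3) = _\<close> P_def in_Q' compose_add tensor_compose cl rewrite)
  next
    case s
    show ?case
      by (rule bexI[of _ "P j o\<^sub>L L"])
         (simp_all add: \<open>\<alpha>' (lam3 s3) = _\<close> P_def in_Q' tensor_compose cl rewrite
            cstar_algebraD(1)[OF cstar'])
  next
    case (mult g h)
    let ?E = "lam3 \<one>\<^bsub>S3\<^esub> \<otimes>\<^sub>o P j"
    obtain p where p: "p \<in> Q'" "\<alpha>' (lam3 g) o\<^sub>L ?E = lam3 (D.twist j g) \<otimes>\<^sub>o p"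
      "?E o\<^sub>L \<alpha>' (lam3 g) = lam3 (D.twist j g) \<otimes>\<^sub>o p" using mult by blast
    obtain q where q: "q \<in> Q'" "\<alpha>' (lam3 h) o\<^sub>L ?E = lam3 (D.twist j h) \<otimes>\<^sub>o q"
      "?E o\<^sub>L \<alpha>' (lam3 h) = lam3 (D.twist j h) \<otimes>\<^sub>o q" using mult by blast
    have comm_h: "(\<alpha>' (lam3 h) o\<^sub>L ?E) o\<^sub>L ?E = ?E o\<^sub>L (\<alpha>' (lam3 h) o\<^sub>L ?E)"
      using q(2,3) by (metis D.compose_assoc)
    have comm_g: "?E o\<^sub>L (?E o\<^sub>L \<alpha>' (lam3 g)) = (?E o\<^sub>L \<alpha>' (lam3 g)) o\<^sub>L ?E"
      using p(2,3) by (metis D.compose_assoc)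
    have EE: "?E o\<^sub>L ?E = ?E" by (simp add: tensor_compose clQ[OF PQ] PP)
    have pq: "(lam3 (D.twist j g) \<otimes>\<^sub>o p) o\<^sub>L (lam3 (D.twist j h) \<otimes>\<^sub>o q) =
        lam3 (D.twist j (g \<otimes>\<^bsub>S3\<^esub> h)) \<otimes>\<^sub>o (p o\<^sub>L q)"
      using mult(1,2) by (simp add: tensor_compose clQ p(1) q(1))
    have "\<alpha>' (lam3 (g \<otimes>\<^bsub>S3\<^esub> h)) o\<^sub>L ?E = \<alpha>' (lam3 g) o\<^sub>L ((\<alpha>' (lam3 h) o\<^sub>L ?E) o\<^sub>L ?E)"
      using mult(1,2) by (simp only: D.compose_assoc EE flip: D.coaction_mult[OF cstar' unit' hom'])
    also have "\<dots> = (\<alpha>' (lam3 g) o\<^sub>L ?E) o\<^sub>L (\<alpha>' (lam3 h) o\<^sub>L ?E)"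
      by (simp only: comm_h) (simp only: D.compose_assoc)
    also have "\<dots> = lam3 (D.twist j (g \<otimes>\<^bsub>S3\<^esub> h)) \<otimes>\<^sub>o (p o\<^sub>L q)"
      by (simp only: p(2) q(2) pq)
    finally have 1: "\<alpha>' (lam3 (g \<otimes>\<^bsub>S3\<^esub> h)) o\<^sub>L ?E =
      lam3 (D.twist j (g \<otimes>\<^bsub>S3\<^esub> h)) \<otimes>\<^sub>o (p o\<^sub>L q)" .
    have "?E o\<^sub>L \<alpha>' (lam3 (g \<otimes>\<^bsub>S3\<^esub> h)) = (?E o\<^sub>L (?E o\<^sub>L \<alpha>' (lam3 g))) o\<^sub>L \<alpha>' (lam3 h)"
      using mult(1,2)
      by (simp only: EE flip: D.coaction_mult[OF cstar' unit' hom'] D.compose_assoc)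
    also have "\<dots> = (?E o\<^sub>L \<alpha>' (lam3 g)) o\<^sub>L (?E o\<^sub>L \<alpha>' (lam3 h))"
      by (simp only: comm_g) (simp only: D.compose_assoc)
    also have "\<dots> = lam3 (D.twist j (g \<otimes>\<^bsub>S3\<^esub> h)) \<otimes>\<^sub>o (p o\<^sub>L q)"
      by (simp only: p(3) q(3) pq)
    finally show ?case
      using 1 cstar_algebraD(1)[OF cstar' p(1) q(1)] by blast
  qed
  show ?thesis
    by (rule that[of P]) (use PQ PP adjP blocks sum in \<open>auto simp: P_def\<close>)
qed

end

lemma ex1_morphism_S3:
  assumes ia: "isometric_action S3 gens3 (Q' :: 'q op set) \<Delta>' \<alpha>'"
  shows "\<exists>!\<Phi>. isometric_action_morphism S3 D.Q.lspan D.\<Delta> D.\<alpha> Q' \<Delta>' \<alpha>' \<Phi>"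
proof -
  note ia' = ia[unfolded isometric_action_def compact_quantum_group_def cqg_action_def
      unital_cstar_algebra_def CS3_eq]
  have cstar': "cstar_algebra Q'" and hom\<Delta>': "unital_star_hom Q' (Q' \<otimes>\<^sub>C Q') \<Delta>'"
    and hom': "unital_star_hom D.CS.lspan (D.CS.lspan \<otimes>\<^sub>C Q') \<alpha>'"
    and coaction': "\<And>a. a \<in> D.CS.lspan \<Longrightarrow> reassoc (tensor_map D.CS.lspan Q' \<alpha>' id (\<alpha>' a)) =
      tensor_map D.CS.lspan Q' id (\<lambda>q. flip (\<Delta>' q)) (\<alpha>' a)"
    using ia' by blast+
  obtain unit' where unit': "is_unit Q' unit'" using ia' by blast
  have levels: "slice h \<one>\<^bsub>S3\<^esub> (\<alpha>' (lam3 g)) = 0"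
    if "g \<in> carrier S3" "h \<in> carrier S3" "word_length S3 gens3 h \<noteq> word_length S3 gens3 g" for g h
    by (rule slice_of_level[OF cstar_algebra_subspace[OF cstar'] that(2),
          of "\<lambda>h. word_length S3 gens3 h = word_length S3 gens3 g"])
       (use ia' that in auto)
  obtain P where P: "\<And>j. P j \<in> Q'" "\<And>i j. P i o\<^sub>L P j = (if i = j then P i else 0)"
    "\<And>j. adj (P j) = P j" "P False + P True = unit'"
    "\<And>g j. g \<in> carrier S3 \<Longrightarrow> \<exists>r\<in>Q'.
      \<alpha>' (lam3 g) o\<^sub>L (lam3 \<one>\<^bsub>S3\<^esub> \<otimes>\<^sub>o P j) = lam3 (D.twist j g) \<otimes>\<^sub>o r \<and>
      (lam3 \<one>\<^bsub>S3\<^esub> \<otimes>\<^sub>o P j) o\<^sub>L \<alpha>' (lam3 g) = lam3 (D.twist j g) \<otimes>\<^sub>o r"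
    by (rule coaction_partition[OF cstar' unit' hom' levels]) blast+
  show ?thesis
    by (rule D.ex1_morphism[OF cstar' unit' hom' P hom\<Delta>' coaction', where k = t3]) simp_all
qed

theorem theorem4p9:
  shows "(\<exists>!\<Delta>. unital_star_hom Q3 (Q3 \<otimes>\<^sub>C Q3) \<Delta> \<and> fundamental_corepresentation Q3 \<Delta> U3) \<and>
         (\<exists>!\<alpha>. unital_star_hom CS3 (CS3 \<otimes>\<^sub>C Q3) \<alpha> \<and>
            \<alpha> (lam3 t3) = lam3 t3 \<otimes>\<^sub>o E3 + lam3 (inv\<^bsub>S3\<^esub> t3) \<otimes>\<^sub>o F3 \<and>
            \<alpha> (lam3 s3) = lam3 s3 \<otimes>\<^sub>o L3) \<and>
         (\<forall>\<Delta> \<alpha>.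
            unital_star_hom Q3 (Q3 \<otimes>\<^sub>C Q3) \<Delta> \<and> fundamental_corepresentation Q3 \<Delta> U3 \<and>
            unital_star_hom CS3 (CS3 \<otimes>\<^sub>C Q3) \<alpha> \<and>
            \<alpha> (lam3 t3) = lam3 t3 \<otimes>\<^sub>o E3 + lam3 (inv\<^bsub>S3\<^esub> t3) \<otimes>\<^sub>o F3 \<and>
            \<alpha> (lam3 s3) = lam3 s3 \<otimes>\<^sub>o L3
            \<longrightarrow> is_QISO_plus TYPE('q) S3 gens3 Q3 \<Delta> \<alpha>)"
proof -
  have \<alpha>_eq: "\<alpha> = D.\<alpha>"
    if "unital_star_hom D.CS.lspan (D.CS.lspan \<otimes>\<^sub>C D.Q.lspan) \<alpha>"
      "\<alpha> (lam3 t3) = lam3 t3 \<otimes>\<^sub>o E3 + lam3 (inv\<^bsub>S3\<^esub> t3) \<otimes>\<^sub>o F3" "\<alpha> (lam3 s3) = lam3 s3 \<otimes>\<^sub>o L3" for \<alpha>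
    by (rule \<alpha>_unique[OF that(1) D.unital_star_hom_\<alpha>]) (simp_all only: that \<alpha>_gens)
  have QISO: "is_QISO_plus TYPE('q) S3 gens3 D.Q.lspan D.\<Delta> D.\<alpha>"
    unfolding is_QISO_plus_def
  proof (intro conjI allI impI S3.is_group symmetric_generating_set_gens3)
    show "isometric_action S3 gens3 D.Q.lspan D.\<Delta> D.\<alpha>"
      by (rule D.isometric_action_\<alpha>) (auto simp: gens3_eq)
  qed (rule ex1_morphism_S3)
  show ?thesis
    unfolding Q3_eq unfolding CS3_eq
  proof (intro conjI allI impI)
    show "\<exists>!\<Delta>. unital_star_hom D.Q.lspan (D.Q.lspan \<otimes>\<^sub>C D.Q.lspan) \<Delta> \<and>
        fundamental_corepresentation D.Q.lspan \<Delta> U3"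
      by (rule ex1I[of _ D.\<Delta>]) (auto intro: D.unital_star_hom_\<Delta> fundamental_U3 \<Delta>_unique)
    show "\<exists>!\<alpha>. unital_star_hom D.CS.lspan (D.CS.lspan \<otimes>\<^sub>C D.Q.lspan) \<alpha> \<and>
        \<alpha> (lam3 t3) = lam3 t3 \<otimes>\<^sub>o E3 + lam3 (inv\<^bsub>S3\<^esub> t3) \<otimes>\<^sub>o F3 \<and> \<alpha> (lam3 s3) = lam3 s3 \<otimes>\<^sub>o L3"
      by (rule ex1I[of _ D.\<alpha>]) (intro conjI D.unital_star_hom_\<alpha> \<alpha>_gens, blast intro: \<alpha>_eq)
    fix \<Delta> \<alpha>
    assume "unital_star_hom D.Q.lspan (D.Q.lspan \<otimes>\<^sub>C D.Q.lspan) \<Delta> \<and>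
        fundamental_corepresentation D.Q.lspan \<Delta> U3 \<and>
        unital_star_hom D.CS.lspan (D.CS.lspan \<otimes>\<^sub>C D.Q.lspan) \<alpha> \<and>
        \<alpha> (lam3 t3) = lam3 t3 \<otimes>\<^sub>o E3 + lam3 (inv\<^bsub>S3\<^esub> t3) \<otimes>\<^sub>o F3 \<and> \<alpha> (lam3 s3) = lam3 s3 \<otimes>\<^sub>o L3"
    then have "\<Delta> = D.\<Delta>" "\<alpha> = D.\<alpha>" using \<Delta>_unique \<alpha>_eq by blast+
    then show "is_QISO_plus TYPE('q) S3 gens3 D.Q.lspan \<Delta> \<alpha>" by (simp only: QISO)
  qed
qed

end
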